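(* Let $\varepsilon > 0$, and let $(V_1, \dots, V_k, E)$ be a $k$-uniform, $k$-partite hypergraph in $\mathbb{R}^d$ that admits a semi-algebraic description of complexity at most $(D, s)$ and satisfies $|E| \geq \varepsilon |V_1|\cdots|V_k|$. Then there exist subsets $W_1 \subseteq V_1, \dots, W_k \subseteq V_k$ such that 1. $W_1 \times W_2 \times \cdots \times W_k \subseteq E$, and 2. $|W_1|\cdot|W_2|\cdots|W_k| = \Omega\left(\varepsilon^{d(k-1)+1}|V_1|\cdot|V_2|\cdots|V_k|\right)$. Furthermore, for all $1 \leq i \leq k-1$, $$|W_i| = \begin{cases} \Omega(\varepsilon^d |V_i|) & \text{if } d \geq 2, \\ \Omega\left(\frac{\varepsilon |V_i|}{\log^2(1/\varepsilon)}\right) & \text{if } d = 1,\end{cases}$$ and $|W_k| = \Omega(\varepsilon |V_k|)$. The implicit constants of proportionality depend only on $d, k, D$ and $s$.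
   Context: A semi-algebraic description in $\mathbb{R}^m$ of complexity $(D,s)$ consists of real polynomials $f_1,\dots,f_s$ in $m$ variables, each of degree at most $D$, and a Boolean formula $\Phi$ in $s$ variables; it describes the set $\{y \in \mathbb{R}^m : \Phi(f_1(y)\le 0,\dots,f_s(y)\le 0)\}$. A $k$-uniform $k$-partite hypergraph $(V_1,\dots,V_k,E)$ in $\mathbb{R}^d$ (with $V_i \subset \mathbb{R}^d$ finite and $E \subseteq V_1\times\cdots\times V_k$) admits a semi-algebraic description of complexity $(D,s)$ if there is a set $Y \subseteq \mathbb{R}^{d\times k}$ with such a description so that $E = Y \cap (V_1\times\cdots\times V_k)$, where a $k$-tuple of points of $\mathbb{R}^d$ is regarded as a vector in $\mathbb{R}^{dk}$.
   Formalization: ε is restricted to 0 < ε ≤ 1 (a larger ε forces an empty part and can make the bounds false), and for d = 1 log(1/ε) is replaced by max(1, ln(1/ε)), since ε/log²(1/ε) is unbounded as ε → 1 and the literal bound fails there. *)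

theory Defs
  imports "HOL-Analysis.Analysis" "HOL-Library.Poly_Mapping" "HOL-Library.FuncSet"
begin

text \<open>
  Real polynomials in variables indexed by \<open>'v\<close>: a monomial is a finitely supported map from
  variables to exponents, a polynomial a finitely supported map from monomials to coefficients.
\<close>

type_synonym 'v monomial = "'v \<Rightarrow>\<^sub>0 nat"
type_synonym 'v real_mpoly = "'v monomial \<Rightarrow>\<^sub>0 real"

definition mpoly_vars :: "'v real_mpoly \<Rightarrow> 'v set" where
  "mpoly_vars p = (\<Union>m\<in>Poly_Mapping.keys p. Poly_Mapping.keys m)"

definition monomial_degree :: "'v monomial \<Rightarrow> nat" where
  "monomial_degree m = (\<Sum>v\<in>Poly_Mapping.keys m. Poly_Mapping.lookup m v)"

text \<open>Total degree; the zero polynomial gets degree 0.\<close>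

definition total_degree :: "'v real_mpoly \<Rightarrow> nat" where
  "total_degree p = Max (insert 0 (monomial_degree ` Poly_Mapping.keys p))"

definition mpoly_eval :: "'v real_mpoly \<Rightarrow> ('v \<Rightarrow> real) \<Rightarrow> real" where
  "mpoly_eval p y = (\<Sum>m\<in>Poly_Mapping.keys p. Poly_Mapping.lookup p m * (\<Prod>v\<in>Poly_Mapping.keys m. y v ^ Poly_Mapping.lookup m v))"

datatype (atoms: 'a) bool_formula =
    Const bool
  | Atom 'a
  | Neg "'a bool_formula"
  | Conj "'a bool_formula" "'a bool_formula"
  | Disj "'a bool_formula" "'a bool_formula"

primrec holds :: "'a bool_formula \<Rightarrow> ('a \<Rightarrow> bool) \<Rightarrow> bool" where
  "holds (Const b) \<beta> \<longleftrightarrow> b"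
| "holds (Atom a) \<beta> \<longleftrightarrow> \<beta> a"
| "holds (Neg \<phi>) \<beta> \<longleftrightarrow> \<not> holds \<phi> \<beta>"
| "holds (Conj \<phi> \<psi>) \<beta> \<longleftrightarrow> holds \<phi> \<beta> \<and> holds \<psi> \<beta>"
| "holds (Disj \<phi> \<psi>) \<beta> \<longleftrightarrow> holds \<phi> \<beta> \<or> holds \<psi> \<beta>"

text \<open>
  The space \<open>\<real>\<^sup>m\<close> is taken with its coordinates indexed by a set \<open>I\<close> of \<open>m\<close> elements, as the
  functions \<open>I \<rightarrow>\<^sub>E UNIV\<close>, so that \<open>\<real>\<^sup>d\<^sup>k\<close> below can be used with pairs as coordinates.
\<close>

definition semialgebraic_description ::
    "'v set \<Rightarrow> nat \<Rightarrow> nat \<Rightarrow> ('v \<Rightarrow> real) set \<Rightarrow> bool" where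
  "semialgebraic_description I D s Y \<longleftrightarrow>
    (\<exists>(f :: nat \<Rightarrow> 'v real_mpoly) (\<Phi> :: nat bool_formula).
        (\<forall>j\<in>{1..s}. mpoly_vars (f j) \<subseteq> I \<and> total_degree (f j) \<le> D) \<and>
        atoms \<Phi> \<subseteq> {1..s} \<and>
        Y = {y \<in> I \<rightarrow>\<^sub>E UNIV. holds \<Phi> (\<lambda>j. mpoly_eval (f j) y \<le> 0)})"

text \<open>The product \<open>V\<^sub>1 \<times> \<dots> \<times> V\<^sub>k\<close> is the set of functions \<open>Pi\<^sub>E {1..k} V\<close>.\<close>

definition kpartite_hypergraph :: "nat \<Rightarrow> (nat \<Rightarrow> 'a set) \<Rightarrow> (nat \<Rightarrow> 'a) set \<Rightarrow> bool" where
  "kpartite_hypergraph k V E \<longleftrightarrow> (\<forall>i\<in>{1..k}. finite (V i)) \<and> E \<subseteq> Pi\<^sub>E {1..k} V"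

text \<open>A \<open>k\<close>-tuple of points of \<open>\<real>\<^sup>d\<close>, regarded as a vector in \<open>\<real>\<^sup>d\<^sup>k\<close>.\<close>

definition tuple_vector :: "nat \<Rightarrow> (nat \<Rightarrow> real ^ 'd) \<Rightarrow> ('d \<times> nat \<Rightarrow> real)" where
  "tuple_vector k x = (\<lambda>(a, i) \<in> UNIV \<times> {1..k}. x i $ a)"

definition hypergraph_semialgebraic ::
    "nat \<Rightarrow> (nat \<Rightarrow> (real ^ 'd::finite) set) \<Rightarrow> (nat \<Rightarrow> real ^ 'd) set \<Rightarrow> nat \<Rightarrow> nat \<Rightarrow> bool" where
  "hypergraph_semialgebraic k V E D s \<longleftrightarrow>
    (\<exists>Y. semialgebraic_description (UNIV \<times> {1..k}) D s Y \<and>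
         E = {x \<in> Pi\<^sub>E {1..k} V. tuple_vector k x \<in> Y})"

definition hypergraph_complexity_at_most ::
    "nat \<Rightarrow> (nat \<Rightarrow> (real ^ 'd::finite) set) \<Rightarrow> (nat \<Rightarrow> real ^ 'd) set \<Rightarrow> nat \<Rightarrow> nat \<Rightarrow> bool" where
  "hypergraph_complexity_at_most k V E D s \<longleftrightarrow>
    (\<exists>D'\<le>D. \<exists>s'\<le>s. hypergraph_semialgebraic k V E D' s')"

text \<open>
  The guaranteed density of the first \<open>k - 1\<close> parts. In dimension 1 the logarithm is truncated
  from below at 1: \<open>\<epsilon> / log\<^sup>2 (1/\<epsilon>)\<close> is meant for small \<open>\<epsilon>\<close>, since it is unbounded as \<open>\<epsilon> \<rightarrow> 1\<close>.
\<close>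

definition part_density :: "nat \<Rightarrow> real \<Rightarrow> real" where
  "part_density d \<epsilon> = (if d \<ge> 2 then \<epsilon> ^ d else \<epsilon> / (max 1 (ln (1 / \<epsilon>)))\<^sup>2)"

end

theory Submission
  imports Defs
begin

text \<open>
  Fix one part \<open>X\<close> and let \<open>Y\<close> be the product of the others. Polynomials of bounded degree
  cut \<open>\<real>\<^sup>d\<close> into \<open>O(m\<^sup>d)\<close> sign classes, so a random sample of \<open>m\<close> elements of \<open>Y\<close> splits \<open>X\<close> into \<open>O(m\<^sup>d)\<close>
  classes; Haussler's unit-distance argument shows that a further element of \<open>Y\<close> splits off, on average, at most a
  fraction \<open>O(1/m)\<close> of the points from the majority of their class. Applied with \<open>m \<approx> 1/a\<close> to the points of \<open>X\<close> of degree about \<open>a |Y|\<close>, for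
  a suitable \<open>a = 2\<^sup>j \<epsilon> / 4\<close>, this yields a class of size \<open>\<Omega>(\<epsilon> a\<^sup>d\<^sup>-\<^sup>1 / j\<^sup>2) |X|\<close> whose points
  have nearly the same link. Recursion into the link of one of them gives a box of the required size in which
  \<open>E\<close> has density \<open>1 - \<eta>\<close>, for any constant \<open>\<eta>\<close>.

  A box of density \<open>1 - \<eta>\<close> contains a complete one of a constant fraction of its size: all defining polynomials have
  constant sign on some subbox, by a multidimensional search in the style of Megiddo on the linearized
  polynomials, and this subbox is too large to be disjoint from \<open>E\<close>.
\<close>

section \<open>Sign patterns of polynomials\<close>

text \<open>The sample size has to follow the degree: with \<open>m\<close> of order
  \<open>1 / a\<close> the error is of order \<open>a * |Y|\<close>, small against a link only if
  the link itself has about \<open>a * |Y|\<close> elements. Up to a weight, the chosen level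
  \<open>a\<close> holds a fraction \<open>\<epsilon> / a\<close> of \<open>X\<close>, and a class
  the fraction \<open>a ^ d\<close> of that, whence the exponent \<open>d - 1\<close>. A link of
  density \<open>a\<close> contributes \<open>a ^ (d * (k - 2) + 1)\<close> by recursion, so the box
  has size about \<open>\<epsilon> * a ^ (d * (k - 1))\<close>. As \<open>a\<close> exceeds
  \<open>\<epsilon> / 4\<close> by \<open>2 ^ j\<close>, this absorbs the weight even for
  \<open>d = 1\<close>, and a logarithm survives only in the sizes of single parts. The last part is
  never partitioned, it only becomes a link; hence its bound linear in \<open>\<epsilon>\<close>.

  The obstacle is that the points of a class share their links only approximately. So two predicates
  are carried along: \<open>e\<close>, the edge relation with some points fixed, defines the links
  and keeps its pattern bound; \<open>f\<close> says what most tuples of the final box must satisfy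
  and absorbs the averaging over classes.\<close>

inductive polyfun :: "nat \<Rightarrow> (real ^ 'd::finite \<Rightarrow> real) \<Rightarrow> bool" where
  const: "polyfun n (\<lambda>p. c)"
| coord: "polyfun (Suc n) (\<lambda>p. p $ a)"
| add: "polyfun n f \<Longrightarrow> polyfun n g \<Longrightarrow> polyfun n (\<lambda>p. f p + g p)"
| mult: "polyfun m f \<Longrightarrow> polyfun n g \<Longrightarrow> polyfun (m + n) (\<lambda>p. f p * g p)"

lemma polyfun_mono:
  assumes "polyfun n f" "n \<le> m"
  shows "polyfun m f"
  using polyfun.mult[OF assms(1) polyfun.const[of "m - n" 1]] assms(2) by simp

lemma polyfun_scale: "polyfun n f \<Longrightarrow> polyfun n (\<lambda>p. c * f p)"
  using polyfun.mult[OF polyfun.const[of 0 c]] by simp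

lemma polyfun_diff: "polyfun n f \<Longrightarrow> polyfun n g \<Longrightarrow> polyfun n (\<lambda>p. f p - g p)"
  using polyfun.add[OF _ polyfun_scale[of n g "-1"], of f] by simp

lemma polyfun_sum:
  "finite A \<Longrightarrow> (\<And>i. i \<in> A \<Longrightarrow> polyfun n (f i)) \<Longrightarrow> polyfun n (\<lambda>p. \<Sum>i\<in>A. f i p)"
  by (induction A rule: finite_induct) (auto intro: polyfun.const polyfun.add)

lemma polyfun_prod:
  "finite A \<Longrightarrow> (\<And>i. i \<in> A \<Longrightarrow> polyfun n (f i)) \<Longrightarrow> polyfun (card A * n) (\<lambda>p. \<Prod>i\<in>A. f i p)"
  by (induction A rule: finite_induct) (auto intro: polyfun.const polyfun.mult)

definition mon :: "('d::finite \<Rightarrow> nat) \<Rightarrow> real ^ 'd \<Rightarrow> real" where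
  "mon \<alpha> p = (\<Prod>a\<in>UNIV. (p $ a) ^ \<alpha> a)"

text \<open>A box of exponents rather than the simplex of total degree at most \<open>n\<close>: its
  size is the plain power \<open>(n + 1) ^ d\<close>, larger only by a factor depending on
  \<open>d\<close>.\<close>

definition exponents :: "nat \<Rightarrow> ('d::finite \<Rightarrow> nat) set" where
  "exponents n = {\<alpha>. \<forall>a. \<alpha> a \<le> n}"

lemma exponents_PiE: "exponents n = PiE UNIV (\<lambda>_. {..n})"
  by (auto simp: exponents_def PiE_iff)

lemma finite_exponents [simp]: "finite (exponents n)"
  unfolding exponents_PiE by (rule finite_PiE) auto

lemma card_exponents: "card (exponents n :: ('d::finite \<Rightarrow> nat) set) = Suc n ^ CARD('d)"
  unfolding exponents_PiE by (simp add: card_PiE)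

lemma mon_add: "mon \<alpha> p * mon \<beta> p = mon (\<lambda>a. \<alpha> a + \<beta> a) p"
  by (simp add: mon_def power_add prod.distrib)

text \<open>Terms are grouped by exponent, since in a product of two expansions several pairs of
  monomials give the same one.\<close>

lemma monomial_sum_collect:
  assumes "finite T" "\<And>t. t \<in> T \<Longrightarrow> h t \<in> exponents n"
  shows "\<exists>c. \<forall>p. (\<Sum>t\<in>T. b t * mon (h t) p) = (\<Sum>\<alpha>\<in>exponents n. c \<alpha> * mon \<alpha> p)"
proof (intro exI allI)
  fix p
  have "(\<Sum>t\<in>T. b t * mon (h t) p) = (\<Sum>\<alpha>\<in>exponents n. \<Sum>t\<in>{t\<in>T. h t = \<alpha>}. b t * mon (h t) p)"
    using assms by (intro sum.group[symmetric]) auto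
  also have "\<dots> = (\<Sum>\<alpha>\<in>exponents n. (\<Sum>t\<in>{t\<in>T. h t = \<alpha>}. b t) * mon \<alpha> p)"
    by (intro sum.cong refl) (simp add: sum_distrib_right)
  finally show "(\<Sum>t\<in>T. b t * mon (h t) p) = (\<Sum>\<alpha>\<in>exponents n. (\<Sum>t\<in>{t\<in>T. h t = \<alpha>}. b t) * mon \<alpha> p)" .
qed

lemma polyfun_coefficients:
  "polyfun n f \<Longrightarrow> \<exists>c. \<forall>p. f p = (\<Sum>\<alpha>\<in>exponents n. c \<alpha> * mon \<alpha> p)"
proof (induction rule: polyfun.induct)
  case (const n c)
  \<comment> \<open>A constant is a one-term sum with exponent zero, indexed by the unit
    type.\<close>
  show ?case
    using monomial_sum_collect[of "{()}" "\<lambda>_ _. 0" n "\<lambda>_. c"] by (simp add: exponents_def mon_def)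
next
  case (coord n a)
  have "mon (\<lambda>b. if b = a then 1 else 0) p = p $ a" for p :: "real ^ 'a"
    unfolding mon_def by (subst prod.mono_neutral_right[of UNIV "{a}"]) auto
  then show ?case
    using monomial_sum_collect[of "{()}" "\<lambda>_ b. if b = a then 1 else 0" "Suc n" "\<lambda>_. 1"]
    by (simp add: exponents_def)
next
  case (add n f g)
  then obtain c c' where "\<And>p. f p = (\<Sum>\<alpha>\<in>exponents n. c \<alpha> * mon \<alpha> p)" "\<And>p. g p = (\<Sum>\<alpha>\<in>exponents n. c' \<alpha> * mon \<alpha> p)"
    by blast
  then have "\<forall>p. f p + g p = (\<Sum>\<alpha>\<in>exponents n. (c \<alpha> + c' \<alpha>) * mon \<alpha> p)"
    by (simp add: algebra_simps sum.distrib)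
  then show ?case by (intro exI[of _ "\<lambda>\<alpha>. c \<alpha> + c' \<alpha>"])
next
  case (mult m f n g)
  then obtain c c' where c: "\<And>p. f p = (\<Sum>\<alpha>\<in>exponents m. c \<alpha> * mon \<alpha> p)" "\<And>p. g p = (\<Sum>\<alpha>\<in>exponents n. c' \<alpha> * mon \<alpha> p)"
    by blast
  have "f p * g p = (\<Sum>t\<in>exponents m \<times> exponents n. (c (fst t) * c' (snd t)) * mon (\<lambda>a. fst t a + snd t a) p)" for p
    unfolding c sum_product sum.cartesian_product
    by (intro sum.cong refl) (auto simp: mon_add[symmetric])
  moreover have "\<exists>e. \<forall>p. (\<Sum>t\<in>exponents m \<times> exponents n. (c (fst t) * c' (snd t)) * mon (\<lambda>a. fst t a + snd t a) p)
      = (\<Sum>\<alpha>\<in>exponents (m + n). e \<alpha> * mon \<alpha> p)"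
  proof (rule monomial_sum_collect)
    show "finite (exponents m \<times> exponents n)" by simp
    show "(\<lambda>a. fst t a + snd t a) \<in> exponents (m + n)" if "t \<in> exponents m \<times> exponents n" for t
      using that by (auto simp: exponents_def intro: add_mono)
  qed
  ultimately show ?case by simp
qed

text \<open>The partial derivatives get the bound \<open>n\<close> of the function itself instead of
  \<open>n - 1\<close>: the product rule then needs no case distinction, and the order of the final
  count is the same.\<close>

lemma polyfun_gradient:
  "polyfun n f \<Longrightarrow> \<exists>G. (\<forall>a. polyfun n (\<lambda>p. G p $ a)) \<and> (\<forall>p. (f has_derivative (\<lambda>h. G p \<bullet> h)) (at p))"
proof (induction rule: polyfun.induct)
  case (const n c)
  show ?case by (intro exI[of _ "\<lambda>p. 0"]) (auto intro: polyfun.const)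
next
  case (coord n a)
  have "((\<lambda>p. p $ a) has_derivative (\<lambda>h. axis a 1 \<bullet> h)) (at p)" for p :: "real ^ 'a"
    by (simp add: inner_axis' has_derivative_bounded_linear bounded_linear_vec_nth bounded_linear_imp_has_derivative)
  then show ?case by (intro exI[of _ "\<lambda>p. axis a 1"]) (auto simp: axis_def intro: polyfun.const)
next
  case (add n f g)
  then obtain F G where FG: "\<And>a. polyfun n (\<lambda>p. F p $ a)" "\<And>p. (f has_derivative (\<lambda>h. F p \<bullet> h)) (at p)"
    "\<And>a. polyfun n (\<lambda>p. G p $ a)" "\<And>p. (g has_derivative (\<lambda>h. G p \<bullet> h)) (at p)" by blast
  have "((\<lambda>p. f p + g p) has_derivative (\<lambda>h. (F p + G p) \<bullet> h)) (at p)" for p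
    using has_derivative_add[OF FG(2,4)] by (simp add: inner_add_left)
  moreover have "polyfun n (\<lambda>p. (F p + G p) $ a)" for a
    using polyfun.add[OF FG(1,3)] by simp
  ultimately show ?case by (intro exI[of _ "\<lambda>p. F p + G p"]) blast
next
  case (mult m f n g)
  then obtain F G where FG: "\<And>a. polyfun m (\<lambda>p. F p $ a)" "\<And>p. (f has_derivative (\<lambda>h. F p \<bullet> h)) (at p)"
    "\<And>a. polyfun n (\<lambda>p. G p $ a)" "\<And>p. (g has_derivative (\<lambda>h. G p \<bullet> h)) (at p)" by blast
  have "((\<lambda>p. f p * g p) has_derivative (\<lambda>h. (f p *\<^sub>R G p + g p *\<^sub>R F p) \<bullet> h)) (at p)" for p
    using has_derivative_mult[OF FG(2,4)] by (simp add: inner_add_left mult.commute)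
  moreover have "polyfun (m + n) (\<lambda>p. (f p *\<^sub>R G p + g p *\<^sub>R F p) $ a)" for a
    using polyfun.add[OF polyfun.mult[OF mult.hyps(1) FG(3)] polyfun.mult[OF FG(1) mult.hyps(2)], of a a]
    by (simp add: mult.commute)
  ultimately show ?case by (intro exI[of _ "\<lambda>p. f p *\<^sub>R G p + g p *\<^sub>R F p"]) blast
qed

section \<open>Dimension counts and interpolation\<close>

lemma underdetermined_system:
  fixes c :: "'q \<Rightarrow> 'b \<Rightarrow> real"
  assumes "finite B" "finite Q" "card B < card Q"
  shows "\<exists>l. (\<exists>q\<in>Q. l q \<noteq> 0) \<and> (\<forall>\<beta>\<in>B. (\<Sum>q\<in>Q. l q * c q \<beta>) = 0)"
  using assms
proof (induction B arbitrary: Q c)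
  case empty
  then obtain q where "q \<in> Q" by fastforce
  then show ?case by (intro exI[of _ "\<lambda>_. 1"]) auto
next
  case (insert \<beta>0 B)
  show ?case
  proof (cases "\<forall>q\<in>Q. c q \<beta>0 = 0")
    case True
    have "card B < card Q" using insert by simp
    then obtain l where l: "\<exists>q\<in>Q. l q \<noteq> 0" "\<forall>\<beta>\<in>B. (\<Sum>q\<in>Q. l q * c q \<beta>) = 0"
      using insert.IH[OF insert.prems(1), of c] by blast
    show ?thesis using True l by (intro exI[of _ l]) auto
  next
    case False
    then obtain q0 where q0: "q0 \<in> Q" "c q0 \<beta>0 \<noteq> 0" by blast
    define Q' where "Q' = Q - {q0}"
    have Q': "finite Q'" "Q = insert q0 Q'" "q0 \<notin> Q'" using q0 insert.prems by (auto simp: Q'_def)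
    have "card B < card Q'" using insert Q' by simp
    then obtain l where l: "\<exists>q\<in>Q'. l q \<noteq> 0"
      "\<forall>\<beta>\<in>B. (\<Sum>q\<in>Q'. l q * (c q \<beta> - c q \<beta>0 / c q0 \<beta>0 * c q0 \<beta>)) = 0"
      using insert.IH[OF Q'(1), of "\<lambda>q \<beta>. c q \<beta> - c q \<beta>0 / c q0 \<beta>0 * c q0 \<beta>"] by blast
    \<comment> \<open>The value of the unknown \<open>q0\<close> that solves the equation
      \<open>\<beta>0\<close> for the given other unknowns; the reduced coefficients above arise by
      substituting it into the remaining equations.\<close>
    define z where "z = - (\<Sum>q\<in>Q'. l q * c q \<beta>0) / c q0 \<beta>0"
    define l' where "l' = l(q0 := z)"
    have sum_l': "(\<Sum>q\<in>Q. l' q * c q \<beta>) = z * c q0 \<beta> + (\<Sum>q\<in>Q'. l q * c q \<beta>)" for \<beta>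
    proof -
      have "(\<Sum>q\<in>Q'. l' q * c q \<beta>) = (\<Sum>q\<in>Q'. l q * c q \<beta>)"
        using Q'(3) by (intro sum.cong) (auto simp: l'_def)
      then show ?thesis unfolding Q'(2) using Q'(1,3) by (simp add: l'_def)
    qed
    have "(\<Sum>q\<in>Q. l' q * c q \<beta>) = 0" if "\<beta> \<in> insert \<beta>0 B" for \<beta>
    proof (cases "\<beta> = \<beta>0")
      case True
      then show ?thesis using q0(2) by (simp add: sum_l' z_def)
    next
      case False
      then have "(\<Sum>q\<in>Q'. l q * (c q \<beta> - c q \<beta>0 / c q0 \<beta>0 * c q0 \<beta>)) = 0" using l(2) that by blast
      also have "(\<Sum>q\<in>Q'. l q * (c q \<beta> - c q \<beta>0 / c q0 \<beta>0 * c q0 \<beta>))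
          = (\<Sum>q\<in>Q'. l q * c q \<beta>) - (\<Sum>q\<in>Q'. l q * c q \<beta>0 * (c q0 \<beta> / c q0 \<beta>0))"
        unfolding sum_subtractf[symmetric] by (intro sum.cong) (auto simp: field_simps)
      also have "\<dots> = z * c q0 \<beta> + (\<Sum>q\<in>Q'. l q * c q \<beta>)"
        unfolding sum_distrib_right[symmetric] z_def by simp
      finally show ?thesis using sum_l' by simp
    qed
    moreover have "\<exists>q\<in>Q. l' q \<noteq> 0" using l(1) Q' by (auto simp: l'_def)
    ultimately show ?thesis by blast
  qed
qed

text \<open>Functions that vanish at all points but their own are linearly independent: evaluating a
  dependence at \<open>x q0\<close> leaves only the term with \<open>l q0\<close>. So there are at
  most as many of them as monomials.\<close>

lemma polyfun_interpolation_bound: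
  fixes h :: "'q \<Rightarrow> real ^ 'd::finite \<Rightarrow> real"
  assumes fin: "finite Q" and poly: "\<And>q. q \<in> Q \<Longrightarrow> polyfun n (h q)"
    and diag: "\<And>q q'. q \<in> Q \<Longrightarrow> q' \<in> Q \<Longrightarrow> h q (x q') = 0 \<longleftrightarrow> q \<noteq> q'"
  shows "card Q \<le> Suc n ^ CARD('d)"
proof (rule ccontr)
  assume "\<not> card Q \<le> Suc n ^ CARD('d)"
  then have less: "card (exponents n :: ('d \<Rightarrow> nat) set) < card Q" by (simp add: card_exponents)
  have "\<forall>q\<in>Q. \<exists>c. \<forall>p. h q p = (\<Sum>\<alpha>\<in>exponents n. c \<alpha> * mon \<alpha> p)"
    using polyfun_coefficients[OF poly] by blast
  then obtain c where c: "\<And>q p. q \<in> Q \<Longrightarrow> h q p = (\<Sum>\<alpha>\<in>exponents n. c q \<alpha> * mon \<alpha> p)"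
    by metis
  obtain l where l: "\<exists>q\<in>Q. l q \<noteq> 0" "\<And>\<alpha>. \<alpha> \<in> exponents n \<Longrightarrow> (\<Sum>q\<in>Q. l q * c q \<alpha>) = 0"
    using underdetermined_system[OF finite_exponents fin less, of c] by blast
  have zero: "(\<Sum>q\<in>Q. l q * h q p) = 0" for p
  proof -
    have "(\<Sum>q\<in>Q. l q * h q p) = (\<Sum>q\<in>Q. \<Sum>\<alpha>\<in>exponents n. l q * c q \<alpha> * mon \<alpha> p)"
      by (intro sum.cong refl) (simp add: c sum_distrib_left mult.assoc)
    also have "\<dots> = (\<Sum>\<alpha>\<in>exponents n. \<Sum>q\<in>Q. l q * c q \<alpha> * mon \<alpha> p)" by (rule sum.swap)
    also have "\<dots> = (\<Sum>\<alpha>\<in>exponents n. (\<Sum>q\<in>Q. l q * c q \<alpha>) * mon \<alpha> p)"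
      by (intro sum.cong refl) (rule sum_distrib_right[symmetric])
    also have "\<dots> = 0" by (simp add: l(2))
    finally show ?thesis .
  qed
  obtain q0 where q0: "q0 \<in> Q" "l q0 \<noteq> 0" using l(1) by blast
  have "(\<Sum>q\<in>Q. l q * h q (x q0)) = l q0 * h q0 (x q0)"
  proof -
    have "(\<Sum>q\<in>Q - {q0}. l q * h q (x q0)) = 0"
      using diag[OF _ q0(1)] by (intro sum.neutral) auto
    then show ?thesis using fin q0(1) by (simp add: sum.remove)
  qed
  then show False using zero[of "x q0"] q0 diag[of q0 q0] by simp
qed

text \<open>Interpolation on the fibres of \<open>F\<close> over a grid of \<open>(M + 1)\<^sup>d\<close> values, \<open>M\<close> points being taken in each fibre:
  the degree needed grows only linearly in \<open>M\<close>, which bounds \<open>M\<close>. This replaces Bezout's theorem.\<close>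

lemma polynomial_map_fibres:
  fixes F :: "real ^ 'd::finite \<Rightarrow> real ^ 'd"
  assumes poly: "\<And>a. polyfun n (\<lambda>p. F p $ a)" and \<kappa>: "0 < \<kappa>" and fin: "finite S"
    and fibre: "\<And>v. (\<And>a. 0 \<le> v $ a \<and> v $ a \<le> \<kappa>) \<Longrightarrow> \<exists>x. inj_on x S \<and> (\<forall>s\<in>S. F (x s) = v)"
  shows "card S \<le> (CARD('d) * n + 1) ^ CARD('d)"
proof (cases "card S = 0")
  case False
  \<comment> \<open>\<open>M\<close> is both the number of points per fibre and the grid parameter:
    \<open>(M + 1) ^ d * M\<close> interpolation conditions face a space of dimension
    \<open>(M * (d * n + 1)) ^ d\<close>, so the powers of \<open>M\<close> cancel and leave the
    bound.\<close>
  define M where "M = card S"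
  have M: "M > 0" using False by (simp add: M_def)
  define val where "val t = \<kappa> * real t / real (M + 1)" for t
  have val_inj: "val t = val t' \<longleftrightarrow> t = t'" for t t' using \<kappa> by (simp add: val_def)
  have val_range: "0 \<le> val t" "t \<le> M \<Longrightarrow> val t \<le> \<kappa>" for t
    using \<kappa> by (auto simp: val_def divide_le_eq)
  have "\<exists>x. inj_on x S \<and> (\<forall>s\<in>S. F (x s) = (\<chi> a. val (\<iota> a)))" if "\<iota> \<in> exponents M" for \<iota> :: "'d \<Rightarrow> nat"
    using that by (intro fibre) (auto simp: exponents_def val_range)
  then obtain x where x: "\<And>\<iota>. \<iota> \<in> exponents M \<Longrightarrow> inj_on (x \<iota>) S"
    "\<And>\<iota> s a. \<iota> \<in> exponents M \<Longrightarrow> s \<in> S \<Longrightarrow> F (x \<iota> s) $ a = val (\<iota> a)"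
    by (metis vec_lambda_beta)
  define ax where "ax \<iota> s s' = (SOME a. x \<iota> s $ a \<noteq> x \<iota> s' $ a)" for \<iota> s s'
  have ax: "x \<iota> s $ ax \<iota> s s' \<noteq> x \<iota> s' $ ax \<iota> s s'"
    if "\<iota> \<in> exponents M" "s \<in> S" "s' \<in> S" "s \<noteq> s'" for \<iota> s s'
  proof -
    have "x \<iota> s \<noteq> x \<iota> s'" using x(1) that by (auto dest: inj_onD)
    then have "\<exists>a. x \<iota> s $ a \<noteq> x \<iota> s' $ a" by (auto simp: vec_eq_iff)
    then show ?thesis unfolding ax_def by (rule someI_ex)
  qed
  \<comment> \<open>\<open>h1\<close> vanishes on the fibres over all other grid points,
    \<open>h2\<close> at the other chosen points of the fibre over \<open>\<iota>\<close>, with one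
    linear factor for each. The degrees are \<open>d * M * n\<close> and
    \<open>M - 1\<close>.\<close>
  define h1 where "h1 \<iota> p = (\<Prod>a\<in>UNIV. \<Prod>t\<in>{..M} - {\<iota> a}. F p $ a - val t)" for \<iota> p
  define h2 where "h2 \<iota> s p = (\<Prod>s'\<in>S - {s}. p $ ax \<iota> s s' - x \<iota> s' $ ax \<iota> s s')" for \<iota> s p
  define h where "h = (\<lambda>(\<iota>, s) p. h1 \<iota> p * h2 \<iota> s p)"
  define Q where "Q = (exponents M :: ('d \<Rightarrow> nat) set) \<times> S"
  have deg: "polyfun (CARD('d) * (M * n) + (M - 1)) (h q)" if q: "q \<in> Q" for q
  proof -
    obtain \<iota> s where q: "q = (\<iota>, s)" "\<iota> \<in> exponents M" "s \<in> S" using q by (auto simp: Q_def)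
    have "polyfun (M * n) (\<lambda>p. \<Prod>t\<in>{..M} - {\<iota> a}. F p $ a - val t)" for a
    proof -
      have "card ({..M} - {\<iota> a}) = M" using q(2) by (simp add: exponents_def)
      then show ?thesis
        using polyfun_prod[of "{..M} - {\<iota> a}" n "\<lambda>t p. F p $ a - val t"]
        by (simp add: polyfun_diff poly polyfun.const)
    qed
    then have 1: "polyfun (CARD('d) * (M * n)) (h1 \<iota>)"
      using polyfun_prod[of "UNIV :: 'd set" "M * n" "\<lambda>a p. \<Prod>t\<in>{..M} - {\<iota> a}. F p $ a - val t"]
      by (simp add: h1_def[abs_def])
    have "card (S - {s}) = M - 1" using q(3) fin by (simp add: M_def)
    then have 2: "polyfun (M - 1) (h2 \<iota> s)"
      using polyfun_prod[of "S - {s}" 1 "\<lambda>s' p. p $ ax \<iota> s s' - x \<iota> s' $ ax \<iota> s s'"] fin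
      by (simp add: h2_def[abs_def] polyfun_diff polyfun.const polyfun.coord)
    show ?thesis using polyfun.mult[OF 1 2] by (simp add: h_def q)
  qed
  have "card Q \<le> Suc (CARD('d) * (M * n) + (M - 1)) ^ CARD('d)"
  proof (rule polyfun_interpolation_bound[where h = h and x = "\<lambda>(\<iota>, s). x \<iota> s"])
    show "finite Q" using fin by (simp add: Q_def)
    show "polyfun (CARD('d) * (M * n) + (M - 1)) (h q)" if "q \<in> Q" for q using deg that .
    fix q q' assume "q \<in> Q" "q' \<in> Q"
    then obtain \<iota> s \<iota>' s' where q: "q = (\<iota>, s)" "q' = (\<iota>', s')"
      "\<iota> \<in> exponents M" "\<iota>' \<in> exponents M" "s \<in> S" "s' \<in> S"
      by (auto simp: Q_def)
    have h1: "h1 \<iota> (x \<iota>' s') = 0 \<longleftrightarrow> \<iota> \<noteq> \<iota>'"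
    proof -
      have "h1 \<iota> (x \<iota>' s') = 0 \<longleftrightarrow> (\<exists>a. \<exists>t\<in>{..M} - {\<iota> a}. val (\<iota>' a) = val t)"
        using q x(2)[of \<iota>' s'] by (simp add: h1_def)
      also have "\<dots> \<longleftrightarrow> (\<exists>a. \<iota>' a \<noteq> \<iota> a)"
        unfolding val_inj using q by (auto simp: exponents_def)
      finally show ?thesis by (metis ext)
    qed
    have h2: "h2 \<iota> s (x \<iota> s') = 0 \<longleftrightarrow> s \<noteq> s'"
    proof (cases "s = s'")
      case True
      have "h2 \<iota> s (x \<iota> s) \<noteq> 0"
        using ax[OF q(3) q(5)] fin by (auto simp: h2_def)
      then show ?thesis using True by simp
    next
      case False
      then show ?thesis using q fin by (auto simp: h2_def)
    qed
    show "h q ((\<lambda>(\<iota>, s). x \<iota> s) q') = 0 \<longleftrightarrow> q \<noteq> q'"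
      using h1 h2 by (auto simp: q h_def)
  qed
  also have "Suc (CARD('d) * (M * n) + (M - 1)) = M * (CARD('d) * n + 1)"
    using M by (simp add: algebra_simps)
  also have "card Q = (M + 1) ^ CARD('d) * M"
    by (simp add: Q_def card_cartesian_product card_exponents M_def)
  finally have "(M + 1) ^ CARD('d) * M \<le> M ^ CARD('d) * (CARD('d) * n + 1) ^ CARD('d)"
    by (simp only: power_mult_distrib)
  also have "\<dots> \<le> (M + 1) ^ CARD('d) * (CARD('d) * n + 1) ^ CARD('d)"
    by (intro mult_right_mono power_mono) auto
  finally show ?thesis by (simp add: M_def)
qed simp

text \<open>After shifting the \<open>f j\<close> by a constant, every sign condition that occurs in a large ball is open, and on it the product
  \<open>G\<close> of all \<open>f j\<close> and of \<open>R - |p|\<^sup>2\<close> vanishes exactly at the boundary. So for every small \<open>v\<close> the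
  function \<open>\<bar>G\<bar> \<mp> \<langle>v, p\<rangle>\<close> has an interior maximum there, a point of the fibre of \<open>\<nabla>G\<close> over \<open>v\<close>.\<close>

lemma card_sign_patterns:
  fixes f :: "'j \<Rightarrow> real ^ 'd::finite \<Rightarrow> real"
  assumes finJ: "finite J" and finP: "finite P" and poly: "\<And>j. j \<in> J \<Longrightarrow> polyfun D (f j)"
  shows "card ((\<lambda>p. {j\<in>J. f j p \<le> 0}) ` P) \<le> (CARD('d) * (card J * D + 2) + 1) ^ CARD('d)"
proof (cases "P = {}")
  case False
  define S where "S = (\<lambda>p. {j\<in>J. f j p \<le> 0}) ` P"
  have finS: "finite S" using finP by (simp add: S_def)
  define z where "z s = (SOME p. p \<in> P \<and> {j\<in>J. f j p \<le> 0} = s)" for s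
  have z: "z s \<in> P" "{j\<in>J. f j (z s) \<le> 0} = s" if "s \<in> S" for s
  proof -
    have "\<exists>p. p \<in> P \<and> {j\<in>J. f j p \<le> 0} = s" using that by (auto simp: S_def)
    then have "z s \<in> P \<and> {j\<in>J. f j (z s) \<le> 0} = s" unfolding z_def by (rule someI_ex)
    then show "z s \<in> P" "{j\<in>J. f j (z s) \<le> 0} = s" by auto
  qed
  \<comment> \<open>The positive values taken on \<open>P\<close>; the element 1 guarantees that a
    minimum exists.\<close>
  define T where "T = insert 1 {v\<in>(\<lambda>(j, p). f j p) ` (J \<times> P). 0 < v}"
  have T: "finite T" "T \<noteq> {}" "\<And>v. v \<in> T \<Longrightarrow> 0 < v" using finJ finP by (auto simp: T_def)
  \<comment> \<open>Subtracting half of the least positive value makes all values at points of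
    \<open>P\<close> nonzero without changing their classes: \<open>f j p \<le> 0\<close> turns into
    \<open>g j p < 0\<close>.\<close>
  define \<theta> where "\<theta> = Min T / 2"
  have "0 < Min T" using T by (simp add: Min_gr_iff)
  then have \<theta>: "0 < \<theta>" by (simp add: \<theta>_def)
  have \<theta>_less: "\<theta> < f j p" if "j \<in> J" "p \<in> P" "0 < f j p" for j p
  proof -
    have "f j p \<in> T" using that by (auto simp: T_def)
    then have "Min T \<le> f j p" using T(1) by simp
    then show ?thesis using \<open>0 < Min T\<close> by (simp add: \<theta>_def)
  qed
  define g where "g j p = f j p - \<theta>" for j p
  define R where "R = 1 + (\<Sum>p\<in>P. (norm p)\<^sup>2)"
  have R: "(norm p)\<^sup>2 < R" if "p \<in> P" for p
  proof -
    have "(norm p)\<^sup>2 \<le> (\<Sum>p\<in>P. (norm p)\<^sup>2)" using finP that by (intro member_le_sum) auto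
    then show ?thesis by (simp add: R_def)
  qed
  have R1: "R \<ge> 1" by (simp add: R_def sum_nonneg)
  define G where "G p = (\<Prod>j\<in>J. g j p) * (R - (norm p)\<^sup>2)" for p
  have polyg: "polyfun D (g j)" if "j \<in> J" for j
    unfolding g_def using poly[OF that] by (intro polyfun_diff polyfun.const)
  have norm_sq: "(norm p)\<^sup>2 = (\<Sum>a\<in>UNIV. p $ a * p $ a)" for p :: "real ^ 'd"
    unfolding power2_norm_eq_inner inner_vec_def by simp
  have polyR: "polyfun 2 (\<lambda>p :: real ^ 'd. R - (norm p)\<^sup>2)"
  proof -
    have "polyfun (Suc 0 + Suc 0) (\<lambda>p :: real ^ 'd. p $ a * p $ a)" for a
      by (intro polyfun.mult polyfun.coord)
    then have "polyfun 2 (\<lambda>p :: real ^ 'd. p $ a * p $ a)" for a by (simp add: numeral_2_eq_2)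
    then show ?thesis unfolding norm_sq by (intro polyfun_diff polyfun.const polyfun_sum) auto
  qed
  have polyG: "polyfun (card J * D + 2) G"
    unfolding G_def[abs_def] by (intro polyfun.mult polyfun_prod finJ polyg polyR)
  then obtain F where F: "\<And>a. polyfun (card J * D + 2) (\<lambda>p. F p $ a)"
    "\<And>p. (G has_derivative (\<lambda>h. F p \<bullet> h)) (at p)" using polyfun_gradient by blast
  have contg: "continuous_on UNIV (g j)" if "j \<in> J" for j
    using polyfun_gradient[OF polyg[OF that]]
    by (meson continuous_at_imp_continuous_on has_derivative_continuous)
  have contG: "continuous_on A G" for A
    using F(2) by (auto intro!: continuous_at_imp_continuous_on has_derivative_continuous)
  \<comment> \<open>\<open>C s\<close> is a closed sign cell, compact because of the ball, and
    \<open>U s\<close> its open counterpart; they differ exactly by the zeros of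
    \<open>G\<close>.\<close>
  define C where "C s = cball 0 (sqrt R) \<inter> (\<Inter>j\<in>J. if j \<in> s then {p. g j p \<le> 0} else {p. 0 \<le> g j p})" for s
  define U where "U s = ball 0 (sqrt R) \<inter> (\<Inter>j\<in>J. if j \<in> s then {p. g j p < 0} else {p. 0 < g j p})" for s
  have compactC: "compact (C s)" for s
    unfolding C_def using contg
    by (intro compact_Int_closed closed_INT ballI) (auto intro!: closed_Collect_le)
  have openU: "open (U s)" for s
    unfolding U_def using contg finJ
    by (intro open_Int open_INT ballI) (auto intro!: open_Collect_less)
  have ball_iff: "p \<in> ball 0 (sqrt R) \<longleftrightarrow> (norm p)\<^sup>2 < R" and cball_iff: "p \<in> cball 0 (sqrt R) \<longleftrightarrow> (norm p)\<^sup>2 \<le> R"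
    for p :: "real ^ 'd"
  proof -
    have "norm p = sqrt ((norm p)\<^sup>2)" by simp
    then show "p \<in> ball 0 (sqrt R) \<longleftrightarrow> (norm p)\<^sup>2 < R" "p \<in> cball 0 (sqrt R) \<longleftrightarrow> (norm p)\<^sup>2 \<le> R"
      by (metis mem_ball_0 real_sqrt_less_iff, metis mem_cball_0 real_sqrt_le_iff)
  qed
  have UC: "U s \<subseteq> C s" for s
    unfolding U_def C_def by (intro Int_mono ball_subset_cball INF_mono') auto
  have in_U: "p \<in> U s \<longleftrightarrow> (norm p)\<^sup>2 < R \<and> (\<forall>j\<in>J. if j \<in> s then g j p < 0 else 0 < g j p)" for p s
    unfolding U_def Int_iff ball_iff by (auto split: if_split_asm)
  have in_C: "p \<in> C s \<longleftrightarrow> (norm p)\<^sup>2 \<le> R \<and> (\<forall>j\<in>J. if j \<in> s then g j p \<le> 0 else 0 \<le> g j p)" for p s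
    unfolding C_def Int_iff cball_iff by (auto split: if_split_asm)
  have zU: "z s \<in> U s" if "s \<in> S" for s
  proof -
    have "(norm (z s))\<^sup>2 < R" using R[OF z(1)[OF that]] .
    moreover have "if j \<in> s then g j (z s) < 0 else 0 < g j (z s)" if j: "j \<in> J" for j
    proof (cases "j \<in> s")
      case True
      then have "f j (z s) \<le> 0" using z(2)[OF \<open>s \<in> S\<close>] by blast
      then show ?thesis using True \<theta> by (simp add: g_def)
    next
      case False
      then have "0 < f j (z s)" using z(2)[OF \<open>s \<in> S\<close>] j by force
      then show ?thesis using False \<theta>_less[OF j z(1)[OF \<open>s \<in> S\<close>]] by (simp add: g_def)
    qed
    ultimately show ?thesis unfolding in_U by blast
  qed
  have G_0: "G p = 0 \<longleftrightarrow> (\<exists>j\<in>J. g j p = 0) \<or> (norm p)\<^sup>2 = R" for p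
    using finJ by (auto simp: G_def)
  have G_nz: "G p \<noteq> 0" if "p \<in> U s" for p s
  proof -
    have "g j p \<noteq> 0" if "j \<in> J" for j
      using \<open>p \<in> U s\<close> that unfolding in_U by (metis less_irrefl)
    moreover have "(norm p)\<^sup>2 \<noteq> R" using that unfolding in_U by simp
    ultimately show ?thesis unfolding G_0 by blast
  qed
  have C_nz: "p \<in> U s" if "p \<in> C s" "G p \<noteq> 0" for p s
  proof -
    have "(norm p)\<^sup>2 < R" using that unfolding in_C G_0 by linarith
    moreover have "if j \<in> s then g j p < 0 else 0 < g j p" if "j \<in> J" for j
      using \<open>p \<in> C s\<close> \<open>G p \<noteq> 0\<close> that unfolding in_C G_0 by (metis order_le_less)
    ultimately show ?thesis unfolding in_U by blast
  qed
  have U_inj: "s = s'" if "p \<in> U s" "p \<in> U s'" "s \<in> S" "s' \<in> S" for p s s'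
  proof -
    have "s = {j\<in>J. g j p < 0}" if "p \<in> U s" "s \<in> S" for s
    proof -
      have "s \<subseteq> J" using z(2)[OF that(2)] by blast
      moreover have "j \<in> s \<longleftrightarrow> g j p < 0" if "j \<in> J" for j
        using \<open>p \<in> U s\<close> that unfolding in_U by (metis less_asym)
      ultimately show ?thesis by blast
    qed
    from this[OF that(1,3)] this[OF that(2,4)] show ?thesis by (simp only:)
  qed
  define m where "m = Min ((\<lambda>s. \<bar>G (z s)\<bar>) ` S)"
  have "S \<noteq> {}" using False by (simp add: S_def)
  then have m0: "0 < m" using finS G_nz zU by (auto simp: m_def)
  have m_le: "m \<le> \<bar>G (z s)\<bar>" if "s \<in> S" for s using finS that by (simp add: m_def)
  \<comment> \<open>Since \<open>norm v \<le> d * \<kappa>\<close>, the linear perturbation by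
    \<open>v\<close> is at most \<open>m / 4\<close> on the ball of radius
    \<open>sqrt R\<close>.\<close>
  define \<kappa> where "\<kappa> = m / (4 * CARD('d) * sqrt R)"
  have \<kappa>0: "0 < \<kappa>" using m0 R1 by (simp add: \<kappa>_def)
  have "card S \<le> (CARD('d) * (card J * D + 2) + 1) ^ CARD('d)"
  proof (rule polynomial_map_fibres[OF F(1) \<kappa>0 finS])
    fix v :: "real ^ 'd"
    assume v: "\<And>a. 0 \<le> v $ a \<and> v $ a \<le> \<kappa>"
    have small: "\<bar>v \<bullet> p\<bar> \<le> m / 4" if "p \<in> cball 0 (sqrt R)" for p
    proof -
      have "norm v \<le> (\<Sum>a\<in>UNIV. \<bar>v $ a\<bar>)" by (rule norm_le_l1_cart)
      also have "\<dots> \<le> (\<Sum>a\<in>(UNIV :: 'd set). \<kappa>)" using v by (intro sum_mono) auto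
      finally have nv: "norm v \<le> CARD('d) * \<kappa>" by simp
      have "\<bar>v \<bullet> p\<bar> \<le> norm v * norm p" by (rule Cauchy_Schwarz_ineq2)
      also have "\<dots> \<le> (CARD('d) * \<kappa>) * sqrt R"
        using nv that \<kappa>0 by (intro mult_mono) auto
      also have "\<dots> = m / 4" using R1 by (simp add: \<kappa>_def)
      finally show ?thesis .
    qed
    have "\<exists>p. p \<in> U s \<and> F p = v" if s: "s \<in> S" for s
    proof -
      define \<tau> where "\<tau> = sgn (G (z s))"
      have \<tau>: "\<tau> * G (z s) = \<bar>G (z s)\<bar>" "\<bar>\<tau>\<bar> = 1"
        using G_nz[OF zU[OF s]] by (auto simp: \<tau>_def sgn_if)
      define u where "u p = \<tau> * (G p - v \<bullet> p)" for p
      have "continuous_on (C s) u" unfolding u_def by (intro continuous_intros contG)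
      moreover have zC: "z s \<in> C s" using zU[OF s] UC by blast
      ultimately obtain p where p: "p \<in> C s" "\<And>y. y \<in> C s \<Longrightarrow> u y \<le> u p"
        using continuous_attains_sup[OF compactC] by blast
      have "z s \<in> cball 0 (sqrt R)" "p \<in> cball 0 (sqrt R)" using zC p(1) by (auto simp: C_def)
      from this[THEN small] have vb: "\<bar>\<tau> * (v \<bullet> z s)\<bar> \<le> m / 4" "\<bar>\<tau> * (v \<bullet> p)\<bar> \<le> m / 4"
        using \<tau>(2) by (simp_all add: abs_mult)
      have "\<tau> * G (z s) - \<tau> * (v \<bullet> z s) \<le> \<tau> * G p - \<tau> * (v \<bullet> p)"
        using p(2)[OF zC] by (simp add: u_def right_diff_distrib)
      \<comment> \<open>The value of \<open>u\<close> at \<open>z s\<close> is at least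
        \<open>m - m / 4\<close>, so \<open>\<tau> * G p\<close> is at least \<open>m / 2\<close> at
        the maximum. Points of \<open>C s\<close> outside \<open>U s\<close> have
        \<open>G = 0\<close>; hence the maximum is interior.\<close>
      then have "\<tau> * G p > 0" using vb m_le[OF s] m0 \<tau>(1) by linarith
      then have pU: "p \<in> U s" using C_nz p(1) by fastforce
      have "(u has_derivative (\<lambda>h. \<tau> * (F p \<bullet> h - v \<bullet> h))) (at p)"
        unfolding u_def by (intro derivative_intros F(2))
      moreover have "\<forall>y\<in>U s. u y \<le> u p" using p(2) UC by blast
      ultimately have "(\<lambda>h. \<tau> * (F p \<bullet> h - v \<bullet> h)) = (\<lambda>h. 0)"
        using differential_zero_maxmin[OF pU openU] by blast
      then have "\<tau> * (F p \<bullet> (F p - v) - v \<bullet> (F p - v)) = 0" by meson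
      then have "(F p - v) \<bullet> (F p - v) = 0" using \<tau>(2) by (auto simp: inner_diff_left)
      then have "F p = v" by simp
      then show ?thesis using pU by blast
    qed
    then obtain x where x: "\<And>s. s \<in> S \<Longrightarrow> x s \<in> U s" "\<And>s. s \<in> S \<Longrightarrow> F (x s) = v" by metis
    have "inj_on x S" using x(1) U_inj by (metis inj_onI)
    then show "\<exists>x. inj_on x S \<and> (\<forall>s\<in>S. F (x s) = v)" using x(2) by blast
  qed
  then show ?thesis by (simp add: S_def)
qed simp

section \<open>Partitions induced by samples\<close>

text \<open>The sum counts the hypercube edges inside \<open>S\<close>, each by its lower end. After
  splitting at \<open>u\<close> into the traces \<open>S0\<close> and \<open>S1\<close>, the edges
  in direction \<open>u\<close> are the members of \<open>T\<close>, the intersection; an edge in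
  another direction lies in \<open>S0 \<union> S1\<close>, and one occurring in both traces lies in
  \<open>T\<close> as well. A set shattered by \<open>T\<close> is shattered by \<open>S\<close>
  together with \<open>u\<close>, so \<open>T\<close> has the parameter \<open>q - 1\<close>, and
  this gain pays for the edges in direction \<open>u\<close>.\<close>

lemma unit_distance_edges:
  fixes S :: "'a set set"
  assumes "finite U" and "S \<subseteq> Pow U"
    and "\<And>T. T \<subseteq> U \<Longrightarrow> card T = q \<Longrightarrow> (\<lambda>A. A \<inter> T) ` S \<noteq> Pow T"
  shows "(\<Sum>j\<in>U. card {A\<in>S. j \<notin> A \<and> insert j A \<in> S}) \<le> q * card S"
  using assms
proof (induction U arbitrary: S q)
  case empty
  then show ?case by simp
next
  case (insert u U)
  have finS: "finite S"
    using insert.prems(1) insert.hyps(1) by (meson finite_Pow_iff finite_insert finite_subset)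
  show ?case
  proof (cases q)
    \<comment> \<open>For \<open>q = 0\<close> the hypothesis concerns the empty set, which every
      nonempty family shatters.\<close>
    case 0
    have "(\<lambda>A. A \<inter> {}) ` S \<noteq> Pow {}"
      using insert.prems(2)[of "{}"] 0 by simp
    then have "S = {}" by auto
    then show ?thesis by simp
  next
    case (Suc r)
    define S0 where "S0 = {A\<in>S. u \<notin> A}"
    define S1 where "S1 = (\<lambda>A. A - {u}) ` {A\<in>S. u \<in> A}"
    define T where "T = {A\<in>S. u \<notin> A \<and> insert u A \<in> S}"
    have S1_alt: "A \<in> S1 \<longleftrightarrow> u \<notin> A \<and> insert u A \<in> S" for A
      unfolding S1_def by (auto simp: insert_absorb image_iff)
    have fin: "finite S0" "finite S1" using finS by (auto simp: S0_def S1_def)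
    have T_eq: "T = S0 \<inter> S1" using S1_alt by (auto simp: T_def S0_def)
    have card_split: "card {A\<in>S. P A} = card {A\<in>S0. P A} + card {A\<in>S1. P (insert u A)}" for P
    proof -
      have "{A\<in>S. P A} = {A\<in>S0. P A} \<union> insert u ` {A\<in>S1. P (insert u A)}"
      proof (intro set_eqI iffI)
        fix A assume A: "A \<in> {A\<in>S. P A}"
        show "A \<in> {A\<in>S0. P A} \<union> insert u ` {A\<in>S1. P (insert u A)}"
        proof (cases "u \<in> A")
          case True
          then have "A - {u} \<in> {A\<in>S1. P (insert u A)}" "A = insert u (A - {u})"
            using A by (auto simp: S1_alt insert_absorb)
          then show ?thesis by blast
        next
          case False
          then show ?thesis using A by (auto simp: S0_def)
        qed
      qed (auto simp: S0_def S1_alt)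
      moreover have "card (insert u ` {A\<in>S1. P (insert u A)}) = card {A\<in>S1. P (insert u A)}"
        by (intro card_image) (auto simp: inj_on_def S1_alt)
      moreover have "{A\<in>S0. P A} \<inter> insert u ` {A\<in>S1. P (insert u A)} = {}"
        by (auto simp: S0_def)
      ultimately show ?thesis using fin by (simp add: card_Un_disjoint)
    qed
    have cardS: "card S = card (S0 \<union> S1) + card T"
      using card_split[of "\<lambda>_. True"] card_Un_Int[OF fin] by (simp add: T_eq)
    have sub: "S0 \<union> S1 \<subseteq> Pow U" "T \<subseteq> Pow U"
      using insert.prems(1) insert.hyps(2) by (auto simp: S0_def S1_def T_def)
    have IH1: "(\<Sum>j\<in>U. card {A\<in>S0 \<union> S1. j \<notin> A \<and> insert j A \<in> S0 \<union> S1}) \<le> q * card (S0 \<union> S1)"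
    proof (rule insert.IH[OF sub(1)])
      fix T' assume T': "T' \<subseteq> U" "card T' = q"
      have "u \<notin> T'" using T' insert.hyps by auto
      show "(\<lambda>A. A \<inter> T') ` (S0 \<union> S1) \<noteq> Pow T'"
      proof
        assume eq: "(\<lambda>A. A \<inter> T') ` (S0 \<union> S1) = Pow T'"
        have "Pow T' \<subseteq> (\<lambda>A. A \<inter> T') ` S"
        proof
          fix Z assume "Z \<in> Pow T'"
          then obtain A where A: "A \<in> S0 \<union> S1" "Z = A \<inter> T'" using eq by blast
          show "Z \<in> (\<lambda>A. A \<inter> T') ` S"
          proof (cases "A \<in> S0")
            case True then show ?thesis using A by (auto simp: S0_def)
          next
            case False
            then have "insert u A \<in> S" using A S1_alt by auto
            moreover have "Z = insert u A \<inter> T'" using A \<open>u \<notin> T'\<close> by auto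
            ultimately show ?thesis by blast
          qed
        qed
        then show False using insert.prems(2)[of T'] T' by auto
      qed
    qed
    have IH2: "(\<Sum>j\<in>U. card {A\<in>T. j \<notin> A \<and> insert j A \<in> T}) \<le> r * card T"
    proof (rule insert.IH[OF sub(2)])
      fix T' assume T': "T' \<subseteq> U" "card T' = r"
      have u: "u \<notin> T'" "finite T'" using T' insert.hyps finite_subset by auto
      show "(\<lambda>A. A \<inter> T') ` T \<noteq> Pow T'"
      proof
        assume eq: "(\<lambda>A. A \<inter> T') ` T = Pow T'"
        have "Pow (insert u T') \<subseteq> (\<lambda>A. A \<inter> insert u T') ` S"
        proof
          fix Z assume Z: "Z \<in> Pow (insert u T')"
          then have "Z - {u} \<in> Pow T'" by auto
          then obtain A where A: "A \<in> T" "Z - {u} = A \<inter> T'" using eq by blast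
          show "Z \<in> (\<lambda>A. A \<inter> insert u T') ` S"
          proof (cases "u \<in> Z")
            case True
            then have "Z = insert u A \<inter> insert u T'" using A u by auto
            then show ?thesis using A by (auto simp: T_def)
          next
            case False
            then have "Z = A \<inter> insert u T'" using A u by (auto simp: T_def)
            then show ?thesis using A by (auto simp: T_def)
          qed
        qed
        then have "(\<lambda>A. A \<inter> insert u T') ` S = Pow (insert u T')" by auto
        then show False using insert.prems(2)[of "insert u T'"] T' u Suc by auto
      qed
    qed
    have edge: "card {A\<in>S. j \<notin> A \<and> insert j A \<in> S} \<le>
        card {A\<in>S0 \<union> S1. j \<notin> A \<and> insert j A \<in> S0 \<union> S1} + card {A\<in>T. j \<notin> A \<and> insert j A \<in> T}"
      if "j \<in> U" for j
    proof -
      have ju: "j \<noteq> u" using that insert.hyps by auto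
      define E0 where "E0 = {A\<in>S0. j \<notin> A \<and> insert j A \<in> S0}"
      define E1 where "E1 = {A\<in>S1. j \<notin> A \<and> insert j A \<in> S1}"
      have "{A\<in>S0. j \<notin> A \<and> insert j A \<in> S} = E0"
        using ju by (auto simp: E0_def S0_def)
      moreover have "{A\<in>S1. j \<notin> insert u A \<and> insert j (insert u A) \<in> S} = E1"
        using ju by (auto simp: E1_def S1_alt insert_commute)
      ultimately have "card {A\<in>S. j \<notin> A \<and> insert j A \<in> S} = card E0 + card E1"
        using card_split[of "\<lambda>A. j \<notin> A \<and> insert j A \<in> S"] by simp
      also have "\<dots> = card (E0 \<union> E1) + card (E0 \<inter> E1)"
        using fin by (intro card_Un_Int) (auto simp: E0_def E1_def)
      also have "\<dots> \<le> card {A\<in>S0 \<union> S1. j \<notin> A \<and> insert j A \<in> S0 \<union> S1}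
          + card {A\<in>T. j \<notin> A \<and> insert j A \<in> T}"
        using fin by (intro add_mono card_mono) (auto simp: E0_def E1_def T_eq)
      finally show ?thesis .
    qed
    have "(\<Sum>j\<in>insert u U. card {A\<in>S. j \<notin> A \<and> insert j A \<in> S})
        = card T + (\<Sum>j\<in>U. card {A\<in>S. j \<notin> A \<and> insert j A \<in> S})"
      using insert.hyps by (simp add: T_def)
    also have "\<dots> \<le> card T + (\<Sum>j\<in>U. card {A\<in>S0 \<union> S1. j \<notin> A \<and> insert j A \<in> S0 \<union> S1}
          + card {A\<in>T. j \<notin> A \<and> insert j A \<in> T})"
      using edge by (intro add_left_mono sum_mono) auto
    also have "\<dots> \<le> card T + (q * card (S0 \<union> S1) + r * card T)"
      unfolding sum.distrib using IH1 IH2 by linarith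
    also have "\<dots> = q * card S" using Suc cardS by (simp add: algebra_simps)
    finally show ?thesis .
  qed
qed

text \<open>Layer by layer: \<open>min (w A) (w (insert j A))\<close> is the number of thresholds
  \<open>t\<close> for which both sets have weight above \<open>t\<close>. Every layer lies in the
  support of \<open>w\<close> and so shatters no \<open>q\<close>-set; the unweighted bounds are
  added up.\<close>

lemma weighted_unit_distance_edges:
  fixes w :: "'a set \<Rightarrow> nat"
  assumes "finite U"
    and nosh: "\<And>T. T \<subseteq> U \<Longrightarrow> card T = q \<Longrightarrow> (\<lambda>A. A \<inter> T) ` {A\<in>Pow U. 0 < w A} \<noteq> Pow T"
  shows "(\<Sum>j\<in>U. \<Sum>A\<in>{A\<in>Pow U. j \<notin> A}. min (w A) (w (insert j A))) \<le> q * (\<Sum>A\<in>Pow U. w A)"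
proof -
  define M where "M = (\<Sum>A\<in>Pow U. w A)"
  define S where "S t = {A\<in>Pow U. t < w A}" for t
  have wM: "w A \<le> M" if "A \<subseteq> U" for A
    unfolding M_def using assms(1) that by (intro member_le_sum) auto
  have level: "n = (\<Sum>t<M. if t < n then 1 else 0)" if "n \<le> M" for n
  proof -
    have "(\<Sum>t<M. if t < n then 1 else 0) = card ({..<M} \<inter> {t. t < n})"
      by (simp add: sum.If_cases)
    also have "{..<M} \<inter> {t. t < n} = {..<n}" using that by auto
    finally show ?thesis by simp
  qed
  have edges: "(\<Sum>j\<in>U. card {A\<in>S t. j \<notin> A \<and> insert j A \<in> S t}) \<le> q * card (S t)" for t
  proof (rule unit_distance_edges[OF assms(1)])
    show "S t \<subseteq> Pow U" by (auto simp: S_def)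
    fix T assume T: "T \<subseteq> U" "card T = q"
    show "(\<lambda>A. A \<inter> T) ` S t \<noteq> Pow T"
    proof
      assume "(\<lambda>A. A \<inter> T) ` S t = Pow T"
      moreover have "(\<lambda>A. A \<inter> T) ` S t \<subseteq> (\<lambda>A. A \<inter> T) ` {A\<in>Pow U. 0 < w A}"
        by (intro image_mono) (auto simp: S_def)
      ultimately show False using nosh[OF T] by auto
    qed
  qed
  have "(\<Sum>j\<in>U. \<Sum>A\<in>{A\<in>Pow U. j \<notin> A}. min (w A) (w (insert j A)))
      = (\<Sum>j\<in>U. \<Sum>A\<in>{A\<in>Pow U. j \<notin> A}. \<Sum>t<M. if t < min (w A) (w (insert j A)) then 1 else 0)"
  proof (intro sum.cong refl level)
    fix j A assume "A \<in> {A\<in>Pow U. j \<notin> A}"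
    then have "w A \<le> M" using wM by auto
    then show "min (w A) (w (insert j A)) \<le> M" by simp
  qed
  also have "\<dots> = (\<Sum>j\<in>U. \<Sum>t<M. \<Sum>A\<in>{A\<in>Pow U. j \<notin> A}. if t < min (w A) (w (insert j A)) then 1 else 0)"
    by (intro sum.cong refl sum.swap)
  also have "\<dots> = (\<Sum>j\<in>U. \<Sum>t<M. card {A\<in>S t. j \<notin> A \<and> insert j A \<in> S t})"
  proof (intro sum.cong refl)
    fix j t assume "j \<in> U"
    then have "{A\<in>Pow U. j \<notin> A} \<inter> {A. t < min (w A) (w (insert j A))}
        = {A\<in>S t. j \<notin> A \<and> insert j A \<in> S t}" by (auto simp: S_def)
    then show "(\<Sum>A\<in>{A\<in>Pow U. j \<notin> A}. if t < min (w A) (w (insert j A)) then 1 else 0)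
        = card {A\<in>S t. j \<notin> A \<and> insert j A \<in> S t}"
      using assms(1) by (simp add: sum.If_cases)
  qed
  also have "\<dots> = (\<Sum>t<M. \<Sum>j\<in>U. card {A\<in>S t. j \<notin> A \<and> insert j A \<in> S t})"
    by (rule sum.swap)
  also have "\<dots> \<le> (\<Sum>t<M. q * card (S t))" by (intro sum_mono edges)
  also have "\<dots> = q * (\<Sum>t<M. \<Sum>A\<in>Pow U. if t < w A then 1 else 0)"
    using assms(1) by (simp add: sum_distrib_left sum.If_cases S_def Int_def)
  also have "(\<Sum>t<M. \<Sum>A\<in>Pow U. if t < w A then 1 else 0)
      = (\<Sum>A\<in>Pow U. \<Sum>t<M. if t < w A then 1 else 0 :: nat)" by (rule sum.swap)
  also have "\<dots> = (\<Sum>A\<in>Pow U. w A)"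
    using wM by (intro sum.cong refl level[symmetric]) auto
  finally show ?thesis .
qed

text \<open>Averaging over a sample on the whole of \<open>U\<close> and deleting one index: the unit-distance edges in
  direction \<open>j\<close> are the splits that the \<open>j\<close>-th sample element makes in the partition induced by the others.\<close>

lemma sampled_partition:
  fixes e :: "'x \<Rightarrow> 'y \<Rightarrow> bool" and U :: "'u set"
  assumes fin: "finite X" "finite Y" "finite U" and ne: "Y \<noteq> {}" "U \<noteq> {}"
    and nosh: "\<And>T ys. T \<subseteq> U \<Longrightarrow> card T = q \<Longrightarrow> card ((\<lambda>x. {u\<in>T. e x (ys u)}) ` X) < 2 ^ q"
  obtains j ys where "j \<in> U"
    "card U * (\<Sum>y\<in>Y. \<Sum>A\<in>Pow (U - {j}).
       min (card {x\<in>X. {u\<in>U - {j}. e x (ys u)} = A \<and> \<not> e x y})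
           (card {x\<in>X. {u\<in>U - {j}. e x (ys u)} = A \<and> e x y})) \<le> q * card X * card Y"
proof -
  define w where "w ys A = card {x\<in>X. {u\<in>U. e x (ys u)} = A}" for ys A
  define m where "m j ys = (\<Sum>A\<in>{A\<in>Pow U. j \<notin> A}. min (w ys A) (w ys (insert j A)))" for j ys
  define n where "n = card U"
  have n0: "n > 0" using fin ne by (simp add: n_def card_gt_0_iff)
  define Om where "Om = PiE U (\<lambda>_. Y)"
  have cOm: "card Om = card Y ^ n" "finite Om" 
    using fin by (simp_all add: Om_def card_PiE n_def finite_PiE)
  \<comment> \<open>Indices shattered by codes of positive multiplicity would show
    \<open>2 ^ q\<close> patterns on \<open>X\<close>, contrary to \<open>nosh\<close>. The
    multiplicities of all codes add up to \<open>card X\<close>.\<close>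
  have one: "(\<Sum>j\<in>U. m j ys) \<le> q * card X" for ys
  proof -
    have "(\<Sum>j\<in>U. m j ys) \<le> q * (\<Sum>A\<in>Pow U. w ys A)"
      unfolding m_def
    proof (rule weighted_unit_distance_edges[OF fin(3)])
      fix T assume T: "T \<subseteq> U" "card T = q"
      show "(\<lambda>A. A \<inter> T) ` {A\<in>Pow U. 0 < w ys A} \<noteq> Pow T"
      proof
        assume eq: "(\<lambda>A. A \<inter> T) ` {A\<in>Pow U. 0 < w ys A} = Pow T"
        have "Pow T \<subseteq> (\<lambda>x. {u\<in>T. e x (ys u)}) ` X"
        proof
          fix Z assume "Z \<in> Pow T"
          then have "Z \<in> (\<lambda>A. A \<inter> T) ` {A\<in>Pow U. 0 < w ys A}" by (simp only: eq)
          then obtain A where A: "A \<subseteq> U" "0 < w ys A" "Z = A \<inter> T" by blast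
          then have "{x\<in>X. {u\<in>U. e x (ys u)} = A} \<noteq> {}"
            unfolding w_def card_gt_0_iff by blast
          then obtain x where x: "x \<in> X" "{u\<in>U. e x (ys u)} = A" by blast
          have "Z = {u\<in>T. e x (ys u)}" unfolding A(3) x(2)[symmetric] using T(1) by blast
          then show "Z \<in> (\<lambda>x. {u\<in>T. e x (ys u)}) ` X" using x(1) by blast
        qed
        then have "card (Pow T) \<le> card ((\<lambda>x. {u\<in>T. e x (ys u)}) ` X)"
          using fin by (intro card_mono) auto
        moreover have "finite T" using T fin finite_subset by auto
        ultimately show False using nosh[OF T, of ys] T by (simp add: card_Pow)
      qed
    qed
    also have "(\<Sum>A\<in>Pow U. w ys A) = card X"
    proof -
      have "(\<Sum>A\<in>Pow U. w ys A) = (\<Sum>A\<in>Pow U. \<Sum>x\<in>{x\<in>X. {u\<in>U. e x (ys u)} = A}. 1)"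
        by (simp add: w_def)
      also have "\<dots> = (\<Sum>x\<in>X. 1)"
        using fin by (intro sum.group) auto
      finally show ?thesis by simp
    qed
    finally show ?thesis .
  qed
  have tot: "(\<Sum>j\<in>U. \<Sum>ys\<in>Om. m j ys) \<le> q * card X * card Om"
  proof -
    have "(\<Sum>j\<in>U. \<Sum>ys\<in>Om. m j ys) = (\<Sum>ys\<in>Om. \<Sum>j\<in>U. m j ys)" by (rule sum.swap)
    also have "\<dots> \<le> (\<Sum>ys\<in>Om. q * card X)" by (intro sum_mono one)
    finally show ?thesis by (simp add: mult_ac)
  qed
  obtain j where j: "j \<in> U" "n * (\<Sum>ys\<in>Om. m j ys) \<le> q * card X * card Om"
  proof -
    have "\<exists>j\<in>U. n * (\<Sum>ys\<in>Om. m j ys) \<le> q * card X * card Om"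
    proof (rule ccontr)
      assume "\<not> ?thesis"
      then have "(\<Sum>j\<in>U. q * card X * card Om) < (\<Sum>j\<in>U. n * (\<Sum>ys\<in>Om. m j ys))"
        using fin ne by (intro sum_strict_mono) auto
      also have "\<dots> \<le> n * (q * card X * card Om)"
        unfolding sum_distrib_left[symmetric] using tot by simp
      finally show False by (simp add: n_def)
    qed
    then show ?thesis using that by blast
  qed
  define U' where "U' = U - {j}"
  have U: "U = insert j U'" "j \<notin> U'" "finite U'" using j fin by (auto simp: U'_def)
  have nU': "card U' = n - 1" using j fin by (simp add: U'_def n_def)
  define Om' where "Om' = PiE U' (\<lambda>_. Y)"
  have cOm': "finite Om'" "Om' \<noteq> {}"
    using fin U ne by (simp_all add: Om'_def finite_PiE PiE_eq_empty_iff)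
  have "n = Suc (card U')" using nU' n0 by simp
  then have cOm'': "card Om = card Y * card Om'"
    using U by (simp add: cOm Om'_def card_PiE)
  have "Om = (\<lambda>(y, g). g(j := y)) ` (Y \<times> Om')"
    unfolding Om_def Om'_def U(1) by (rule PiE_insert_eq)
  moreover have "inj_on (\<lambda>(y, g). g(j := y)) (Y \<times> Om')"
    unfolding Om'_def using U(2) by (rule inj_combinator)
  ultimately have "(\<Sum>ys\<in>Om. m j ys) = (\<Sum>(y, g)\<in>Y \<times> Om'. m j (g(j := y)))"
    by (simp add: sum.reindex case_prod_unfold)
  also have "\<dots> = (\<Sum>g\<in>Om'. \<Sum>y\<in>Y. m j (g(j := y)))"
    by (subst sum.swap) (rule sum.cartesian_product[symmetric])
  finally have split: "(\<Sum>ys\<in>Om. m j ys) = (\<Sum>g\<in>Om'. \<Sum>y\<in>Y. m j (g(j := y)))" .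
  obtain g where g: "n * (\<Sum>y\<in>Y. m j (g(j := y))) \<le> q * card X * card Y"
  proof -
    have "\<exists>g\<in>Om'. n * (\<Sum>y\<in>Y. m j (g(j := y))) \<le> q * card X * card Y"
    proof (rule ccontr)
      assume "\<not> ?thesis"
      then have "(\<Sum>g\<in>Om'. q * card X * card Y) < (\<Sum>g\<in>Om'. n * (\<Sum>y\<in>Y. m j (g(j := y))))"
        using cOm' by (intro sum_strict_mono) auto
      also have "\<dots> \<le> q * card X * card Om"
        unfolding sum_distrib_left[symmetric] using j(2) split by simp
      finally show False by (simp add: cOm'' mult_ac)
    qed
    then show ?thesis using that by blast
  qed
  \<comment> \<open>Changing the \<open>j\<close>-th sample element to \<open>y\<close> only decides
    whether \<open>j\<close> belongs to the code. So the classes of \<open>A\<close> and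
    \<open>insert j A\<close> are the two pieces into which \<open>y\<close> splits a class of the
    sample without \<open>j\<close>.\<close>
  have code: "{u\<in>U. e x ((g(j := y)) u)} = (if e x y then insert j {u\<in>U'. e x (g u)} else {u\<in>U'. e x (g u)})"
    for x y using U(1,2) by auto
  have "m j (g(j := y)) = (\<Sum>A\<in>Pow U'.
       min (card {x\<in>X. {u\<in>U'. e x (g u)} = A \<and> \<not> e x y})
           (card {x\<in>X. {u\<in>U'. e x (g u)} = A \<and> e x y}))" for y
    unfolding m_def
  proof (rule sum.cong)
    show "{A\<in>Pow U. j \<notin> A} = Pow U'" using U by auto
    fix A assume A: "A \<in> Pow U'"
    have "j \<notin> A" using A U by auto
    have "{x\<in>X. {u\<in>U. e x ((g(j := y)) u)} = A} = {x\<in>X. {u\<in>U'. e x (g u)} = A \<and> \<not> e x y}"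
      unfolding code using \<open>j \<notin> A\<close> by (auto split: if_splits)
    moreover have "{x\<in>X. {u\<in>U. e x ((g(j := y)) u)} = insert j A} = {x\<in>X. {u\<in>U'. e x (g u)} = A \<and> e x y}"
    proof -
      have "insert j {u\<in>U'. e x (g u)} = insert j A \<longleftrightarrow> {u\<in>U'. e x (g u)} = A" for x
        using \<open>j \<notin> A\<close> U(2) by (metis (no_types, lifting) insert_ident mem_Collect_eq)
      moreover have "{u\<in>U'. e x (g u)} \<noteq> insert j A" for x using U(2) by auto
      ultimately show ?thesis unfolding code by auto
    qed
    ultimately show "min (w (g(j := y)) A) (w (g(j := y)) (insert j A)) =
       min (card {x\<in>X. {u\<in>U'. e x (g u)} = A \<and> \<not> e x y})
           (card {x\<in>X. {u\<in>U'. e x (g u)} = A \<and> e x y})"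
      by (simp only: w_def)
  qed
  then show ?thesis using that[of j g] j(1) g by (simp add: U'_def n_def)
qed

section \<open>Boxes of constant sign\<close>

definition shrinks :: "real \<Rightarrow> nat set \<Rightarrow> (nat \<Rightarrow> 'a set) \<Rightarrow> (nat \<Rightarrow> 'a set) \<Rightarrow> bool" where
  "shrinks c J V W \<longleftrightarrow> (\<forall>j\<in>J. W j \<subseteq> V j \<and> c * real (card (V j)) \<le> real (card (W j)))"

text \<open>The full sign is kept, with 0 separate, instead of the truth of
  \<open>g x \<le> 0\<close>: constancy then survives multiplication by a constant of either sign.
  An empty box qualifies.\<close>

definition sgn_const :: "nat set \<Rightarrow> (nat \<Rightarrow> 'a set) \<Rightarrow> ((nat \<Rightarrow> 'a) \<Rightarrow> real) \<Rightarrow> bool" where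
  "sgn_const J W g \<longleftrightarrow> (\<forall>x\<in>PiE J W. \<forall>y\<in>PiE J W. sgn (g x) = sgn (g y))"

lemma shrinks_trans:
  assumes "shrinks c J V W" "shrinks c' J W U" "0 \<le> c'"
  shows "shrinks (c * c') J V U"
  unfolding shrinks_def
proof (intro ballI conjI)
  fix j assume j: "j \<in> J"
  show "U j \<subseteq> V j" using assms j unfolding shrinks_def by blast
  have "c * c' * real (card (V j)) = c' * (c * real (card (V j)))" by simp
  also have "\<dots> \<le> c' * real (card (W j))"
    using assms j unfolding shrinks_def by (intro mult_left_mono) auto
  also have "\<dots> \<le> real (card (U j))" using assms j unfolding shrinks_def by auto
  finally show "c * c' * real (card (V j)) \<le> real (card (U j))" .
qed

lemma shrinks_weaken: "shrinks c J V W \<Longrightarrow> c' \<le> c \<Longrightarrow> shrinks c' J V W"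
  unfolding shrinks_def by (meson mult_right_mono of_nat_0_le_iff order_trans)

lemma shrinks_refl: "c \<le> 1 \<Longrightarrow> shrinks c J V V"
  unfolding shrinks_def using mult_right_mono[of c 1] by auto

lemma shrinks_finite: "shrinks c J V W \<Longrightarrow> \<forall>j\<in>J. finite (V j) \<Longrightarrow> \<forall>j\<in>J. finite (W j)"
  unfolding shrinks_def using finite_subset by blast

lemma sgn_const_shrinks: "sgn_const J V g \<Longrightarrow> shrinks c J V W \<Longrightarrow> sgn_const J W g"
  unfolding sgn_const_def shrinks_def by (auto simp: PiE_iff subset_iff) 

section \<open>Prune and search in families of linear combinations\<close>

definition homogenizable :: "real \<Rightarrow> nat set \<Rightarrow> ((nat \<Rightarrow> 'a) \<Rightarrow> real) set \<Rightarrow> bool" where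
  "homogenizable c J G \<longleftrightarrow>
    (\<forall>V g. (\<forall>j\<in>J. finite (V j)) \<longrightarrow> g \<in> G \<longrightarrow> (\<exists>W. shrinks c J V W \<and> sgn_const J W g))"

text \<open>One box has to serve a constant fraction of a whole family; \<open>N\<close> is the
  dimension in which the search takes place. The indices are natural numbers because the recursion
  passes to families of pairs, numbered below some \<open>t\<close>, and a predicate cannot quantify
  over index types.\<close>

definition resolvable :: "real \<Rightarrow> nat \<Rightarrow> nat set \<Rightarrow> ((nat \<Rightarrow> 'a) \<Rightarrow> real) set \<Rightarrow> bool" where
  "resolvable c N J G \<longleftrightarrow>
    (\<forall>V (X :: nat set) a \<psi>. (\<forall>j\<in>J. finite (V j)) \<longrightarrow> finite X \<longrightarrow> (\<forall>l<N. \<psi> l \<in> G) \<longrightarrow>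
      (\<exists>W X'. shrinks c J V W \<and> X' \<subseteq> X \<and> c * real (card X) \<le> real (card X') \<and>
        (\<forall>x\<in>X'. sgn_const J W (\<lambda>y. \<Sum>l<N. a x l * \<psi> l y))))"

lemma resolvableD:
  fixes X :: "nat set"
  assumes "resolvable c N J G" "\<forall>j\<in>J. finite (V j)" "finite X" "\<And>l. l < N \<Longrightarrow> \<psi> l \<in> G"
  obtains W X' where "shrinks c J V W" "X' \<subseteq> X" "c * real (card X) \<le> real (card X')"
    "\<And>x. x \<in> X' \<Longrightarrow> sgn_const J W (\<lambda>y. \<Sum>l<N. a x l * \<psi> l y)"
proof -
  have "\<exists>W X'. shrinks c J V W \<and> X' \<subseteq> X \<and> c * real (card X) \<le> real (card X') \<and>
        (\<forall>x\<in>X'. sgn_const J W (\<lambda>y. \<Sum>l<N. a x l * \<psi> l y))"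
    using assms(1)[unfolded resolvable_def, rule_format, of V X \<psi> a] assms(2-4) by blast
  then show ?thesis using that by blast
qed

lemma median_exists:
  fixes s :: "'x \<Rightarrow> real"
  assumes "finite X" "X \<noteq> {}"
  obtains m where "2 * card {x\<in>X. s x < m} \<le> card X" "2 * card {x\<in>X. m < s x} \<le> card X"
proof -
  define K where "K = {v\<in>s ` X. card X \<le> 2 * card {x\<in>X. s x \<le> v}}"
  have "{x\<in>X. s x \<le> Max (s ` X)} = X" using assms by auto
  then have "Max (s ` X) \<in> K" using assms by (auto simp: K_def)
  moreover have finK: "finite K" using assms by (auto simp: K_def)
  ultimately have mK: "Min K \<in> K" by (metis Min_in empty_iff)
  define m where "m = Min K"
  have "card {x\<in>X. s x \<le> m} + card {x\<in>X. m < s x} = card X"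
    using assms by (subst card_Un_disjoint[symmetric]) (auto intro!: arg_cong[where f=card])
  moreover have "card X \<le> 2 * card {x\<in>X. s x \<le> m}" using mK by (simp add: K_def m_def)
  ultimately have 2: "2 * card {x\<in>X. m < s x} \<le> card X" by linarith
  have 1: "2 * card {x\<in>X. s x < m} \<le> card X"
  proof (cases "{x\<in>X. s x < m} = {}")
    case False
    define v where "v = Max (s ` {x\<in>X. s x < m})"
    have v_in: "v \<in> s ` {x\<in>X. s x < m}"
      unfolding v_def using False assms by (intro Max_in) auto
    then have "v < m" "v \<in> s ` X" by auto
    have "v \<notin> K" using \<open>v < m\<close> finK Min_le[of K v] unfolding m_def by fastforce
    then have "2 * card {x\<in>X. s x \<le> v} < card X" using \<open>v \<in> s ` X\<close> by (auto simp: K_def)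
    moreover have "card {x\<in>X. s x < m} \<le> card {x\<in>X. s x \<le> v}"
      unfolding v_def using assms by (intro card_mono) auto
    ultimately show ?thesis by linarith
  next
    case True
    show ?thesis unfolding True by simp
  qed
  show ?thesis using that 1 2 by blast
qed

lemma sgn_add_same:
  fixes u w P :: real
  assumes "P > 0" "sgn u * sgn w \<ge> 0"
  shows "sgn (u + P * w) = (if sgn u \<noteq> 0 then sgn u else sgn w)"
proof (cases u "0::real" rule: linorder_cases)
  case less
  then have "w \<le> 0" using assms by (cases w "0::real" rule: linorder_cases) auto
  then have "P * w \<le> 0" using assms by (simp add: mult_le_0_iff)
  then show ?thesis using less by simp
next
  case equal
  then show ?thesis using assms by (simp add: sgn_mult)
next
  case greater
  then have "w \<ge> 0" using assms by (cases w "0::real" rule: linorder_cases) auto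
  then have "P * w \<ge> 0" using assms by simp
  then show ?thesis using greater by simp
qed

lemma sgn_const_scale:
  assumes "sgn_const J W g" "\<And>y. y \<in> PiE J W \<Longrightarrow> f y = c * g y"
  shows "sgn_const J W f"
  unfolding sgn_const_def
proof (intro ballI)
  fix x y assume xy: "x \<in> PiE J W" "y \<in> PiE J W"
  have "sgn (g x) = sgn (g y)" using assms(1) xy unfolding sgn_const_def by blast
  then show "sgn (f x) = sgn (f y)" unfolding assms(2)[OF xy(1)] assms(2)[OF xy(2)] sgn_mult by simp
qed

text \<open>With \<open>u = Q * f + P * g\<close> and \<open>w = f - g\<close> one has
  \<open>(P + Q) * f = u + P * w\<close> and \<open>(P + Q) * g = u - Q * w\<close>. If the signs of
  \<open>u\<close> and \<open>w\<close> are not opposite, they fix the sign of \<open>f\<close>;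
  otherwise those of \<open>u\<close> and \<open>- w\<close> fix the sign of
  \<open>g\<close>.\<close>

lemma sgn_const_one_of_pair:
  fixes P Q :: real
  assumes "P > 0" "Q > 0"
    and "sgn_const J W (\<lambda>y. Q * f y + P * g y)" "sgn_const J W (\<lambda>y. f y - g y)"
  shows "sgn_const J W f \<or> sgn_const J W g"
proof (cases "PiE J W = {}")
  case True
  then show ?thesis by (simp add: sgn_const_def)
next
  case False
  then obtain y0 where y0: "y0 \<in> PiE J W" by blast
  define u where "u y = Q * f y + P * g y" for y
  define w where "w y = f y - g y" for y
  have su: "sgn (u y) = sgn (u y0)" and sw: "sgn (w y) = sgn (w y0)" if "y \<in> PiE J W" for y
    using assms(3,4) that y0 unfolding sgn_const_def u_def w_def by blast+
  have f: "(P + Q) * f y = u y + P * w y" and g: "(P + Q) * g y = u y + Q * (- w y)" for y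
    by (auto simp: u_def w_def algebra_simps)
  have PQ: "sgn z = sgn ((P + Q) * z)" for z
    using assms by (simp add: sgn_mult)
  show ?thesis
  proof (cases "sgn (u y0) * sgn (w y0) \<ge> 0")
    case True
    then have "sgn (f y) = (if sgn (u y0) \<noteq> 0 then sgn (u y0) else sgn (w y0))" if "y \<in> PiE J W" for y
      unfolding PQ[of "f y"] f using sgn_add_same[OF assms(1), of "u y" "w y"] su[OF that] sw[OF that]
      by auto
    then show ?thesis unfolding sgn_const_def by simp
  next
    case False
    then have "sgn (u y0) * sgn (- w y0) \<ge> 0" by (simp add: sgn_minus)
    then have "sgn (g y) = (if sgn (u y0) \<noteq> 0 then sgn (u y0) else sgn (- w y0))" if "y \<in> PiE J W" for y
      unfolding PQ[of "g y"] g using sgn_add_same[OF assms(2), of "u y" "- w y"] su[OF that] sw[OF that]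
      by (auto simp: sgn_minus)
    then show ?thesis unfolding sgn_const_def by simp
  qed
qed

text \<open>Dividing by the coefficient of \<open>\<psi> 0\<close>, the members of \<open>X\<close> become affine functions whose slopes in \<open>\<psi> 1\<close> are
  paired across their median \<open>m\<close>. In each pair, the difference eliminates \<open>\<psi> 0 + m \<psi> 1\<close> and a positive combination
  eliminates \<open>\<psi> 1\<close>; the signs of these two determine the sign of one member of the pair.\<close>

lemma prune_and_search_step:
  fixes G :: "((nat \<Rightarrow> 'a) \<Rightarrow> real) set"
  assumes lin: "\<And>g h t. g \<in> G \<Longrightarrow> h \<in> G \<Longrightarrow> (\<lambda>y. g y + t * h y) \<in> G"
    and res: "resolvable c (Suc M) J G" and c: "0 < c" "c \<le> 1"
  shows "resolvable (c * c / 8) (Suc (Suc M)) J G"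
  unfolding resolvable_def
proof (intro allI impI)
  fix V :: "nat \<Rightarrow> 'a set" and X :: "nat set" and a :: "nat \<Rightarrow> nat \<Rightarrow> real" and \<psi> :: "nat \<Rightarrow> (nat \<Rightarrow> 'a) \<Rightarrow> real"
  assume finV: "\<forall>j\<in>J. finite (V j)" and finX: "finite X" and \<psi>: "\<forall>l<Suc (Suc M). \<psi> l \<in> G"
  define F where "F x y = (\<Sum>l<Suc (Suc M). a x l * \<psi> l y)" for x y
  define R where "R b y = (\<Sum>l<M. b l * \<psi> (Suc (Suc l)) y)" for b y
  have F: "F x y = a x 0 * \<psi> 0 y + a x 1 * \<psi> 1 y + R (\<lambda>l. a x (Suc (Suc l))) y" for x y
    unfolding F_def R_def sum.lessThan_Suc_shift by simp
  have cc: "c * c \<le> c" using c by (simp add: mult_left_le)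
  \<comment> \<open>Members without a term in \<open>\<psi> 0\<close> already live in one dimension
    less.\<close>
  define Z where "Z = {x\<in>X. a x 0 = 0}"
  define X1 where "X1 = {x\<in>X. a x 0 \<noteq> 0}"
  have cardX: "card X = card Z + card X1"
    unfolding Z_def X1_def using finX by (subst card_Un_disjoint[symmetric]) (auto intro!: arg_cong[where f=card])
  have finX1: "finite X1" using finX by (simp add: X1_def)
  \<comment> \<open>Covers the cases in which an eighth of \<open>X\<close> is expressible by
    \<open>Suc M\<close> functions of \<open>G\<close>, so that a single search finishes.\<close>
  have goal_if: "\<exists>W X'. shrinks (c * c / 8) J V W \<and> X' \<subseteq> X \<and> c * c / 8 * real (card X) \<le> real (card X') \<and>
        (\<forall>x\<in>X'. sgn_const J W (\<lambda>y. \<Sum>l<Suc (Suc M). a x l * \<psi> l y))"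
    if sub: "X2 \<subseteq> X" and big: "card X \<le> 8 * card X2" and \<psi>': "\<And>l. l < Suc M \<Longrightarrow> \<psi>' l \<in> G"
      and eq: "\<And>x y. x \<in> X2 \<Longrightarrow> F x y = (\<Sum>l<Suc M. a' x l * \<psi>' l y)" for X2 a' \<psi>'
  proof -
    have "finite X2" using sub finX finite_subset by blast
    obtain W X' where W: "shrinks c J V W" "X' \<subseteq> X2" "c * real (card X2) \<le> real (card X')"
      "\<And>x. x \<in> X' \<Longrightarrow> sgn_const J W (\<lambda>y. \<Sum>l<Suc M. a' x l * \<psi>' l y)"
      using resolvableD[OF res finV, where X = X2 and a = a' and \<psi> = \<psi>'] \<open>finite X2\<close> \<psi>' by blast
    have "c * c / 8 * real (card X) \<le> c / 8 * real (card X)"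
      using cc by (intro mult_right_mono) auto
    also have "\<dots> \<le> c / 8 * real (8 * card X2)"
      using c big by (intro mult_left_mono) auto
    also have "\<dots> \<le> card X'" using W(3) by simp
    finally have "c * c / 8 * real (card X) \<le> real (card X')" .
    moreover have "shrinks (c * c / 8) J V W" 
      using W(1) by (rule shrinks_weaken) (use cc c in linarith)
    moreover have "sgn_const J W (\<lambda>y. \<Sum>l<Suc (Suc M). a x l * \<psi> l y)" if "x \<in> X'" for x
    proof -
      have "(\<lambda>y. \<Sum>l<Suc (Suc M). a x l * \<psi> l y) = (\<lambda>y. \<Sum>l<Suc M. a' x l * \<psi>' l y)"
        using eq[of x] that W(2) unfolding F_def by blast
      then show ?thesis using W(4)[OF that] by (simp only:)
    qed
    ultimately show ?thesis using W(2) sub by blast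
  qed
  consider (zero) "card X \<le> 2 * card Z" | (nonzero) "card X < 2 * card X1" "X1 \<noteq> {}"
    using cardX by fastforce
  then show "\<exists>W X'. shrinks (c * c / 8) J V W \<and> X' \<subseteq> X \<and> c * c / 8 * real (card X) \<le> real (card X') \<and>
        (\<forall>x\<in>X'. sgn_const J W (\<lambda>y. \<Sum>l<Suc (Suc M). a x l * \<psi> l y))"
  proof cases
    case zero
    show ?thesis
    proof (rule goal_if[where a' = "\<lambda>x l. a x (Suc l)" and \<psi>' = "\<lambda>l. \<psi> (Suc l)"])
      show "Z \<subseteq> X" by (auto simp: Z_def)
      show "card X \<le> 8 * card Z" using zero by simp
      show "\<psi> (Suc l) \<in> G" if "l < Suc M" for l using \<psi> that by simp
      show "F x y = (\<Sum>l<Suc M. a x (Suc l) * \<psi> (Suc l) y)" if "x \<in> Z" for x y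
        unfolding F_def sum.lessThan_Suc_shift[of _ "Suc M"] using that by (simp add: Z_def)
    qed
  next
    case nonzero
    define s where "s x = a x 1 / a x 0" for x
    obtain m where m: "2 * card {x\<in>X1. s x < m} \<le> card X1" "2 * card {x\<in>X1. m < s x} \<le> card X1"
      using median_exists[OF finX1 nonzero(2)] by blast
    define Lo where "Lo = {x\<in>X1. s x < m}"
    define Hi where "Hi = {x\<in>X1. m < s x}"
    define Eq where "Eq = {x\<in>X1. s x = m}"
    have "card X1 = card Lo + card (Hi \<union> Eq)"
      unfolding Lo_def Hi_def Eq_def using finX1
      by (subst card_Un_disjoint[symmetric]) (auto intro!: arg_cong[where f=card])
    also have "card (Hi \<union> Eq) = card Hi + card Eq"
      unfolding Hi_def Eq_def using finX1 by (intro card_Un_disjoint) auto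
    finally have cardX1: "card X1 = card Lo + (card Hi + card Eq)" .
    define \<phi> where "\<phi> y = \<psi> 0 y + m * \<psi> 1 y" for y
    have \<phi>: "\<phi> \<in> G" unfolding \<phi>_def using \<psi> by (intro lin) auto
    have shift_in: "\<psi> (Suc (Suc l)) \<in> G" if "l < M" for l using \<psi> that by simp
    \<comment> \<open>If a quarter of the slopes equal the median, \<open>\<phi>\<close> replaces
      \<open>\<psi> 0\<close> and \<open>\<psi> 1\<close> together. Otherwise, as each side holds at
      most half of \<open>X1\<close>, each also holds at least a quarter.\<close>
    show ?thesis
    proof (cases "card X1 \<le> 4 * card Eq")
      case True
      show ?thesis
      proof (rule goal_if[where a' = "\<lambda>x l. case l of 0 \<Rightarrow> a x 0 | Suc i \<Rightarrow> a x (Suc (Suc i))"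
            and \<psi>' = "\<lambda>l. case l of 0 \<Rightarrow> \<phi> | Suc i \<Rightarrow> \<psi> (Suc (Suc i))"])
        show "Eq \<subseteq> X" by (auto simp: Eq_def X1_def)
        show "card X \<le> 8 * card Eq" using True nonzero by simp
        show "(case l of 0 \<Rightarrow> \<phi> | Suc i \<Rightarrow> \<psi> (Suc (Suc i))) \<in> G" if "l < Suc M" for l
          using that \<phi> shift_in by (cases l) auto
        fix x y assume x: "x \<in> Eq"
        have "a x 1 = m * a x 0" using x by (auto simp: Eq_def X1_def s_def field_simps)
        then show "F x y = (\<Sum>l<Suc M. (case l of 0 \<Rightarrow> a x 0 | Suc i \<Rightarrow> a x (Suc (Suc i))) *
            (case l of 0 \<Rightarrow> \<phi> | Suc i \<Rightarrow> \<psi> (Suc (Suc i))) y)"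
          unfolding sum.lessThan_Suc_shift F by (simp add: \<phi>_def R_def algebra_simps)
      qed
    next
      case False
      then have LoHi: "card X1 \<le> 4 * card Lo" "card X1 \<le> 4 * card Hi"
        using m cardX1 unfolding Lo_def[symmetric] Hi_def[symmetric] by linarith+
      have fins: "finite Lo" "finite Hi" using finX1 by (auto simp: Lo_def Hi_def)
      obtain lo where lo: "bij_betw lo {0..<card Lo} Lo" using ex_bij_betw_nat_finite[OF fins(1)] by blast
      obtain hi where hi: "bij_betw hi {0..<card Hi} Hi" using ex_bij_betw_nat_finite[OF fins(2)] by blast
      define t where "t = min (card Lo) (card Hi)"
      have lo_in: "lo r \<in> Lo" and hi_in: "hi r \<in> Hi" if "r < t" for r
        using lo hi that by (auto simp: t_def bij_betw_def)
      \<comment> \<open>Distances of the two slopes from the median: weighting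
        \<open>f (hi r)\<close> by \<open>Q r\<close> and \<open>f (lo r)\<close> by
        \<open>P r\<close> cancels \<open>\<psi> 1\<close>.\<close>
      define P where "P r = s (hi r) - m" for r
      define Q where "Q r = m - s (lo r)" for r
      have PQ: "P r > 0" "Q r > 0" if "r < t" for r
        using lo_in[OF that] hi_in[OF that] by (auto simp: P_def Q_def Lo_def Hi_def)
      define b where "b x l = a x (Suc (Suc l)) / a x 0" for x l
      define f where "f x y = \<phi> y + (s x - m) * \<psi> 1 y + R (b x) y" for x y
      have Ff: "F x y = a x 0 * f x y" if "x \<in> X1" for x y
      proof -
        have "a x 0 \<noteq> 0" using that by (simp add: X1_def)
        moreover have "a x 0 * R (b x) y = R (\<lambda>l. a x (Suc (Suc l))) y"
          unfolding R_def b_def sum_distrib_left using \<open>a x 0 \<noteq> 0\<close> by (intro sum.cong) auto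
        ultimately show ?thesis unfolding F f_def \<phi>_def by (simp add: s_def algebra_simps)
      qed
      \<comment> \<open>In the combination with coefficients \<open>au\<close> the terms of
        \<open>\<psi> 1\<close> have cancelled, in the one with \<open>aw\<close> those of
        \<open>\<phi>\<close>; both use only \<open>Suc M\<close> functions.\<close>
      define au where "au r l = (case l of 0 \<Rightarrow> P r + Q r | Suc i \<Rightarrow> Q r * b (hi r) i + P r * b (lo r) i)" for r l
      define \<psi>u where "\<psi>u l = (case l of 0 \<Rightarrow> \<phi> | Suc i \<Rightarrow> \<psi> (Suc (Suc i)))" for l
      define aw where "aw r l = (case l of 0 \<Rightarrow> P r + Q r | Suc i \<Rightarrow> b (hi r) i - b (lo r) i)" for r l
      define \<psi>w where "\<psi>w l = (case l of 0 \<Rightarrow> \<psi> 1 | Suc i \<Rightarrow> \<psi> (Suc (Suc i)))" for l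
      have \<psi>u_in: "\<psi>u l \<in> G" if "l < Suc M" for l using that \<phi> shift_in by (cases l) (auto simp: \<psi>u_def)
      have \<psi>w_in: "\<psi>w l \<in> G" if "l < Suc M" for l
        using that \<psi> shift_in by (cases l) (auto simp: \<psi>w_def)
      have u: "(\<Sum>l<Suc M. au r l * \<psi>u l y) = Q r * f (hi r) y + P r * f (lo r) y" for r y
        unfolding sum.lessThan_Suc_shift au_def \<psi>u_def f_def R_def P_def Q_def
        by (simp add: algebra_simps sum.distrib sum_distrib_left sum_subtractf)
      have w: "(\<Sum>l<Suc M. aw r l * \<psi>w l y) = f (hi r) y - f (lo r) y" for r y
        unfolding sum.lessThan_Suc_shift aw_def \<psi>w_def f_def R_def P_def Q_def
        by (simp add: algebra_simps sum.distrib sum_distrib_left sum_subtractf)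
      obtain W1 R1 where W1: "shrinks c J V W1" "R1 \<subseteq> {..<t}" "c * real (card {..<t}) \<le> real (card R1)"
        "\<And>r. r \<in> R1 \<Longrightarrow> sgn_const J W1 (\<lambda>y. \<Sum>l<Suc M. au r l * \<psi>u l y)"
        using resolvableD[OF res finV, where X = "{..<t}" and a = au and \<psi> = \<psi>u] \<psi>u_in finite_lessThan by blast
      have finR1: "finite R1" using W1(2) finite_subset by blast
      obtain W2 R2 where W2: "shrinks c J W1 W2" "R2 \<subseteq> R1" "c * real (card R1) \<le> real (card R2)"
        "\<And>r. r \<in> R2 \<Longrightarrow> sgn_const J W2 (\<lambda>y. \<Sum>l<Suc M. aw r l * \<psi>w l y)"
        using resolvableD[OF res shrinks_finite[OF W1(1) finV] finR1, where a = aw and \<psi> = \<psi>w] \<psi>w_in by blast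
      have R2t: "R2 \<subseteq> {..<t}" using W1 W2 by blast
      have F_const: "sgn_const J W2 (F x)" if "x \<in> X1" "sgn_const J W2 (f x)" for x
        by (rule sgn_const_scale[OF that(2), where c = "a x 0"]) (rule Ff[OF that(1)])
      define pick where "pick r = (if sgn_const J W2 (F (hi r)) then hi r else lo r)" for r
      have pick: "sgn_const J W2 (F (pick r))" if "r \<in> R2" for r
      proof -
        have rt: "r < t" using that R2t by auto
        have "sgn_const J W2 (\<lambda>y. \<Sum>l<Suc M. au r l * \<psi>u l y)"
          using W1(4) W2(1,2) that sgn_const_shrinks by blast
        then have "sgn_const J W2 (f (hi r)) \<or> sgn_const J W2 (f (lo r))"
          using W2(4)[OF that] sgn_const_one_of_pair[OF PQ[OF rt]] unfolding u w by blast
        moreover have "hi r \<in> X1" "lo r \<in> X1" using hi_in lo_in rt by (auto simp: Hi_def Lo_def)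
        ultimately have "sgn_const J W2 (F (hi r)) \<or> sgn_const J W2 (F (lo r))"
          using F_const by blast
        then show ?thesis by (auto simp: pick_def)
      qed
      have "inj_on pick {..<t}"
      proof (rule inj_onI)
        fix r r' assume r: "r \<in> {..<t}" "r' \<in> {..<t}" and eq: "pick r = pick r'"
        have inj: "inj_on lo {..<t}" "inj_on hi {..<t}"
          using lo hi by (auto simp: bij_betw_def t_def intro: inj_on_subset)
        have "hi r \<noteq> lo r'" "lo r \<noteq> hi r'"
          using hi_in[of r] lo_in[of r'] lo_in[of r] hi_in[of r'] r by (auto simp: Hi_def Lo_def)
        then have "hi r = hi r' \<or> lo r = lo r'" using eq unfolding pick_def by metis
        then show "r = r'" using inj r by (blast dest: inj_onD)
      qed
      then have cardp: "card (pick ` R2) = card R2" using R2t by (meson card_image inj_on_subset)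
      \<comment> \<open>There are \<open>t \<ge> |X| / 8\<close> pairs: more than half of
        \<open>X\<close> has a leading coefficient, and a quarter of these lies on each side of the
        median. Each of the two searches costs a factor \<open>c\<close>.\<close>
      have "c * c / 8 * real (card X) \<le> c * c / 8 * real (8 * t)"
        using nonzero LoHi c by (intro mult_left_mono) (auto simp: t_def)
      also have "\<dots> = c * (c * real (card {..<t}))" by simp
      also have "\<dots> \<le> c * real (card R1)" using W1(3) c by (intro mult_left_mono) auto
      also have "\<dots> \<le> real (card (pick ` R2))" using W2(3) cardp by simp
      finally have "c * c / 8 * real (card X) \<le> real (card (pick ` R2))" .
      moreover have "shrinks (c * c / 8) J V W2"
        by (rule shrinks_weaken[OF shrinks_trans[OF W1(1) W2(1)]]) (use c in auto)
      moreover have "pick ` R2 \<subseteq> X"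
        using hi_in lo_in R2t by (auto simp: pick_def Hi_def Lo_def X1_def)
      moreover have "\<forall>x\<in>pick ` R2. sgn_const J W2 (\<lambda>y. \<Sum>l<Suc (Suc M). a x l * \<psi> l y)"
        using pick unfolding F_def by blast
      ultimately show ?thesis by blast
    qed
  qed
qed

text \<open>Elimination changes the functions but stays inside a \<open>G\<close> closed under
  \<open>g + t * h\<close>, so the constant depends on \<open>N\<close> and \<open>c0\<close> alone
  and holds uniformly in \<open>J\<close> and \<open>G\<close>. The actual start is
  \<open>N = 1\<close>: all members are multiples of one function, and one application of
  \<open>homogenizable\<close> serves them all.\<close>

lemma prune_and_search:
  assumes c0: "0 < c0" "c0 \<le> 1"
  shows "\<exists>c>0. c \<le> 1 \<and> (\<forall>J (G :: ((nat \<Rightarrow> 'a) \<Rightarrow> real) set).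
    (\<forall>g\<in>G. \<forall>h\<in>G. \<forall>t. (\<lambda>y. g y + t * h y) \<in> G) \<longrightarrow> homogenizable c0 J G \<longrightarrow> resolvable c N J G)"
proof (induction N)
  case 0
  have "resolvable 1 0 J G" for J and G :: "((nat \<Rightarrow> 'a) \<Rightarrow> real) set"
    unfolding resolvable_def
  proof (intro allI impI)
    fix V :: "nat \<Rightarrow> 'a set" and X :: "nat set" and a :: "nat \<Rightarrow> nat \<Rightarrow> real" and \<psi> :: "nat \<Rightarrow> (nat \<Rightarrow> 'a) \<Rightarrow> real"
    show "\<exists>W X'. shrinks 1 J V W \<and> X' \<subseteq> X \<and> 1 * real (card X) \<le> real (card X') \<and>
        (\<forall>x\<in>X'. sgn_const J W (\<lambda>y. \<Sum>l<0. a x l * \<psi> l y))"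
      by (rule exI[of _ V], rule exI[of _ X]) (simp add: shrinks_refl sgn_const_def)
  qed
  then show ?case by (intro exI[of _ 1]) auto
next
  case (Suc N)
  show ?case
  proof (cases N)
    case 0
    have "resolvable c0 1 J G" if hom: "homogenizable c0 J G" for J and G :: "((nat \<Rightarrow> 'a) \<Rightarrow> real) set"
      unfolding resolvable_def
    proof (intro allI impI)
      fix V :: "nat \<Rightarrow> 'a set" and X :: "nat set" and a :: "nat \<Rightarrow> nat \<Rightarrow> real" and \<psi> :: "nat \<Rightarrow> (nat \<Rightarrow> 'a) \<Rightarrow> real"
      assume "\<forall>j\<in>J. finite (V j)" "\<forall>l<1. \<psi> l \<in> G"
      then obtain W where W: "shrinks c0 J V W" "sgn_const J W (\<psi> 0)"
        using hom unfolding homogenizable_def by (metis less_one)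
      moreover have "sgn_const J W (\<lambda>y. \<Sum>l<1. a x l * \<psi> l y)" for x
        by (rule sgn_const_scale[OF W(2), where c = "a x 0"]) simp
      moreover have "c0 * real (card X) \<le> real (card X)" 
        using c0 by (simp add: mult_left_le_one_le)
      ultimately show "\<exists>W X'. shrinks c0 J V W \<and> X' \<subseteq> X \<and> c0 * real (card X) \<le> real (card X') \<and>
        (\<forall>x\<in>X'. sgn_const J W (\<lambda>y. \<Sum>l<1. a x l * \<psi> l y))" by blast
    qed
    then show ?thesis using c0 0 by (intro exI[of _ c0]) auto
  next
    case (Suc M)
    obtain c where c: "0 < c" "c \<le> 1" and res: "\<And>J (G :: ((nat \<Rightarrow> 'a) \<Rightarrow> real) set).
      (\<forall>g\<in>G. \<forall>h\<in>G. \<forall>t. (\<lambda>y. g y + t * h y) \<in> G) \<Longrightarrow> homogenizable c0 J G \<Longrightarrow> resolvable c (Suc M) J G"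
      using Suc.IH Suc by auto
    have "resolvable (c * c / 8) (Suc (Suc M)) J G"
      if "\<forall>g\<in>G. \<forall>h\<in>G. \<forall>t. (\<lambda>y. g y + t * h y) \<in> G" "homogenizable c0 J G"
      for J and G :: "((nat \<Rightarrow> 'a) \<Rightarrow> real) set"
      using that res[OF that] c by (intro prune_and_search_step) auto
    moreover have "c * c / 8 > 0" "c * c / 8 \<le> 1"
      using c mult_le_one[of c c] by auto
    ultimately show ?thesis using Suc by (intro exI[of _ "c * c / 8"]) auto
  qed
qed

text \<open>Restrictions of polynomials to a product, with \<open>\<phi>\<close> running over the monomials of a single factor.\<close>

inductive_set tensors :: "('b \<Rightarrow> 'a \<Rightarrow> real) \<Rightarrow> 'b set \<Rightarrow> nat set \<Rightarrow> ((nat \<Rightarrow> 'a) \<Rightarrow> real) set"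
  for \<phi> B I where
  zero: "(\<lambda>x. 0) \<in> tensors \<phi> B I"
| add_term: "g \<in> tensors \<phi> B I \<Longrightarrow> (\<And>i. i \<in> I \<Longrightarrow> \<alpha> i \<in> B) \<Longrightarrow>
    (\<lambda>x. g x + c * (\<Prod>i\<in>I. \<phi> (\<alpha> i) (x i))) \<in> tensors \<phi> B I"

lemma tensors_lin:
  assumes "g \<in> tensors \<phi> B I" "h \<in> tensors \<phi> B I"
  shows "(\<lambda>x. g x + t * h x) \<in> tensors \<phi> B I"
  using assms(2)
proof induction
  case zero
  then show ?case using assms(1) by simp
next
  case (add_term h \<alpha> c)
  then have "(\<lambda>x. (g x + t * h x) + (t * c) * (\<Prod>i\<in>I. \<phi> (\<alpha> i) (x i))) \<in> tensors \<phi> B I"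
    by (intro tensors.add_term) auto
  then show ?case by (simp add: algebra_simps)
qed

lemma tensors_indep: "g \<in> tensors \<phi> B J \<Longrightarrow> i \<notin> J \<Longrightarrow> g (x(i := p)) = g x"
  by (induction rule: tensors.induct) (auto intro!: arg_cong2[where f="(*)"] prod.cong)

text \<open>Linearization in one coordinate: with a point \<open>p\<close> at position
  \<open>i\<close>, the function becomes a combination of the \<open>\<psi> \<beta>\<close> with
  coefficients \<open>\<phi> \<beta> p\<close>. The points of one part thus form the index family of
  a search on the other parts.\<close>

lemma tensors_peel:
  assumes "g \<in> tensors \<phi> B (insert i J)" "finite J" "i \<notin> J" "finite B"
  obtains \<psi> where "\<And>\<beta>. \<psi> \<beta> \<in> tensors \<phi> B J" "\<And>x. g x = (\<Sum>\<beta>\<in>B. \<phi> \<beta> (x i) * \<psi> \<beta> x)"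
proof -
  have "\<exists>\<psi>. (\<forall>\<beta>. \<psi> \<beta> \<in> tensors \<phi> B J) \<and> (\<forall>x. g x = (\<Sum>\<beta>\<in>B. \<phi> \<beta> (x i) * \<psi> \<beta> x))"
    using assms(1)
  proof induction
    case zero
    show ?case by (intro exI[of _ "\<lambda>_ _. 0"]) (simp add: tensors.zero)
  next
    case (add_term g \<alpha> c)
    then obtain \<psi> where \<psi>: "\<And>\<beta>. \<psi> \<beta> \<in> tensors \<phi> B J" "\<And>x. g x = (\<Sum>\<beta>\<in>B. \<phi> \<beta> (x i) * \<psi> \<beta> x)"
      by auto
    define \<psi>' where "\<psi>' \<beta> x = \<psi> \<beta> x + (if \<beta> = \<alpha> i then c else 0) * (\<Prod>j\<in>J. \<phi> (\<alpha> j) (x j))" for \<beta> x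
    have "\<psi>' \<beta> \<in> tensors \<phi> B J" for \<beta>
      unfolding \<psi>'_def using \<psi>(1) add_term.hyps by (intro tensors.add_term) auto
    moreover have "g x + c * (\<Prod>i\<in>insert i J. \<phi> (\<alpha> i) (x i)) = (\<Sum>\<beta>\<in>B. \<phi> \<beta> (x i) * \<psi>' \<beta> x)" for x
    proof -
      have "(\<Sum>\<beta>\<in>B. \<phi> \<beta> (x i) * \<psi>' \<beta> x) = g x +
          (\<Sum>\<beta>\<in>B. if \<beta> = \<alpha> i then \<phi> \<beta> (x i) * c * (\<Prod>j\<in>J. \<phi> (\<alpha> j) (x j)) else 0)"
        unfolding \<psi>(2) sum.distrib[symmetric] \<psi>'_def by (intro sum.cong) (auto simp: algebra_simps)
      also have "\<dots> = g x + c * (\<Prod>i\<in>insert i J. \<phi> (\<alpha> i) (x i))"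
        using add_term.hyps(2)[of i] assms by simp
      finally show ?thesis by simp
    qed
    ultimately show ?case by blast
  qed
  then show ?thesis using that by blast
qed

text \<open>Induction on the number of factors. The search gives a subbox of the other parts on
  which a constant fraction of the points of part \<open>i\<close> have a constant sign each. These
  signs may differ from point to point; keeping one that is carried by a third of the points costs
  the factor 3.\<close>

lemma tensors_homogenizable:
  fixes \<phi> :: "'b \<Rightarrow> 'a \<Rightarrow> real"
  assumes finB: "finite B"
  shows "\<exists>c>0. c \<le> 1 \<and> (\<forall>I. finite I \<longrightarrow> card I = n \<longrightarrow> homogenizable c I (tensors \<phi> B I))"
proof (induction n)
  case 0
  have "homogenizable 1 {} (tensors \<phi> B {})"
    unfolding homogenizable_def shrinks_def sgn_const_def by simp
  then show ?case by (intro exI[of _ 1]) auto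
next
  case (Suc n)
  then obtain c0 where c0: "0 < c0" "c0 \<le> 1"
    "\<And>I. finite I \<Longrightarrow> card I = n \<Longrightarrow> homogenizable c0 I (tensors \<phi> B I)" by blast
  obtain c where c: "0 < c" "c \<le> 1" "\<And>J (G :: ((nat \<Rightarrow> 'a) \<Rightarrow> real) set).
      (\<forall>g\<in>G. \<forall>h\<in>G. \<forall>t. (\<lambda>y. g y + t * h y) \<in> G) \<Longrightarrow> homogenizable c0 J G \<Longrightarrow> resolvable c (card B) J G"
    using prune_and_search[OF c0(1,2), of "card B"] by blast
  have "homogenizable (c / 3) I (tensors \<phi> B I)" if I: "finite I" "card I = Suc n" for I
    unfolding homogenizable_def
  proof (intro allI impI)
    fix V :: "nat \<Rightarrow> 'a set" and g
    assume finV: "\<forall>j\<in>I. finite (V j)" and g: "g \<in> tensors \<phi> B I"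
    obtain i J where J: "I = insert i J" "i \<notin> J" "card J = n" "finite J"
      using I by (metis card_Suc_eq finite_insert)
    obtain \<psi> where \<psi>: "\<And>\<beta>. \<psi> \<beta> \<in> tensors \<phi> B J" "\<And>x. g x = (\<Sum>\<beta>\<in>B. \<phi> \<beta> (x i) * \<psi> \<beta> x)"
      using tensors_peel[of g \<phi> B i J] g J finB by auto
    have res: "resolvable c (card B) J (tensors \<phi> B J)"
      using c0(3)[OF J(4,3)] by (intro c(3)) (auto intro: tensors_lin)
    have finVi: "finite (V i)" and finVJ: "\<forall>j\<in>J. finite (V j)" using finV J by auto
    obtain en where en: "bij_betw en {0..<card (V i)} (V i)" using ex_bij_betw_nat_finite[OF finVi] by blast
    obtain bn where bn: "bij_betw bn {0..<card B} B" using ex_bij_betw_nat_finite[OF finB] by blast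
    define G where "G p y = (\<Sum>\<beta>\<in>B. \<phi> \<beta> p * \<psi> \<beta> y)" for p y
    have G_bn: "(\<Sum>l<card B. \<phi> (bn l) p * \<psi> (bn l) y) = G p y" for p y
      unfolding G_def by (rule sum.reindex_bij_betw) (use bn in \<open>simp add: atLeast0LessThan\<close>)
    have "\<exists>W X'. shrinks c J V W \<and> X' \<subseteq> {0..<card (V i)} \<and> c * real (card {0..<card (V i)}) \<le> real (card X')
        \<and> (\<forall>x\<in>X'. sgn_const J W (\<lambda>y. \<Sum>l<card B. \<phi> (bn l) (en x) * \<psi> (bn l) y))"
      by (rule resolvableD[OF res finVJ, where X = "{0..<card (V i)}" and \<psi> = "\<lambda>l. \<psi> (bn l)"
          and a = "\<lambda>x l. \<phi> (bn l) (en x)"])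
        (auto simp: \<psi>(1))
    then obtain W X' where W: "shrinks c J V W" "X' \<subseteq> {0..<card (V i)}" "c * real (card (V i)) \<le> real (card X')"
        "\<And>x. x \<in> X' \<Longrightarrow> sgn_const J W (G (en x))"
      unfolding G_bn by auto
    define X where "X = en ` X'"
    have X: "X \<subseteq> V i" "c * real (card (V i)) \<le> real (card X)" "\<And>p. p \<in> X \<Longrightarrow> sgn_const J W (G p)"
    proof -
      have "inj_on en X'" using en W(2) by (meson bij_betw_def inj_on_subset)
      then show "c * real (card (V i)) \<le> real (card X)" using W(3) by (simp add: X_def card_image)
      show "X \<subseteq> V i" using en W(2) by (auto simp: X_def bij_betw_def)
    qed (use W(4) in \<open>auto simp: X_def\<close>)
    have finX: "finite X" using X(1) finVi finite_subset by blast
    \<comment> \<open>The point of the box at which signs are compared. If the box is empty this is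
      an arbitrary value, and constancy holds vacuously.\<close>
    define y0 where "y0 = (SOME y. y \<in> PiE J W)"
    define Xs where "Xs s = {p\<in>X. sgn (G p y0) = s}" for s
    have "card X = card (Xs (- 1)) + card (Xs 0 \<union> Xs 1)"
      using finX by (subst card_Un_disjoint[symmetric])
        (auto simp: Xs_def sgn_if intro!: arg_cong[where f=card] split: if_splits)
    also have "card (Xs 0 \<union> Xs 1) = card (Xs 0) + card (Xs 1)"
      using finX by (intro card_Un_disjoint) (auto simp: Xs_def)
    finally have "card X = card (Xs (- 1)) + (card (Xs 0) + card (Xs 1))" .
    then have "card X \<le> 3 * card (Xs (- 1)) \<or> card X \<le> 3 * card (Xs 0) \<or> card X \<le> 3 * card (Xs 1)"
      by linarith
    then obtain s where s: "card X \<le> 3 * card (Xs s)" by blast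
    define W' where "W' = W(i := Xs s)"
    have W': "\<And>j. j \<in> J \<Longrightarrow> W' j = W j" "W' i = Xs s" using J by (auto simp: W'_def)
    have "shrinks (c / 3) I V W'"
      unfolding shrinks_def J(1) ball_simps
    proof (intro conjI ballI)
      show "W' i \<subseteq> V i" using X(1) by (auto simp: W' Xs_def)
      show "c / 3 * real (card (V i)) \<le> real (card (W' i))"
        using X(2) s by (simp add: W')
      have sh: "shrinks (c / 3) J V W" using W(1) c by (intro shrinks_weaken[OF W(1)]) auto
      fix j assume "j \<in> J"
      then show "W' j \<subseteq> V j" "c / 3 * real (card (V j)) \<le> real (card (W' j))"
        using sh W' by (auto simp: shrinks_def)
    qed
    moreover have "sgn_const I W' g"
    proof -
      have "sgn (g x) = s" if x: "x \<in> PiE I W'" for x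
      proof -
        have xi: "x i \<in> Xs s" using x W'(2) J(1) by (auto simp: PiE_iff)
        define y where "y = restrict x J"
        have y: "y \<in> PiE J W" using x W' J(1) by (auto simp: y_def PiE_iff)
        then have "y0 \<in> PiE J W" unfolding y0_def by (rule someI[where P = "\<lambda>y. y \<in> PiE J W"])
        moreover have "sgn_const J W (G (x i))" using X(3) xi by (simp add: Xs_def)
        ultimately have "sgn (G (x i) y) = sgn (G (x i) y0)"
          using y unfolding sgn_const_def by blast
        also have "\<dots> = s" using xi by (simp add: Xs_def)
        also have "G (x i) y = g x"
        proof -
          have "x = y(i := x i)" using x J(1) by (auto simp: y_def fun_eq_iff PiE_iff extensional_def)
          then have "\<psi> \<beta> x = \<psi> \<beta> y" for \<beta> using tensors_indep[OF \<psi>(1) J(2)] by metis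
          then show ?thesis by (simp add: G_def \<psi>(2))
        qed
        finally show ?thesis .
      qed
      then show ?thesis by (simp add: sgn_const_def)
    qed
    ultimately show "\<exists>W. shrinks (c / 3) I V W \<and> sgn_const I W g" by blast
  qed
  then show ?case using c by (intro exI[of _ "c / 3"]) auto
qed

text \<open>The functions are treated one after another: constancy obtained earlier passes to
  subboxes, so the constants multiply and depend on the number of functions only, not on the
  functions.\<close>

lemma tensors_homogeneous_box:
  fixes \<phi> :: "'b \<Rightarrow> 'a \<Rightarrow> real"
  assumes "finite B" "finite I"
  shows "\<exists>c>0. c \<le> 1 \<and> (\<forall>V gs. (\<forall>i\<in>I. finite (V i)) \<longrightarrow> length gs = r \<longrightarrow> set gs \<subseteq> tensors \<phi> B I \<longrightarrow>
    (\<exists>W. shrinks c I V W \<and> (\<forall>g\<in>set gs. sgn_const I W g)))"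
proof (induction r)
  case 0
  show ?case
  proof (intro exI[of _ 1] conjI allI impI)
    show "\<exists>W. shrinks 1 I V W \<and> (\<forall>g\<in>set gs. sgn_const I W g)"
      if "length gs = 0" for V :: "nat \<Rightarrow> 'a set" and gs
      using that by (intro exI[of _ V]) (simp add: shrinks_refl)
  qed auto
next
  case (Suc r)
  then obtain c where c: "0 < c" "c \<le> 1" "\<And>V gs. (\<forall>i\<in>I. finite (V i)) \<Longrightarrow> length gs = r \<Longrightarrow>
    set gs \<subseteq> tensors \<phi> B I \<Longrightarrow> \<exists>W. shrinks c I V W \<and> (\<forall>g\<in>set gs. sgn_const I W g)" by blast
  obtain c1 where c1: "0 < c1" "c1 \<le> 1" "homogenizable c1 I (tensors \<phi> B I)"
    using tensors_homogenizable[OF assms(1), of "card I" \<phi>] assms(2) by blast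
  show ?case
  proof (intro exI[of _ "c1 * c"] conjI allI impI)
    fix V :: "nat \<Rightarrow> 'a set" and gs
    assume V: "\<forall>i\<in>I. finite (V i)" "length gs = Suc r" "set gs \<subseteq> tensors \<phi> B I"
    then obtain g hs where gs: "gs = g # hs" "length hs = r" by (cases gs) auto
    obtain W where W: "shrinks c1 I V W" "sgn_const I W g"
      using c1(3)[unfolded homogenizable_def, rule_format, of V g] V gs by auto
    obtain U where U: "shrinks c I W U" "\<forall>g\<in>set hs. sgn_const I U g"
      using c(3)[OF shrinks_finite[OF W(1) V(1)] gs(2)] V gs by auto
    show "\<exists>W. shrinks (c1 * c) I V W \<and> (\<forall>g\<in>set gs. sgn_const I W g)"
      using shrinks_trans[OF W(1) U(1)] c U sgn_const_shrinks[OF W(2) U(1)] gs by auto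
  qed (use c c1 in \<open>auto intro: mult_le_one\<close>)
qed

section \<open>Links of heavy classes\<close>

lemma dyadic_level:
  fixes r :: real
  assumes "1 \<le> r"
  obtains j :: nat where "2 ^ j \<le> r" "r < 2 ^ Suc j"
proof -
  obtain n where n: "r < 2 ^ n" using real_arch_pow[of 2 r] by auto
  define m where "m = (LEAST n. r < 2 ^ n)"
  have m: "r < 2 ^ m" unfolding m_def using n by (rule LeastI)
  then have "m \<noteq> 0" using assms by (intro notI) simp
  then obtain j where j: "m = Suc j" using not0_implies_Suc by blast
  have "\<not> r < 2 ^ j" using not_less_Least[of j "\<lambda>n. r < 2 ^ n"] j by (simp add: m_def)
  then show ?thesis using that[of j] m j by simp
qed

text \<open>Summable weights of polynomial decay cost nothing for \<open>d \<ge> 2\<close>, where \<open>a\<^sup>d\<^sup>-\<^sup>1\<close> grows geometrically with the level; for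
  \<open>d = 1\<close> their decay is what costs the factor \<open>log\<^sup>2 (1/\<epsilon>)\<close>.\<close>

definition level_weight :: "nat \<Rightarrow> real" where
  "level_weight j = 1 / ((real j + 1) * (real j + 2))"

lemma level_weight_pos: "0 < level_weight j" by (simp add: level_weight_def)

lemma sum_level_weight:
  assumes "finite L"
  shows "sum level_weight L \<le> 1"
proof -
  have *: "(\<Sum>j<N. level_weight j) = 1 - 1 / (real N + 1)" for N
  proof (induction N)
    case (Suc N)
    have "level_weight N = 1 / (real N + 1) - 1 / (real N + 2)"
      by (simp add: level_weight_def divide_simps)
    then show ?case using Suc by simp
  qed simp
  obtain N where "L \<subseteq> {..<N}" using finite_nat_iff_bounded assms by blast
  then have "sum level_weight L \<le> (\<Sum>j<N. level_weight j)"
    by (intro sum_mono2) (auto intro: less_imp_le level_weight_pos)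
  also have "\<dots> \<le> 1" unfolding * by simp
  finally show ?thesis .
qed

text \<open>Weighted pigeonhole over the degree levels. Level \<open>j\<close> carries mass at most
  its size times \<open>2 ^ Suc j * b * n\<close>; if all levels fell short of their share
  \<open>level_weight j\<close>, the total would stay below \<open>b * |X| * n\<close>, as the
  weights sum to at most 1.\<close>

lemma heavy_level:
  fixes deg :: "'x \<Rightarrow> real"
  assumes finX: "finite X" "X \<noteq> {}" and G: "G \<subseteq> X" and b: "0 < b" and n: "0 \<le> n"
    and deg: "\<And>x. x \<in> G \<Longrightarrow> b * n \<le> deg x" and mass: "b * real (card X) * n \<le> (\<Sum>x\<in>G. deg x)" and n0: "0 < n"
  obtains j where "{x\<in>G. 2 ^ j * b * n \<le> deg x \<and> deg x < 2 ^ Suc j * b * n} \<noteq> {}"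
    "level_weight j * real (card X) \<le> 2 ^ Suc j * real (card {x\<in>G. 2 ^ j * b * n \<le> deg x \<and> deg x < 2 ^ Suc j * b * n})"
proof -
  have finG: "finite G" using finX G finite_subset by blast
  have "\<exists>j. 2 ^ j * b * n \<le> deg x \<and> deg x < 2 ^ Suc j * b * n" if "x \<in> G" for x
  proof -
    have "1 \<le> deg x / (b * n)" using deg[OF that] b n0 by (simp add: le_divide_eq)
    then obtain j where "2 ^ j \<le> deg x / (b * n)" "deg x / (b * n) < 2 ^ Suc j" using dyadic_level by blast
    then show ?thesis using b n0
      by (intro exI[of _ j]) (simp add: le_divide_eq divide_less_eq mult.assoc del: power_Suc)
  qed
  then obtain lev where lev: "\<And>x. x \<in> G \<Longrightarrow> 2 ^ lev x * b * n \<le> deg x \<and> deg x < 2 ^ Suc (lev x) * b * n"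
    by metis
  define X' where "X' j = {x\<in>G. 2 ^ j * b * n \<le> deg x \<and> deg x < 2 ^ Suc j * b * n}" for j
  have finX': "finite (X' j)" for j using finG by (simp add: X'_def)
  define L where "L = lev ` G"
  have finL: "finite L" using finG by (simp add: L_def)
  have "b * real (card X) * n \<le> (\<Sum>j\<in>L. \<Sum>x\<in>{x\<in>G. lev x = j}. deg x)"
    using mass finG finL by (subst sum.group) (auto simp: L_def)
  also have "\<dots> \<le> (\<Sum>j\<in>L. real (card (X' j)) * (2 ^ Suc j * b * n))"
  proof (rule sum_mono)
    fix j
    have "(\<Sum>x\<in>{x\<in>G. lev x = j}. deg x) \<le> (\<Sum>x\<in>{x\<in>G. lev x = j}. 2 ^ Suc j * b * n)"
      by (rule sum_mono) (use lev in fastforce)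
    also have "\<dots> = real (card {x\<in>G. lev x = j}) * (2 ^ Suc j * b * n)" by simp
    also have "\<dots> \<le> real (card (X' j)) * (2 ^ Suc j * b * n)"
      using lev b n by (intro mult_right_mono of_nat_mono card_mono finX') (auto simp: X'_def)
    finally show "(\<Sum>x\<in>{x\<in>G. lev x = j}. deg x) \<le> real (card (X' j)) * (2 ^ Suc j * b * n)" .
  qed
  also have "\<dots> = (\<Sum>j\<in>L. 2 ^ Suc j * real (card (X' j))) * (b * n)"
    unfolding sum_distrib_right by (intro sum.cong) auto
  finally have tot: "real (card X) \<le> (\<Sum>j\<in>L. 2 ^ Suc j * real (card (X' j)))"
    using b n0 by (simp add: mult.assoc mult.commute[of b] mult.left_commute)
  have "\<exists>j\<in>L. level_weight j * real (card X) \<le> 2 ^ Suc j * real (card (X' j))"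
  proof (rule ccontr)
    assume H: "\<not> ?thesis"
    have cX: "0 < real (card X)" using finX by (simp add: card_gt_0_iff)
    have "L \<noteq> {}" using tot cX by auto
    then have "(\<Sum>j\<in>L. 2 ^ Suc j * real (card (X' j))) < (\<Sum>j\<in>L. level_weight j * real (card X))"
      using H finL by (intro sum_strict_mono) auto
    also have "\<dots> = sum level_weight L * real (card X)" by (simp add: sum_distrib_right)
    also have "\<dots> \<le> 1 * real (card X)" using finL by (intro mult_right_mono sum_level_weight) auto
    finally show False using tot by simp
  qed
  then obtain j where j: "j \<in> L" "level_weight j * real (card X) \<le> 2 ^ Suc j * real (card (X' j))" by blast
  moreover have "X' j \<noteq> {}" using j(1) lev by (auto simp: L_def X'_def)
  ultimately show ?thesis using that[of j] by (simp add: X'_def)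
qed

text \<open>Average over the choice of \<open>x1\<close>. If \<open>y\<close> splits
  \<open>P\<close> into \<open>t\<close> and \<open>t'\<close> points, the ordered pairs disagreeing
  at \<open>y\<close> number \<open>2 * t * t'\<close>, which is twice the product of maximum and
  minimum and so at most \<open>2 * |P| * min t t'\<close>.\<close>

lemma representative_of_class:
  fixes e :: "'x \<Rightarrow> 'y \<Rightarrow> bool"
  assumes fin: "finite P" "finite Y" and ne: "P \<noteq> {}"
  obtains x1 where "x1 \<in> P"
    "(\<Sum>x\<in>P. card {y\<in>Y. e x1 y \<noteq> e x y}) \<le> 2 * (\<Sum>y\<in>Y. min (card {x\<in>P. \<not> e x y}) (card {x\<in>P. e x y}))"
proof -
  define mm where "mm = (\<Sum>y\<in>Y. min (card {x\<in>P. \<not> e x y}) (card {x\<in>P. e x y}))"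
  have count: "(\<Sum>x\<in>P. card {y\<in>Y. R x y}) = (\<Sum>y\<in>Y. card {x\<in>P. R x y})" for R
    using fin sum.swap_restrict[of P Y "\<lambda>_ _. 1::nat" R] by simp
  have "(\<Sum>x1\<in>P. \<Sum>x\<in>P. card {y\<in>Y. e x1 y \<noteq> e x y}) = (\<Sum>x1\<in>P. \<Sum>y\<in>Y. card {x\<in>P. e x1 y \<noteq> e x y})"
    by (simp only: count)
  also have "\<dots> = (\<Sum>y\<in>Y. \<Sum>x1\<in>P. card {x\<in>P. e x1 y \<noteq> e x y})" by (rule sum.swap)
  also have "\<dots> \<le> (\<Sum>y\<in>Y. card P * (2 * min (card {x\<in>P. \<not> e x y}) (card {x\<in>P. e x y})))"
  proof (rule sum_mono)
    fix y
    define t where "t = card {x\<in>P. e x y}"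
    define t' where "t' = card {x\<in>P. \<not> e x y}"
    have "(\<Sum>x1\<in>P. card {x\<in>P. e x1 y \<noteq> e x y}) = (\<Sum>x1\<in>P. if e x1 y then t' else t)"
      by (intro sum.cong) (auto simp: t_def t'_def)
    also have "\<dots> = t * t' + t' * t"
      using fin by (simp add: sum.If_cases t_def t'_def Int_def)
    also have "\<dots> = max t' t * (2 * min t' t)" by (auto simp: max_def min_def)
    also have "\<dots> \<le> card P * (2 * min t' t)"
      using fin by (intro mult_right_mono) (auto simp: t_def t'_def intro: card_mono)
    finally show "(\<Sum>x1\<in>P. card {x\<in>P. e x1 y \<noteq> e x y}) \<le>
        card P * (2 * min (card {x\<in>P. \<not> e x y}) (card {x\<in>P. e x y}))" by (simp add: t_def t'_def)
  qed
  also have "\<dots> = card P * (2 * mm)" by (simp add: mm_def sum_distrib_left)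
  finally have tot: "(\<Sum>x1\<in>P. \<Sum>x\<in>P. card {y\<in>Y. e x1 y \<noteq> e x y}) \<le> card P * (2 * mm)" .
  have "\<exists>x1\<in>P. (\<Sum>x\<in>P. card {y\<in>Y. e x1 y \<noteq> e x y}) \<le> 2 * mm"
  proof (rule ccontr)
    assume "\<not> ?thesis"
    then have "(\<Sum>x1\<in>P. 2 * mm) < (\<Sum>x1\<in>P. \<Sum>x\<in>P. card {y\<in>Y. e x1 y \<noteq> e x y})"
      using fin ne by (intro sum_strict_mono) auto
    then show False using tot by simp
  qed
  then show ?thesis using that by (auto simp: mm_def)
qed

text \<open>Of \<open>n + 1\<close> sample elements one is set aside to measure how a further
  element splits the partition induced by the other \<open>n\<close>. That partition has at most
  \<open>B * n ^ d\<close> classes, and \<open>B * q ^ d < 2 ^ q\<close> excludes shattered sets of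
  \<open>q\<close> sample indices. A joint average gives size and purity for the same class.\<close>

lemma large_pure_class:
  fixes e :: "'x \<Rightarrow> 'y \<Rightarrow> bool"
  assumes fin: "finite X" "finite Y" and ne: "X \<noteq> {}" "Y \<noteq> {}"
    and pat: "\<And>(U :: nat set) ys. finite U \<Longrightarrow> U \<noteq> {} \<Longrightarrow>
      card ((\<lambda>x. {u\<in>U. e x (ys u)}) ` X) \<le> B * card U ^ d"
    and q: "B * q ^ d < 2 ^ q" "0 < q" and n: "0 < n"
  obtains P where "P \<subseteq> X" "P \<noteq> {}" "card X \<le> 2 * (B * n ^ d) * card P"
    "real (n + 1) * real (\<Sum>y\<in>Y. min (card {x\<in>P. \<not> e x y}) (card {x\<in>P. e x y})) \<le> 2 * real q * real (card P) * real (card Y)"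
proof -
  have nosh: "card ((\<lambda>x. {u\<in>T. e x (ys u)}) ` X) < 2 ^ q" if "T \<subseteq> {..n}" "card T = q" for T ys
  proof -
    have "finite T" "T \<noteq> {}" using that q finite_subset by auto
    then show ?thesis using pat[of T ys] q that by simp
  qed
  have fin_n: "finite {..n}" and ne_n: "{..n} \<noteq> {}" by auto
  obtain j ys where j: "j \<in> {..n}"
    "card {..n} * (\<Sum>y\<in>Y. \<Sum>A\<in>Pow ({..n} - {j}).
       min (card {x\<in>X. {u\<in>{..n} - {j}. e x (ys u)} = A \<and> \<not> e x y})
           (card {x\<in>X. {u\<in>{..n} - {j}. e x (ys u)} = A \<and> e x y})) \<le> q * card X * card Y"
    by (rule sampled_partition[OF fin(1,2) fin_n ne(2) ne_n nosh])
  define U where "U = {..n} - {j}"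
  have U: "finite U" "card U = n" "U \<noteq> {}"
  proof -
    show U: "finite U" "card U = n" using j(1) by (simp_all add: U_def)
    then show "U \<noteq> {}" using n by auto
  qed
  define code where "code x = {u\<in>U. e x (ys u)}" for x
  define cl where "cl A = {x\<in>X. code x = A}" for A
  define mino where "mino A = (\<Sum>y\<in>Y. min (card {x\<in>cl A. \<not> e x y}) (card {x\<in>cl A. e x y}))" for A
  define AA where "AA = code ` X"
  have AA: "finite AA" "AA \<noteq> {}" "AA \<subseteq> Pow U" using fin ne by (auto simp: AA_def code_def)
  have cardAA: "card AA \<le> B * n ^ d" using pat[OF U(1,3), of ys] by (simp add: AA_def code_def[abs_def] U)
  have clX: "cl A \<subseteq> X" "finite (cl A)" for A using fin by (auto simp: cl_def)
  have sumcl: "(\<Sum>A\<in>AA. card (cl A)) = card X"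
  proof -
    have "(\<Sum>A\<in>AA. card (cl A)) = (\<Sum>A\<in>AA. \<Sum>x\<in>{x\<in>X. code x = A}. 1)" by (simp add: cl_def)
    also have "\<dots> = (\<Sum>x\<in>X. 1)" using fin AA by (intro sum.group) (auto simp: AA_def)
    finally show ?thesis by simp
  qed
  have "(\<Sum>A\<in>AA. mino A) \<le> (\<Sum>A\<in>Pow U. mino A)" using AA U by (intro sum_mono2) auto
  also have "\<dots> = (\<Sum>y\<in>Y. \<Sum>A\<in>Pow U. min (card {x\<in>cl A. \<not> e x y}) (card {x\<in>cl A. e x y}))"
    unfolding mino_def by (rule sum.swap)
  also have "\<dots> = (\<Sum>y\<in>Y. \<Sum>A\<in>Pow U.
       min (card {x\<in>X. {u\<in>U. e x (ys u)} = A \<and> \<not> e x y}) (card {x\<in>X. {u\<in>U. e x (ys u)} = A \<and> e x y}))"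
    by (simp add: cl_def code_def conj_assoc)
  finally have "(n + 1) * (\<Sum>A\<in>AA. mino A) \<le> (n + 1) * (\<Sum>y\<in>Y. \<Sum>A\<in>Pow U.
       min (card {x\<in>X. {u\<in>U. e x (ys u)} = A \<and> \<not> e x y}) (card {x\<in>X. {u\<in>U. e x (ys u)} = A \<and> e x y}))"
    by (rule mult_left_mono) simp
  moreover have "n + 1 = card {..n}" by simp
  ultimately have summino: "(n + 1) * (\<Sum>A\<in>AA. mino A) \<le> q * card X * card Y"
    using order_trans[OF _ j(2)[folded U_def]] by (simp only:)
  have "\<exists>A\<in>AA. card X \<le> 2 * card AA * card (cl A) \<and> (n + 1) * mino A \<le> 2 * q * card (cl A) * card Y"
  proof (rule ccontr)
    assume H: "\<not> ?thesis"
    define N where "N = real (card AA)"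
    define c1 where "c1 = real (q * card Y)"
    have N: "N > 0" using AA by (simp add: N_def card_gt_0_iff)
    have c1: "c1 > 0" using q ne fin by (simp add: c1_def card_gt_0_iff)
    have X0: "real (card X) > 0" using fin ne by (simp add: card_gt_0_iff)
    \<comment> \<open>A class that is too small or too impure stays below one of the two terms.
      Summed over the classes, each term gives at most \<open>|X| / 2\<close>, so such classes
      cannot cover \<open>X\<close>.\<close>
    have lt: "real (card (cl A)) < real (card X) / (2 * N) + real (n + 1) * real (mino A) / (2 * c1)" if "A \<in> AA" for A
    proof -
      have "2 * card AA * card (cl A) < card X \<or> 2 * q * card (cl A) * card Y < (n + 1) * mino A"
        using H that by (meson not_le)
      then show ?thesis
      proof
        assume "2 * card AA * card (cl A) < card X"
        then have "real (2 * card AA * card (cl A)) < real (card X)" by (rule of_nat_less_iff[THEN iffD2])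
        then have "real (card (cl A)) < real (card X) / (2 * N)"
          using N by (simp add: less_divide_eq N_def mult_ac)
        moreover have "0 \<le> real (n + 1) * real (mino A) / (2 * c1)" using c1 by simp
        ultimately show ?thesis by linarith
      next
        assume "2 * q * card (cl A) * card Y < (n + 1) * mino A"
        then have "real (2 * q * card (cl A) * card Y) < real ((n + 1) * mino A)" by (rule of_nat_less_iff[THEN iffD2])
        then have "real (card (cl A)) < real (n + 1) * real (mino A) / (2 * c1)"
          using c1 by (simp add: less_divide_eq c1_def algebra_simps)
        moreover have "0 \<le> real (card X) / (2 * N)" using N by simp
        ultimately show ?thesis by linarith
      qed
    qed
    have "real (card X) = (\<Sum>A\<in>AA. real (card (cl A)))" using sumcl by (metis of_nat_sum)
    also have "\<dots> < (\<Sum>A\<in>AA. real (card X) / (2 * N) + real (n + 1) * real (mino A) / (2 * c1))"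
      using AA lt by (intro sum_strict_mono) auto
    also have "\<dots> = real (card X) / 2 + real (n + 1) * (\<Sum>A\<in>AA. real (mino A)) / (2 * c1)"
      using N by (simp add: sum.distrib N_def sum_divide_distrib sum_distrib_left del: of_nat_Suc)
    also have "real (n + 1) * (\<Sum>A\<in>AA. real (mino A)) = real ((n + 1) * (\<Sum>A\<in>AA. mino A))"
      by (simp add: algebra_simps)
    also have "\<dots> \<le> real (q * card X * card Y)" using summino by (rule of_nat_mono)
    also have "\<dots> = c1 * real (card X)" by (simp add: c1_def)
    finally show False using c1 by (simp add: divide_right_mono)
  qed
  then obtain A where A: "A \<in> AA" "card X \<le> 2 * card AA * card (cl A)"
    "(n + 1) * mino A \<le> 2 * q * card (cl A) * card Y" by blast
  show ?thesis
  proof (rule that[of "cl A"])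
    show "cl A \<subseteq> X" by (rule clX)
    show "cl A \<noteq> {}" using A(1) by (auto simp: AA_def cl_def)
    have "2 * card AA * card (cl A) \<le> 2 * (B * n ^ d) * card (cl A)"
      using cardAA by (intro mult_right_mono mult_left_mono) auto
    then show "card X \<le> 2 * (B * n ^ d) * card (cl A)" using A(2) by linarith
    have "real ((n + 1) * mino A) \<le> real (2 * q * card (cl A) * card Y)" using A(3) by (rule of_nat_mono)
    then show "real (n + 1) * real (\<Sum>y\<in>Y. min (card {x\<in>cl A. \<not> e x y}) (card {x\<in>cl A. e x y}))
       \<le> 2 * real q * real (card (cl A)) * real (card Y)" by (simp only: mino_def of_nat_mult of_nat_numeral)
  qed
qed

text \<open>The conclusion compares \<open>e\<close> at the representative \<open>x1\<close> with
  \<open>f\<close> at the points of \<open>P\<close>, since the link of \<open>x1\<close> is what is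
  passed on. One half of \<open>\<eta>\<close> pays for replacing the links of the class by that of
  \<open>x1\<close>, the other half for failures of \<open>f\<close> already present.\<close>

lemma heavy_link:
  fixes e f :: "'x \<Rightarrow> 'y \<Rightarrow> bool"
  assumes fin: "finite X" "finite Y" and ne: "X \<noteq> {}" "Y \<noteq> {}"
    and pat: "\<And>(U :: nat set) X' ys. finite U \<Longrightarrow> U \<noteq> {} \<Longrightarrow> finite X' \<Longrightarrow>
      card ((\<lambda>x. {u\<in>U. e x (ys u)}) ` X') \<le> B * card U ^ d"
    and q: "B * q ^ d < 2 ^ q" "0 < q" and B: "0 < B" and d: "0 < d"
    and \<epsilon>: "0 < \<epsilon>" "\<epsilon> * real (card X) * real (card Y) \<le> (\<Sum>x\<in>X. real (card {y\<in>Y. e x y}))"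
    and \<eta>: "0 < \<eta>" "\<eta> \<le> 1"
    and bad: "(\<Sum>x\<in>X. real (card {y\<in>Y. e x y \<and> \<not> f x y})) \<le> \<eta> / 8 * (\<Sum>x\<in>X. real (card {y\<in>Y. e x y}))"
  obtains j P x1 where "P \<subseteq> X" "x1 \<in> P" "2 ^ j * (\<epsilon> / 4) \<le> 1"
    "2 ^ j * (\<epsilon> / 4) * real (card Y) \<le> real (card {y\<in>Y. e x1 y})"
    "(\<Sum>x\<in>P. real (card {y\<in>Y. e x1 y \<and> \<not> f x y})) \<le> \<eta> * real (card P) * real (card {y\<in>Y. e x1 y})"
    "\<epsilon> * (2 ^ j * (\<epsilon> / 4)) ^ (d - 1) * level_weight j / (16 * real B * (8 * real q / \<eta>) ^ d) * real (card X) \<le> real (card P)"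
proof -
  define deg where "deg x = real (card {y\<in>Y. e x y})" for x
  define bd where "bd x = real (card {y\<in>Y. e x y \<and> \<not> f x y})" for x
  define \<gamma> where "\<gamma> = \<eta> / 8"
  have \<gamma>: "0 < \<gamma>" using \<eta> by (simp add: \<gamma>_def)
  \<comment> \<open>By Markov's inequality the points outside \<open>G1\<close> carry at most half
    of the edges, and those of degree below \<open>\<epsilon> / 4 * |Y|\<close> at most a further
    \<open>\<epsilon> / 4\<close> of all pairs. So \<open>G\<close> keeps edges amounting to
    \<open>\<epsilon> / 4\<close> of all pairs.\<close>
  define G1 where "G1 = {x\<in>X. bd x \<le> 2 * \<gamma> * deg x}"
  define G where "G = {x\<in>G1. \<epsilon> / 4 * real (card Y) \<le> deg x}"
  have deg0: "0 \<le> deg x" and bd0: "0 \<le> bd x" for x by (simp_all add: deg_def bd_def)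
  have Y0: "0 < real (card Y)" using fin ne by (simp add: card_gt_0_iff)
  have "(\<Sum>x\<in>X - G1. 2 * \<gamma> * deg x) \<le> (\<Sum>x\<in>X - G1. bd x)"
    by (rule sum_mono) (auto simp: G1_def)
  also have "\<dots> \<le> (\<Sum>x\<in>X. bd x)" using fin bd0 by (intro sum_mono2) auto
  also have "\<dots> \<le> \<gamma> * (\<Sum>x\<in>X. deg x)" using bad by (simp add: bd_def deg_def \<gamma>_def)
  finally have "\<gamma> * (2 * (\<Sum>x\<in>X - G1. deg x)) \<le> \<gamma> * (\<Sum>x\<in>X. deg x)"
    by (simp add: sum_distrib_left mult_ac)
  then have "2 * (\<Sum>x\<in>X - G1. deg x) \<le> (\<Sum>x\<in>X. deg x)" using \<gamma> by simp
  moreover have "(\<Sum>x\<in>X. deg x) = (\<Sum>x\<in>X - G1. deg x) + (\<Sum>x\<in>G1. deg x)"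
    using fin by (intro sum.subset_diff) (auto simp: G1_def)
  moreover have "(\<Sum>x\<in>G1. deg x) = (\<Sum>x\<in>G1 - G. deg x) + (\<Sum>x\<in>G. deg x)"
    using fin by (intro sum.subset_diff) (auto simp: G1_def G_def)
  moreover have "(\<Sum>x\<in>G1 - G. deg x) \<le> \<epsilon> / 4 * real (card X) * real (card Y)"
  proof -
    have "(\<Sum>x\<in>G1 - G. deg x) \<le> (\<Sum>x\<in>G1 - G. \<epsilon> / 4 * real (card Y))"
      by (rule sum_mono) (auto simp: G_def)
    also have "\<dots> \<le> (\<Sum>x\<in>X. \<epsilon> / 4 * real (card Y))"
      using fin \<epsilon> by (intro sum_mono2) (auto simp: G1_def)
    finally show ?thesis by (simp add: mult_ac)
  qed
  ultimately have mass: "\<epsilon> / 4 * real (card X) * real (card Y) \<le> (\<Sum>x\<in>G. deg x)"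
    using \<epsilon>(2) by (simp add: deg_def[symmetric])
  have GX: "G \<subseteq> X" by (auto simp: G_def G1_def)
  obtain j where j: "{x\<in>G. 2 ^ j * (\<epsilon> / 4) * real (card Y) \<le> deg x \<and> deg x < 2 ^ Suc j * (\<epsilon> / 4) * real (card Y)} \<noteq> {}"
    "level_weight j * real (card X) \<le> 2 ^ Suc j *
      real (card {x\<in>G. 2 ^ j * (\<epsilon> / 4) * real (card Y) \<le> deg x \<and> deg x < 2 ^ Suc j * (\<epsilon> / 4) * real (card Y)})"
    by (rule heavy_level[OF fin(1) ne(1) GX _ _ _ mass Y0]) (use \<epsilon> Y0 in \<open>auto simp: G_def\<close>)
  define a where "a = 2 ^ j * (\<epsilon> / 4)"
  define Xj where "Xj = {x\<in>G. 2 ^ j * (\<epsilon> / 4) * real (card Y) \<le> deg x \<and> deg x < 2 ^ Suc j * (\<epsilon> / 4) * real (card Y)}"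
  have a0: "0 < a" using \<epsilon> by (simp add: a_def)
  have Xj: "Xj \<noteq> {}" "Xj \<subseteq> X" using j(1) GX by (auto simp: Xj_def)
  have finXj: "finite Xj" using Xj(2) fin(1) finite_subset by blast
  have deg_Xj: "a * real (card Y) \<le> deg x" "deg x < 2 * a * real (card Y)" if "x \<in> Xj" for x
    using that by (auto simp: Xj_def a_def)
  have bd_Xj: "bd x \<le> 2 * \<gamma> * deg x" if "x \<in> Xj" for x using that by (auto simp: Xj_def G_def G1_def)
  have deg_le: "deg x \<le> real (card Y)" for x unfolding deg_def using fin by (intro of_nat_mono card_mono) auto
  have a1: "a \<le> 1"
  proof -
    obtain x where "x \<in> Xj" using Xj by blast
    then have "a * real (card Y) \<le> 1 * real (card Y)" using deg_Xj(1)[of x] deg_le[of x] by linarith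
    then show ?thesis using Y0 by (simp only: mult_le_cancel_right_pos)
  qed
  \<comment> \<open>Chosen so that a sample of about \<open>K / a\<close> elements leaves a minority
    total of at most \<open>2 * q * a / K = \<eta> * a / 4\<close> of the pairs in
    \<open>P \<times> Y\<close>; passing to the representative doubles it.\<close>
  define K where "K = 8 * real q / \<eta>"
  have "1 \<le> 8 * real q" "0 < 8 * real q" using q(2) by auto
  then have K1: "1 \<le> K" using \<eta> by (simp add: K_def le_divide_eq)
  have Ka1: "1 \<le> K / a" using K1 a0 a1 by (simp add: le_divide_eq)
  define n where "n = nat \<lfloor>K / a\<rfloor>"
  have n_le: "real n \<le> K / a" and n_gt: "K / a < real (n + 1)" and n0: "0 < n"
    using Ka1 unfolding n_def by (auto simp: le_nat_iff) linarith+
  have pat_Xj: "card ((\<lambda>x. {u\<in>U. e x (ys u)}) ` Xj) \<le> B * card U ^ d" if "finite U" "U \<noteq> {}"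
    for U :: "nat set" and ys using pat that finXj by blast
  obtain P where P: "P \<subseteq> Xj" "P \<noteq> {}" "card Xj \<le> 2 * (B * n ^ d) * card P"
    "real (n + 1) * real (\<Sum>y\<in>Y. min (card {x\<in>P. \<not> e x y}) (card {x\<in>P. e x y})) \<le> 2 * real q * real (card P) * real (card Y)"
    by (rule large_pure_class[OF finXj fin(2) Xj(1) ne(2) pat_Xj q n0])
  define mm where "mm = real (\<Sum>y\<in>Y. min (card {x\<in>P. \<not> e x y}) (card {x\<in>P. e x y}))"
  have mm0: "0 \<le> mm" unfolding mm_def by (rule of_nat_0_le_iff)
  have finP: "finite P" using P(1) finXj finite_subset by blast
  have mm: "4 * (2 * mm) \<le> 2 * \<eta> * a * real (card P) * real (card Y)"
  proof -
    have "K / a * mm \<le> real (n + 1) * mm" using n_gt mm0 by (intro mult_right_mono) auto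
    also have "\<dots> \<le> 2 * real q * real (card P) * real (card Y)" using P(4) by (simp only: mm_def)
    finally have "K * mm \<le> 2 * real q * real (card P) * real (card Y) * a"
      using a0 by (simp add: field_simps)
    then have "8 * real q * mm \<le> 2 * real q * real (card P) * real (card Y) * a * \<eta>"
      using \<eta> by (simp add: K_def field_simps)
    then have "real q * (8 * mm) \<le> real q * (2 * \<eta> * a * real (card P) * real (card Y))" by (simp add: mult_ac)
    then show ?thesis using q(2) by simp
  qed
  obtain x1 where x1: "x1 \<in> P" and x1_sum: "(\<Sum>x\<in>P. card {y\<in>Y. e x1 y \<noteq> e x y}) \<le>
      2 * (\<Sum>y\<in>Y. min (card {x\<in>P. \<not> e x y}) (card {x\<in>P. e x y}))"
    using representative_of_class[OF finP fin(2) P(2)] by blast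
  have "(\<Sum>x\<in>P. real (card {y\<in>Y. e x1 y \<noteq> e x y})) = real (\<Sum>x\<in>P. card {y\<in>Y. e x1 y \<noteq> e x y})" by simp
  also have "\<dots> \<le> real (2 * (\<Sum>y\<in>Y. min (card {x\<in>P. \<not> e x y}) (card {x\<in>P. e x y})))"
    using x1_sum by (rule of_nat_mono)
  also have "\<dots> = 2 * mm" by (simp add: mm_def)
  finally have diff: "(\<Sum>x\<in>P. real (card {y\<in>Y. e x1 y \<noteq> e x y})) \<le> 2 * mm" .
  have x1X: "x1 \<in> Xj" using x1 P(1) by blast
  show ?thesis
  proof (rule that[of P x1 j])
    show "P \<subseteq> X" using P(1) Xj(2) by blast
    show "x1 \<in> P" by (rule x1)
    show "2 ^ j * (\<epsilon> / 4) \<le> 1" using a1 by (simp add: a_def)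
    show "2 ^ j * (\<epsilon> / 4) * real (card Y) \<le> real (card {y\<in>Y. e x1 y})"
      using deg_Xj(1)[OF x1X] by (simp add: a_def deg_def)
    have "(\<Sum>x\<in>P. real (card {y\<in>Y. e x1 y \<and> \<not> f x y})) \<le> (\<Sum>x\<in>P. real (card {y\<in>Y. e x1 y \<noteq> e x y}) + bd x)"
    proof (rule sum_mono)
      fix x
      have "card {y\<in>Y. e x1 y \<and> \<not> f x y} \<le> card ({y\<in>Y. e x1 y \<noteq> e x y} \<union> {y\<in>Y. e x y \<and> \<not> f x y})"
        using fin by (intro card_mono) auto
      also have "\<dots> \<le> card {y\<in>Y. e x1 y \<noteq> e x y} + card {y\<in>Y. e x y \<and> \<not> f x y}" by (rule card_Un_le)
      finally show "real (card {y\<in>Y. e x1 y \<and> \<not> f x y}) \<le> real (card {y\<in>Y. e x1 y \<noteq> e x y}) + bd x"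
        by (simp add: bd_def)
    qed
    also have "\<dots> \<le> 2 * mm + (\<Sum>x\<in>P. 4 * \<gamma> * a * real (card Y))"
      unfolding sum.distrib
    proof (intro add_mono diff sum_mono)
      fix x assume "x \<in> P"
      then have x: "x \<in> Xj" using P(1) by blast
      have "bd x \<le> 2 * \<gamma> * deg x" by (rule bd_Xj[OF x])
      also have "\<dots> \<le> 2 * \<gamma> * (2 * a * real (card Y))"
        using deg_Xj(2)[OF x] \<gamma> by (intro mult_left_mono) auto
      finally show "bd x \<le> 4 * \<gamma> * a * real (card Y)" by simp
    qed
    also have "\<dots> \<le> \<eta> * real (card P) * (a * real (card Y))"
      using mm by (simp add: \<gamma>_def algebra_simps)
    also have "\<dots> \<le> \<eta> * real (card P) * real (card {y\<in>Y. e x1 y})"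
      using deg_Xj(1)[OF x1X] \<eta> by (intro mult_left_mono) (auto simp: deg_def)
    finally show "(\<Sum>x\<in>P. real (card {y\<in>Y. e x1 y \<and> \<not> f x y})) \<le> \<eta> * real (card P) * real (card {y\<in>Y. e x1 y})" .
    have "level_weight j * real (card X) \<le> 2 ^ Suc j * real (card Xj)" using j(2) by (simp add: Xj_def)
    also have "\<dots> \<le> 2 ^ Suc j * (2 * (real B * (K / a) ^ d) * real (card P))"
    proof (intro mult_left_mono)
      have "real (card Xj) \<le> real (2 * (B * n ^ d) * card P)" using P(3) by (rule of_nat_mono)
      also have "\<dots> = 2 * (real B * real n ^ d) * real (card P)" by simp
      also have "\<dots> \<le> 2 * (real B * (K / a) ^ d) * real (card P)"
        using n_le by (intro mult_right_mono mult_left_mono power_mono) auto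
      finally show "real (card Xj) \<le> 2 * (real B * (K / a) ^ d) * real (card P)" .
    qed simp
    \<comment> \<open>Returns from the level to its density \<open>a\<close>: the level holds at
      least the fraction \<open>level_weight j * \<epsilon> / (8 * a)\<close> of \<open>X\<close>,
      and \<open>P\<close> at least \<open>(a / K) ^ d / (2 * B)\<close> of that.\<close>
    also have "2 ^ Suc j = 8 * a / \<epsilon>" using \<epsilon> by (simp add: a_def)
    finally have "level_weight j * real (card X) \<le> 8 * a / \<epsilon> * (2 * (real B * (K / a) ^ d) * real (card P))" .
    moreover have "a ^ d = a * a ^ (d - 1)" using d by (simp add: power_eq_if)
    ultimately have "\<epsilon> * a ^ (d - 1) * level_weight j * real (card X) \<le> 16 * real B * K ^ d * real (card P)"
      using a0 \<epsilon>(1) by (simp add: power_divide field_simps)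
    then show "\<epsilon> * (2 ^ j * (\<epsilon> / 4)) ^ (d - 1) * level_weight j / (16 * real B * (8 * real q / \<eta>) ^ d) * real (card X) \<le> real (card P)"
      using B K1 unfolding a_def[symmetric] K_def[symmetric] by (simp add: divide_le_eq mult_ac)
  qed
qed

section \<open>Comparing densities across levels\<close>

lemma part_density_bounds:
  assumes "0 < \<epsilon>" "\<epsilon> \<le> 1"
  shows "0 \<le> part_density d \<epsilon>" "part_density d \<epsilon> \<le> 1"
proof -
  have "\<epsilon> / (max 1 (ln (1 / \<epsilon>)))\<^sup>2 \<le> \<epsilon> / 1"
    using assms by (intro divide_left_mono) auto
  then have "\<epsilon> / (max 1 (ln (1 / \<epsilon>)))\<^sup>2 \<le> 1" using assms by linarith
  then show "0 \<le> part_density d \<epsilon>" "part_density d \<epsilon> \<le> 1"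
    using assms unfolding part_density_def by (auto intro: power_le_one)
qed

lemma ln_4_le: "ln (4::real) \<le> 2"
  using ln_add_one_self_le_self[of "3::real"] ln_realpow[of "2::real" 2] ln_2_less_1 by simp

text \<open>A single factor \<open>2 ^ j\<close> already outgrows the quadratic denominator of the
  weight.\<close>

lemma level_weight_growth:
  assumes "0 < m"
  shows "1 / 4 \<le> (2 ^ j) ^ m * level_weight j"
proof -
  have poly: "(real j + 1) * (real j + 2) \<le> 4 * 2 ^ j"
  proof (induction j)
    case (Suc j)
    show ?case
    proof (cases "j \<le> 1")
      case True
      then have "j = 0 \<or> j = 1" by auto
      then show ?thesis by auto
    next
      case False
      then have "2 \<le> real j" by simp
      then have "(real (Suc j) + 1) * (real (Suc j) + 2) \<le> 2 * ((real j + 1) * (real j + 2))"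
        by (simp add: algebra_simps) (use mult_right_mono[of 2 "real j" "real j"] in linarith)
      then show ?thesis using Suc by simp
    qed
  qed simp
  have "1 / 4 * ((real j + 1) * (real j + 2)) \<le> 2 ^ j" using poly by linarith
  then have "1 / 4 \<le> 2 ^ j * level_weight j"
    by (simp add: level_weight_def le_divide_eq)
  also have "\<dots> \<le> (2 ^ j) ^ m * level_weight j"
    using assms level_weight_pos[of j] by (intro mult_right_mono self_le_power) auto
  finally show ?thesis .
qed

text \<open>The right-hand side is the class size on level \<open>j\<close>, here freed of
  \<open>j\<close>. For \<open>d = 1\<close> no power of \<open>2 ^ j\<close> helps, but
  \<open>2 ^ j \<le> 4 / \<epsilon>\<close> bounds \<open>j\<close> by a multiple of the truncated
  logarithm. In the constant, \<open>4 ^ d\<close> comes from \<open>\<epsilon> / 4\<close>; the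
  number 36 is shared with \<open>part_density_quarter\<close>, where it is
  \<open>4 * 9\<close>.\<close>

lemma part_density_level:
  assumes \<epsilon>: "0 < \<epsilon>" "\<epsilon> \<le> 1" and a: "2 ^ j * (\<epsilon> / 4) \<le> 1" and d: "0 < d"
  shows "part_density d \<epsilon> / (36 * 4 ^ d) \<le> \<epsilon> * (2 ^ j * (\<epsilon> / 4)) ^ (d - 1) * level_weight j"
proof (cases "d \<ge> 2")
  case True
  obtain m where m: "d = Suc (Suc m)" using True by (metis add_2_eq_Suc le_Suc_ex)
  have w: "1 / 4 \<le> (2 ^ j) ^ Suc m * level_weight j" by (rule level_weight_growth) simp
  have "part_density d \<epsilon> / (36 * 4 ^ d) = \<epsilon> ^ d / 4 ^ d * (1 / 36)"
    using True by (simp add: part_density_def)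
  also have "\<dots> \<le> \<epsilon> ^ d / 4 ^ d * 1" using \<epsilon> by (intro mult_left_mono) auto
  also have "\<dots> = \<epsilon> * (\<epsilon> / 4) ^ Suc m * (1 / 4)"
    by (simp add: m power_divide)
  also have "\<dots> \<le> \<epsilon> * (\<epsilon> / 4) ^ Suc m * ((2 ^ j) ^ Suc m * level_weight j)"
    using \<epsilon> w by (intro mult_left_mono) auto
  also have "\<dots> = \<epsilon> * (2 ^ j * (\<epsilon> / 4)) ^ (d - 1) * level_weight j"
    unfolding power_mult_distrib m by simp
  finally show ?thesis .
next
  case False
  then have d1: "d = 1" using d by simp
  define L where "L = max 1 (ln (1 / \<epsilon>))"
  have L: "1 \<le> L" "ln (1 / \<epsilon>) \<le> L" by (auto simp: L_def)
  have "2 ^ j \<le> 4 * (1 / \<epsilon>)" using a \<epsilon> by (simp add: field_simps)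
  then have "ln (2 ^ j) \<le> ln (4 * (1 / \<epsilon>))" using \<epsilon> by (subst ln_le_cancel_iff) auto
  also have "\<dots> = ln 4 + ln (1 / \<epsilon>)" using \<epsilon> by (subst ln_mult) auto
  also have "\<dots> \<le> 2 + L" using L ln_4_le by linarith
  finally have "real j * ln 2 \<le> 2 + L" by (simp add: ln_realpow)
  moreover have "real j * (1 / 2) \<le> real j * ln 2" using ln2_ge_two_thirds by (intro mult_left_mono) auto
  ultimately have "real j \<le> 4 + 2 * L" by linarith
  then have "(real j + 1) * (real j + 2) \<le> (8 * L) * (8 * L)"
    using L by (intro mult_mono) auto
  then have "1 / (64 * L\<^sup>2) \<le> level_weight j"
    unfolding level_weight_def using L by (intro divide_left_mono mult_pos_pos) (auto simp: power2_eq_square)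
  then have "\<epsilon> * (1 / (64 * L\<^sup>2)) \<le> \<epsilon> * level_weight j" using \<epsilon> by (intro mult_left_mono) auto
  moreover have "part_density d \<epsilon> / (36 * 4 ^ d) \<le> \<epsilon> * (1 / (64 * L\<^sup>2))"
    using \<epsilon> L by (simp add: part_density_def d1 L_def[symmetric] divide_simps)
  ultimately show ?thesis by (simp add: d1)
qed

text \<open>The recursion bounds the later parts through the link density \<open>a\<close>; this
  translates the bound back to \<open>\<epsilon>\<close>. In dimension 1 the truncated logarithm
  grows at most threefold, because \<open>ln 4 \<le> 2\<close>.\<close>

lemma part_density_quarter:
  assumes \<epsilon>: "0 < \<epsilon>" "\<epsilon> \<le> 1" and a: "\<epsilon> / 4 \<le> a" "a \<le> 1"
  shows "part_density d \<epsilon> / (36 * 4 ^ d) \<le> part_density d a"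
proof (cases "d \<ge> 2")
  case True
  have "\<epsilon> ^ d / (36 * 4 ^ d) = (\<epsilon> / 4) ^ d * (1 / 36)" by (simp add: power_divide)
  also have "\<dots> \<le> (\<epsilon> / 4) ^ d * 1" using \<epsilon> by (intro mult_left_mono) auto
  also have "\<dots> \<le> a ^ d" using \<epsilon> a by (auto intro: power_mono)
  finally show ?thesis using True by (simp add: part_density_def)
next
  case False
  define L where "L = max 1 (ln (1 / \<epsilon>))"
  define L' where "L' = max 1 (ln (1 / a))"
  have L: "1 \<le> L" "ln (1 / \<epsilon>) \<le> L" by (auto simp: L_def)
  have a0: "0 < a" using \<epsilon> a by linarith
  have "ln (1 / a) \<le> ln (4 * (1 / \<epsilon>))"
    using \<epsilon> a a0 by (subst ln_le_cancel_iff) (auto simp: field_simps)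
  also have "\<dots> = ln 4 + ln (1 / \<epsilon>)" using \<epsilon> by (subst ln_mult) auto
  also have "\<dots> \<le> 3 * L" using L ln_4_le by linarith
  finally have L': "1 \<le> L'" "L' \<le> 3 * L" using L by (auto simp: L'_def)
  then have "L'\<^sup>2 \<le> (3 * L)\<^sup>2" by (intro power_mono) auto
  then have "(\<epsilon> / 4) / (9 * L\<^sup>2) \<le> a / L'\<^sup>2"
    using a \<epsilon> a0 L L' by (intro frac_le) (auto simp: power_mult_distrib)
  moreover have "\<epsilon> / L\<^sup>2 / (36 * 4 ^ d) \<le> (\<epsilon> / 4) / (9 * L\<^sup>2)"
    using \<epsilon> L by (simp add: field_simps)
  ultimately show ?thesis using False by (simp add: part_density_def L_def L'_def)
qed

section \<open>Recursion over the parts\<close>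

lemma sum_card_PiE_insert:
  assumes "finite I" "i \<notin> I" "finite (V i)" "\<And>j. j \<in> I \<Longrightarrow> finite (V j)"
  shows "card {x\<in>PiE (insert i I) V. P x} = (\<Sum>p\<in>V i. card {y\<in>PiE I V. P (y(i := p))})"
proof -
  have fin: "finite (PiE I V)" using assms by (intro finite_PiE) auto
  have "{x\<in>PiE (insert i I) V. P x} = (\<lambda>(p, y). y(i := p)) ` (SIGMA p:V i. {y\<in>PiE I V. P (y(i := p))})"
    unfolding PiE_insert_eq by auto
  moreover have "inj_on (\<lambda>(p, y). y(i := p)) (SIGMA p:V i. {y\<in>PiE I V. P (y(i := p))})"
    by (rule inj_on_subset[OF inj_combinator[OF assms(2), of V]]) auto
  ultimately have "card {x\<in>PiE (insert i I) V. P x} = card (SIGMA p:V i. {y\<in>PiE I V. P (y(i := p))})"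
    by (simp add: card_image)
  also have "\<dots> = (\<Sum>p\<in>V i. card {y\<in>PiE I V. P (y(i := p))})"
    using fin assms by (intro card_SigmaI) auto
  finally show ?thesis .
qed

text \<open>A dual shatter function bound \<open>B m\<^sup>d\<close> for the \<open>i\<close>-th part against the product of all others.\<close>

definition pattern_bound :: "nat \<Rightarrow> nat \<Rightarrow> ((nat \<Rightarrow> 'a) \<Rightarrow> bool) \<Rightarrow> nat \<Rightarrow> bool" where
  "pattern_bound B d e i \<longleftrightarrow> (\<forall>(U :: nat set) X ys. finite U \<longrightarrow> U \<noteq> {} \<longrightarrow> finite X \<longrightarrow>
     card ((\<lambda>p. {u\<in>U. e ((ys u)(i := p))}) ` X) \<le> B * card U ^ d)"

text \<open>Fixing the point of another part only restricts the sample to tuples with that entry, so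
  \<open>B\<close> is the same throughout the recursion.\<close>

lemma pattern_bound_link:
  fixes e :: "(nat \<Rightarrow> 'a) \<Rightarrow> bool"
  assumes "pattern_bound B d e i" "i \<noteq> j"
  shows "pattern_bound B d (\<lambda>y. e (y(j := p))) i"
  unfolding pattern_bound_def
proof (intro allI impI)
  fix U :: "nat set" and X :: "'a set" and ys :: "nat \<Rightarrow> nat \<Rightarrow> 'a"
  assume "finite U" "U \<noteq> {}" "finite X"
  then have "card ((\<lambda>q. {u\<in>U. e ((ys u)(j := p, i := q))}) ` X) \<le> B * card U ^ d"
    using assms(1)[unfolded pattern_bound_def] by simp
  then show "card ((\<lambda>q. {u\<in>U. e ((ys u)(i := q, j := p))}) ` X) \<le> B * card U ^ d"
    using assms(2) by (simp add: fun_upd_twist[of i j])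
qed

text \<open>Taking \<open>q = 2 ^ t\<close> reduces the claim to \<open>t * d + B < 2 ^ t\<close>, a
  linear function against an exponential one.\<close>

lemma dominated_power: "\<exists>q>0. B * q ^ d < (2::nat) ^ q"
proof -
  define c where "c = d + B + 1"
  define t where "t = 4 * c"
  have "t * d + B < t * c" by (simp add: t_def c_def algebra_simps)
  also have "\<dots> = (2 * c) * (2 * c)" by (simp add: t_def)
  also have "\<dots> \<le> 2 ^ (2 * c) * 2 ^ (2 * c)"
    using less_exp[of "2 * c"] by (intro mult_mono) auto
  also have "\<dots> = 2 ^ t" by (simp add: t_def flip: power_add)
  finally have t: "t * d + B < 2 ^ t" .
  have "B * (2 ^ t) ^ d \<le> 2 ^ B * 2 ^ (t * d)"
    using less_exp[of B] by (intro mult_mono) (auto simp: power_mult)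
  also have "\<dots> = 2 ^ (t * d + B)" by (simp add: power_add)
  also have "\<dots> < 2 ^ (2 ^ t)" using t by simp
  finally show ?thesis by (intro exI[of _ "2 ^ t"]) simp
qed

text \<open>In the induction step \<open>e\<close> becomes the link of a representative
  \<open>x1\<close>, and \<open>f\<close> becomes the statement that \<open>f\<close> holds for most
  points \<open>p\<close> of the class. Part \<open>k\<close> is what remains at the end: there the
  box consists of all points satisfying \<open>e\<close>, and the failure hypothesis is the
  claim.\<close>

lemma dense_box:
  fixes k :: nat and J :: "nat set"
  assumes d: "0 < d" and B: "0 < B" and "finite J" "k \<notin> J" "0 < \<eta>" "\<eta> \<le> 1"
  shows "\<exists>\<gamma> c. 0 < \<gamma> \<and> \<gamma> \<le> 1 \<and> 0 < c \<and> c \<le> 1 \<and>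
    (\<forall>V (e :: (nat \<Rightarrow> 'a) \<Rightarrow> bool) f \<epsilon>.
      (\<forall>i\<in>insert k J. finite (V i) \<and> V i \<noteq> {}) \<longrightarrow> (\<forall>i\<in>J. pattern_bound B d e i) \<longrightarrow> 0 < \<epsilon> \<longrightarrow> \<epsilon> \<le> 1 \<longrightarrow>
      \<epsilon> * (\<Prod>i\<in>insert k J. real (card (V i))) \<le> real (card {x\<in>PiE (insert k J) V. e x}) \<longrightarrow>
      real (card {x\<in>PiE (insert k J) V. e x \<and> \<not> f x}) \<le> \<gamma> * real (card {x\<in>PiE (insert k J) V. e x}) \<longrightarrow>
      (\<exists>W. (\<forall>i\<in>insert k J. W i \<subseteq> V i) \<and>
        real (card {x\<in>PiE (insert k J) W. \<not> f x}) \<le> \<eta> * (\<Prod>i\<in>insert k J. real (card (W i))) \<and>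
        c * (\<epsilon> ^ (d * card J + 1) * (\<Prod>i\<in>insert k J. real (card (V i)))) \<le> (\<Prod>i\<in>insert k J. real (card (W i))) \<and>
        (\<forall>i\<in>J. c * (part_density d \<epsilon> * real (card (V i))) \<le> real (card (W i))) \<and>
        c * (\<epsilon> * real (card (V k))) \<le> real (card (W k))))"
  using assms(3-)
proof (induction J arbitrary: \<eta> rule: finite_induct)
  case empty
  show ?case
  proof (rule exI[of _ \<eta>], rule exI[of _ 1], intro conjI allI impI)
    fix V :: "nat \<Rightarrow> 'a set" and e f :: "(nat \<Rightarrow> 'a) \<Rightarrow> bool" and \<epsilon> :: real
    assume V: "\<forall>i\<in>{k}. finite (V i) \<and> V i \<noteq> {}"
      and E: "\<epsilon> * (\<Prod>i\<in>{k}. real (card (V i))) \<le> real (card {x\<in>PiE {k} V. e x})"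
      and bad: "real (card {x\<in>PiE {k} V. e x \<and> \<not> f x}) \<le> \<eta> * real (card {x\<in>PiE {k} V. e x})"
    define pt where "pt p = (\<lambda>_. undefined)(k := p)" for p :: 'a
    define W where "W = (\<lambda>_ :: nat. {p\<in>V k. e (pt p)})"
    have card1: "card {x\<in>PiE {k} U. P x} = card {p\<in>U k. P (pt p)}" if "finite (U k)" for U :: "nat \<Rightarrow> 'a set" and P
    proof -
      have "card {x\<in>PiE {k} U. P x} = (\<Sum>p\<in>U k. card {y\<in>PiE {} U. P (y(k := p))})"
        using sum_card_PiE_insert[of "{}" k U P] that by simp
      also have "\<dots> = (\<Sum>p\<in>U k. if P (pt p) then 1 else 0)"
      proof (intro sum.cong refl)
        fix p
        have "{y\<in>PiE {} U. P (y(k := p))} = (if P (pt p) then {\<lambda>_. undefined} else {})" by (auto simp: pt_def)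
        then show "card {y\<in>PiE {} U. P (y(k := p))} = (if P (pt p) then 1 else 0)" by simp
      qed
      also have "\<dots> = card {p\<in>U k. P (pt p)}" using that by (simp add: sum.If_cases Int_def)
      finally show ?thesis .
    qed
    have "card {x\<in>PiE {k} V. e x} = card (W k)" using V by (simp add: card1 W_def)
    moreover have "card {x\<in>PiE {k} V. e x \<and> \<not> f x} = card {x\<in>PiE {k} W. \<not> f x}"
      using V card1[of V "\<lambda>x. e x \<and> \<not> f x"] card1[of W "\<lambda>x. \<not> f x"] by (simp add: W_def conj_assoc)
    ultimately show "\<exists>W. (\<forall>i\<in>{k}. W i \<subseteq> V i) \<and>
        real (card {x\<in>PiE {k} W. \<not> f x}) \<le> \<eta> * (\<Prod>i\<in>{k}. real (card (W i))) \<and>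
        1 * (\<epsilon> ^ (d * card {} + 1) * (\<Prod>i\<in>{k}. real (card (V i)))) \<le> (\<Prod>i\<in>{k}. real (card (W i))) \<and>
        (\<forall>i\<in>{}. 1 * (part_density d \<epsilon> * real (card (V i))) \<le> real (card (W i))) \<and>
        1 * (\<epsilon> * real (card (V k))) \<le> real (card (W k))"
      using E bad by (intro exI[of _ W]) (auto simp: W_def)
  qed (use empty in auto)
next
  case (insert i J)
  have ki: "k \<noteq> i" "k \<notin> J" using insert.prems by auto
  define I where "I = insert k J"
  have I: "finite I" "i \<notin> I" "insert k (insert i J) = insert i I" using insert.hyps ki by (auto simp: I_def)
  obtain \<gamma>1 c1 where IH0: "0 < \<gamma>1" "\<gamma>1 \<le> 1" "0 < c1" "c1 \<le> 1" and
    IH: "\<And>V (e :: (nat \<Rightarrow> 'a) \<Rightarrow> bool) f \<epsilon>.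
      (\<forall>i\<in>I. finite (V i) \<and> V i \<noteq> {}) \<Longrightarrow> (\<forall>i\<in>J. pattern_bound B d e i) \<Longrightarrow> 0 < \<epsilon> \<Longrightarrow> \<epsilon> \<le> 1 \<Longrightarrow>
      \<epsilon> * (\<Prod>i\<in>I. real (card (V i))) \<le> real (card {x\<in>PiE I V. e x}) \<Longrightarrow>
      real (card {x\<in>PiE I V. e x \<and> \<not> f x}) \<le> \<gamma>1 * real (card {x\<in>PiE I V. e x}) \<Longrightarrow>
      (\<exists>W. (\<forall>i\<in>I. W i \<subseteq> V i) \<and>
        real (card {x\<in>PiE I W. \<not> f x}) \<le> \<eta> / 2 * (\<Prod>i\<in>I. real (card (W i))) \<and>
        c1 * (\<epsilon> ^ (d * card J + 1) * (\<Prod>i\<in>I. real (card (V i)))) \<le> (\<Prod>i\<in>I. real (card (W i))) \<and>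
        (\<forall>i\<in>J. c1 * (part_density d \<epsilon> * real (card (V i))) \<le> real (card (W i))) \<and>
        c1 * (\<epsilon> * real (card (V k))) \<le> real (card (W k)))"
    using insert.IH[of "\<eta> / 2"] ki(2) insert.prems(2,3) unfolding I_def[symmetric] by auto
  \<comment> \<open>Markov's inequality on the link of \<open>x1\<close>: a tuple violating
    \<open>f'\<close> fails with more than \<open>\<eta> / 2\<close> of \<open>P\<close>, so a
    failure rate of \<open>\<eta> / 2 * \<gamma>1\<close> leaves at most the fraction
    \<open>\<gamma>1\<close> of such tuples, which the recursive call tolerates.\<close>
  define \<eta>2 where "\<eta>2 = \<eta> / 2 * \<gamma>1"
  have \<eta>2: "0 < \<eta>2" "\<eta>2 \<le> 1"
    using insert.prems IH0 mult_mono[of "\<eta> / 2" 1 \<gamma>1 1] by (auto simp: \<eta>2_def)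
  obtain q where q: "0 < q" "B * q ^ d < 2 ^ q" using dominated_power by blast
  define K where "K = 16 * real B * (8 * real q / \<eta>2) ^ d"
  have K: "1 \<le> K"
  proof -
    have "\<eta>2 \<le> 8 * real q" using \<eta>2 q(1) by linarith
    then have "1 \<le> 8 * real q / \<eta>2" using \<eta>2 by (simp add: le_divide_eq)
    then have "1 \<le> (8 * real q / \<eta>2) ^ d" by (rule one_le_power)
    moreover have "1 \<le> 16 * real B" using B by linarith
    ultimately show ?thesis unfolding K_def using mult_mono[of 1 "16 * real B" 1] by fastforce
  qed
  define m where "m = d * Suc (card J)"
  \<comment> \<open>Small enough for all bounds at once: \<open>K\<close> is lost in the class,
    \<open>4 * 4 ^ m\<close> in the product through \<open>\<epsilon> / 4\<close> and the level
    weight, and \<open>36 * 4 ^ d\<close> in the bounds for single parts.\<close>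
  define c where "c = c1 / (K * (36 * 4 ^ m * 4))"
  have m: "0 < m" "d \<le> m" using d by (simp_all add: m_def)
  have pow4: "(4::real) ^ d \<le> 4 ^ m" "1 \<le> (4::real) ^ d" "1 \<le> (4::real) ^ m" using m by (simp_all add: power_increasing)
  have c0: "0 < c" using IH0 K by (simp add: c_def)
  have c_le: "c \<le> 1 / (K * (36 * 4 ^ d))" "c \<le> c1 / (36 * 4 ^ d)" "c \<le> c1 / 4" "c \<le> 1"
    "c \<le> c1 / (K * (4 * 4 ^ m))"
  proof -
    have D0: "(36::real) * 4 ^ d \<le> 36 * 4 ^ m * 4" using pow4 by linarith
    have D: "K * (36 * 4 ^ d) \<le> K * (36 * 4 ^ m * 4)" using D0 K by (intro mult_left_mono) auto
    have "1 * (36 * 4 ^ d) \<le> K * (36 * 4 ^ m * 4)" using K by (intro mult_mono[OF K D0]) auto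
    then have D2: "36 * 4 ^ d \<le> K * (36 * 4 ^ m * 4)" by simp
    have D3: "4 \<le> K * (36 * 4 ^ m * 4)" using D2 pow4 by linarith
    have D4: "K * (4 * 4 ^ m) \<le> K * (36 * 4 ^ m * 4)" using K pow4 by (intro mult_left_mono) auto
    show "c \<le> 1 / (K * (36 * 4 ^ d))" unfolding c_def using IH0 K pow4 D by (intro frac_le) auto
    show "c \<le> c1 / (36 * 4 ^ d)" unfolding c_def using IH0 K pow4 D2 by (intro frac_le) auto
    show "c \<le> c1 / 4" unfolding c_def using IH0 K D3 by (intro frac_le) auto
    then show "c \<le> 1" using IH0 by linarith
    show "c \<le> c1 / (K * (4 * 4 ^ m))" unfolding c_def using IH0 K pow4 D4 by (intro frac_le) auto
  qed
  show ?case unfolding I(3)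
  proof (rule exI[of _ "\<eta>2 / 8"], rule exI[of _ c], intro conjI allI impI)
    fix V :: "nat \<Rightarrow> 'a set" and e f :: "(nat \<Rightarrow> 'a) \<Rightarrow> bool" and \<epsilon> :: real
    assume V: "\<forall>i\<in>insert i I. finite (V i) \<and> V i \<noteq> {}" and pat: "\<forall>i\<in>insert i J. pattern_bound B d e i"
      and \<epsilon>: "0 < \<epsilon>" "\<epsilon> \<le> 1"
      and E: "\<epsilon> * (\<Prod>i\<in>insert i I. real (card (V i))) \<le> real (card {x\<in>PiE (insert i I) V. e x})"
      and bad: "real (card {x\<in>PiE (insert i I) V. e x \<and> \<not> f x}) \<le> \<eta>2 / 8 * real (card {x\<in>PiE (insert i I) V. e x})"
    define Y where "Y = PiE I V"
    have Y: "finite Y" "Y \<noteq> {}" "real (card Y) = (\<Prod>i\<in>I. real (card (V i)))"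
      using V I(1) by (auto simp: Y_def finite_PiE PiE_eq_empty_iff card_PiE)
    have count: "real (card {x\<in>PiE (insert i I) V. P x}) = (\<Sum>p\<in>V i. real (card {y\<in>Y. P (y(i := p))}))" for P
      using sum_card_PiE_insert[OF I(1,2), of V P] V by (simp add: Y_def)
    have Vi: "finite (V i)" "V i \<noteq> {}" using V by auto
    have pat_i: "card ((\<lambda>p. {u\<in>U. e ((ys u)(i := p))}) ` X') \<le> B * card U ^ d"
      if "finite U" "U \<noteq> {}" "finite X'" for U :: "nat set" and X' ys
      using pat that unfolding pattern_bound_def by blast
    have mass: "\<epsilon> * real (card (V i)) * real (card Y) \<le> (\<Sum>p\<in>V i. real (card {y\<in>Y. e (y(i := p))}))"
      using E I(1,2) unfolding count Y(3) by (simp add: mult.assoc)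
    have bad': "(\<Sum>p\<in>V i. real (card {y\<in>Y. e (y(i := p)) \<and> \<not> f (y(i := p))})) \<le>
        \<eta>2 / 8 * (\<Sum>p\<in>V i. real (card {y\<in>Y. e (y(i := p))}))"
      using bad unfolding count .
    obtain j P x1 where P: "P \<subseteq> V i" "x1 \<in> P" "2 ^ j * (\<epsilon> / 4) \<le> 1"
      "2 ^ j * (\<epsilon> / 4) * real (card Y) \<le> real (card {y\<in>Y. e (y(i := x1))})"
      "(\<Sum>p\<in>P. real (card {y\<in>Y. e (y(i := x1)) \<and> \<not> f (y(i := p))})) \<le> \<eta>2 * real (card P) * real (card {y\<in>Y. e (y(i := x1))})"
      "\<epsilon> * (2 ^ j * (\<epsilon> / 4)) ^ (d - 1) * level_weight j / K * real (card (V i)) \<le> real (card P)"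
      unfolding K_def
      by (rule heavy_link[where e = "\<lambda>p y. e (y(i := p))" and f = "\<lambda>p y. f (y(i := p))",
            OF Vi(1) Y(1) Vi(2) Y(2) pat_i q(2,1) B d \<epsilon>(1) mass \<eta>2 bad'])
    define a where "a = 2 ^ j * (\<epsilon> / 4)"
    have a: "0 < a" "a \<le> 1" "\<epsilon> / 4 \<le> a"
      using \<epsilon> P(3) mult_right_mono[of 1 "2 ^ j" "\<epsilon> / 4"] by (auto simp: a_def)
    have finP: "finite P" using P(1) Vi(1) finite_subset by blast
    have P0: "0 < real (card P)" using P(2) finP by (auto simp: card_gt_0_iff)
    define e' where "e' y = e (y(i := x1))" for y
    define f' where "f' y \<longleftrightarrow> real (card {p\<in>P. \<not> f (y(i := p))}) \<le> \<eta> / 2 * real (card P)" for y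
    have swap: "(\<Sum>p\<in>P. real (card {y\<in>Z. R p y})) = (\<Sum>y\<in>Z. real (card {p\<in>P. R p y}))"
      if "finite Z" for Z :: "(nat \<Rightarrow> 'a) set" and R
      using finP that sum.swap_restrict[of P Z "\<lambda>_ _. 1::real" R] by simp
    have "\<eta> / 2 * real (card P) * real (card {y\<in>Y. e' y \<and> \<not> f' y})
        = (\<Sum>y\<in>{y\<in>Y. e' y \<and> \<not> f' y}. \<eta> / 2 * real (card P))" by simp
    also have "\<dots> \<le> (\<Sum>y\<in>{y\<in>Y. e' y \<and> \<not> f' y}. real (card {p\<in>P. e' y \<and> \<not> f (y(i := p))}))"
      by (rule sum_mono) (auto simp: f'_def)
    also have "\<dots> \<le> (\<Sum>y\<in>Y. real (card {p\<in>P. e' y \<and> \<not> f (y(i := p))}))"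
      using Y(1) by (intro sum_mono2) auto
    also have "\<dots> = (\<Sum>p\<in>P. real (card {y\<in>Y. e' y \<and> \<not> f (y(i := p))}))" by (rule swap[OF Y(1), symmetric])
    also have "\<dots> \<le> \<eta>2 * real (card P) * real (card {y\<in>Y. e' y})" using P(5) by (simp add: e'_def)
    also have "\<dots> = \<eta> / 2 * real (card P) * (\<gamma>1 * real (card {y\<in>Y. e' y}))" by (simp add: \<eta>2_def)
    finally have bad2: "real (card {y\<in>Y. e' y \<and> \<not> f' y}) \<le> \<gamma>1 * real (card {y\<in>Y. e' y})"
      by (rule mult_left_le_imp_le) (use insert.prems P0 in simp)
    have VI: "\<forall>i\<in>I. finite (V i) \<and> V i \<noteq> {}" using V by auto
    have pat': "\<forall>l\<in>J. pattern_bound B d e' l"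
      unfolding e'_def using pat insert.hyps by (intro ballI pattern_bound_link) auto
    have E': "a * (\<Prod>i\<in>I. real (card (V i))) \<le> real (card {x\<in>PiE I V. e' x})"
      using P(4) unfolding Y(3) a_def[symmetric] e'_def by (simp add: Y_def)
    obtain W0 where W0: "\<forall>i\<in>I. W0 i \<subseteq> V i"
      "real (card {x\<in>PiE I W0. \<not> f' x}) \<le> \<eta> / 2 * (\<Prod>i\<in>I. real (card (W0 i)))"
      "c1 * (a ^ (d * card J + 1) * (\<Prod>i\<in>I. real (card (V i)))) \<le> (\<Prod>i\<in>I. real (card (W0 i)))"
      "\<forall>i\<in>J. c1 * (part_density d a * real (card (V i))) \<le> real (card (W0 i))"
      "c1 * (a * real (card (V k))) \<le> real (card (W0 k))"
      using IH[OF VI pat' a(1,2) E' bad2[unfolded Y_def]] by blast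
    define W where "W = W0(i := P)"
    have W: "W i = P" "\<And>l. l \<in> I \<Longrightarrow> W l = W0 l" using I(2) by (auto simp: W_def)
    have prodW: "(\<Prod>l\<in>insert i I. real (card (W l))) = real (card P) * (\<Prod>l\<in>I. real (card (W0 l)))"
      using I(1,2) W by simp
    have prodV: "(\<Prod>l\<in>insert i I. real (card (V l))) = real (card (V i)) * (\<Prod>l\<in>I. real (card (V l)))"
      using I(1,2) by simp
    have finW0: "\<And>l. l \<in> I \<Longrightarrow> finite (W0 l)" using W0(1) VI finite_subset by blast
    define Z where "Z = PiE I W0"
    have Z: "finite Z" "real (card Z) = (\<Prod>l\<in>I. real (card (W0 l)))"
      using finW0 I(1) by (auto simp: Z_def finite_PiE card_PiE)
    have PiEW: "PiE I W = Z" unfolding Z_def using W(2) by (intro PiE_cong) auto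
    have "real (card {x\<in>PiE (insert i I) W. \<not> f x}) = (\<Sum>p\<in>P. real (card {y\<in>Z. \<not> f (y(i := p))}))"
      using sum_card_PiE_insert[OF I(1,2), of W "\<lambda>x. \<not> f x"] W finP finW0 by (simp add: PiEW)
    also have "\<dots> = (\<Sum>y\<in>Z. real (card {p\<in>P. \<not> f (y(i := p))}))" by (rule swap[OF Z(1)])
    \<comment> \<open>Tuples satisfying \<open>f'\<close> fail with at most
      \<open>\<eta> / 2\<close> of \<open>P\<close>. The others may fail with all of
      \<open>P\<close>, but they make up at most the fraction \<open>\<eta> / 2\<close> of
      \<open>Z\<close>.\<close>
    also have "\<dots> \<le> (\<Sum>y\<in>Z. \<eta> / 2 * real (card P) + (if \<not> f' y then real (card P) else 0))"
    proof (rule sum_mono)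
      fix y
      have "real (card {p\<in>P. \<not> f (y(i := p))}) \<le> real (card P)" using finP by (intro of_nat_mono card_mono) auto
      moreover have "0 \<le> \<eta> / 2 * real (card P)" using insert.prems by simp
      ultimately show "real (card {p\<in>P. \<not> f (y(i := p))}) \<le> \<eta> / 2 * real (card P) + (if \<not> f' y then real (card P) else 0)"
        unfolding f'_def by (cases "real (card {p\<in>P. \<not> f (y(i := p))}) \<le> \<eta> / 2 * real (card P)") auto
    qed
    also have "\<dots> = real (card Z) * (\<eta> / 2 * real (card P)) + real (card {y\<in>Z. \<not> f' y}) * real (card P)"
      using Z(1) by (simp only: sum.distrib sum_constant sum.inter_filter[symmetric])
    also have "\<dots> \<le> real (card Z) * (\<eta> / 2 * real (card P)) + (\<eta> / 2 * real (card Z)) * real (card P)"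
      using W0(2) P0 unfolding Z(2) by (intro add_left_mono mult_right_mono) (auto simp: Z_def)
    also have "\<dots> = \<eta> * (\<Prod>l\<in>insert i I. real (card (W l)))" unfolding prodW Z(2) by simp
    finally have W_bad: "real (card {x\<in>PiE (insert i I) W. \<not> f x}) \<le> \<eta> * (\<Prod>l\<in>insert i I. real (card (W l)))" .
    have P_size: "\<epsilon> * a ^ (d - 1) * level_weight j / K * real (card (V i)) \<le> real (card P)"
      using P(6) by (simp add: a_def)
    have W_prod: "c * (\<epsilon> ^ (d * card (insert i J) + 1) * (\<Prod>l\<in>insert i I. real (card (V l)))) \<le> (\<Prod>l\<in>insert i I. real (card (W l)))"
    proof -
      define pv where "pv = (\<Prod>l\<in>I. real (card (V l)))"
      have pv: "0 \<le> pv" unfolding pv_def by (intro prod_nonneg) auto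
      have "c * (\<epsilon> ^ (m + 1) * (real (card (V i)) * pv)) \<le> c1 / (K * (4 * 4 ^ m)) * (\<epsilon> ^ (m + 1) * (real (card (V i)) * pv))"
        using c_le(5) \<epsilon> pv by (intro mult_right_mono) auto
      also have "\<dots> = c1 / K * \<epsilon> * (real (card (V i)) * pv) * ((\<epsilon> / 4) ^ m * (1 / 4))"
        by (simp add: power_divide mult_ac)
      \<comment> \<open>The factor \<open>(2 ^ j) ^ m\<close> between
        \<open>(\<epsilon> / 4) ^ m\<close> and \<open>a ^ m\<close> absorbs the weight;
        \<open>m\<close> is positive in every dimension.\<close>
      also have "\<dots> \<le> c1 / K * \<epsilon> * (real (card (V i)) * pv) * ((\<epsilon> / 4) ^ m * ((2 ^ j) ^ m * level_weight j))"
        using IH0 K \<epsilon> pv level_weight_growth[OF m(1), of j] by (intro mult_left_mono) auto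
      also have "(\<epsilon> / 4) ^ m * ((2 ^ j) ^ m * level_weight j) = a ^ m * level_weight j"
        unfolding a_def power_mult_distrib by simp
      \<comment> \<open>The first \<open>d - 1\<close> powers come from the size of
        \<open>P\<close>, the other \<open>d * card J + 1\<close> from the recursive box.\<close>
      also have "a ^ m = a ^ (d - 1) * a ^ (d * card J + 1)"
      proof -
        have "m = (d - 1) + (d * card J + 1)" using d by (simp add: m_def)
        then show ?thesis by (metis power_add)
      qed
      also have "c1 / K * \<epsilon> * (real (card (V i)) * pv) * (a ^ (d - 1) * a ^ (d * card J + 1) * level_weight j)
          = (\<epsilon> * a ^ (d - 1) * level_weight j / K * real (card (V i))) * (c1 * (a ^ (d * card J + 1) * pv))"
        by simp
      also have "\<dots> \<le> real (card P) * (\<Prod>l\<in>I. real (card (W0 l)))"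
        using P_size W0(3) IH0 a pv unfolding pv_def[symmetric] by (intro mult_mono) auto
      finally have "c * (\<epsilon> ^ (m + 1) * (real (card (V i)) * pv)) \<le> real (card P) * (\<Prod>l\<in>I. real (card (W0 l)))" .
      moreover have "d * card (insert i J) = m" using insert.hyps by (simp add: m_def)
      ultimately show ?thesis unfolding prodW prodV pv_def by simp
    qed
    have W_part: "c * (part_density d \<epsilon> * real (card (V l))) \<le> real (card (W l))" if l: "l \<in> insert i J" for l
    proof (cases "l = i")
      case True
      have pd: "0 \<le> part_density d \<epsilon>" by (rule part_density_bounds[OF \<epsilon>])
      have "c * (part_density d \<epsilon> * real (card (V i))) \<le> 1 / (K * (36 * 4 ^ d)) * (part_density d \<epsilon> * real (card (V i)))"
        using c_le(1) pd by (intro mult_right_mono) auto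
      also have "\<dots> = part_density d \<epsilon> / (36 * 4 ^ d) / K * real (card (V i))" by simp
      also have "\<dots> \<le> \<epsilon> * a ^ (d - 1) * level_weight j / K * real (card (V i))"
        using part_density_level[OF \<epsilon> P(3) d] K unfolding a_def[symmetric]
        by (intro mult_right_mono divide_right_mono) auto
      also have "\<dots> \<le> real (card P)" by (rule P_size)
      finally show ?thesis using True W by simp
    next
      case False
      then have lJ: "l \<in> J" "l \<in> I" using l by (auto simp: I_def)
      have pd: "0 \<le> part_density d \<epsilon>" by (rule part_density_bounds[OF \<epsilon>])
      have "c * (part_density d \<epsilon> * real (card (V l))) \<le> c1 / (36 * 4 ^ d) * (part_density d \<epsilon> * real (card (V l)))"
        using c_le(2) pd by (intro mult_right_mono) auto
      also have "\<dots> = c1 * (part_density d \<epsilon> / (36 * 4 ^ d) * real (card (V l)))" by simp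
      also have "\<dots> \<le> c1 * (part_density d a * real (card (V l)))"
        using part_density_quarter[OF \<epsilon> a(3,2), of d] IH0 by (intro mult_left_mono mult_right_mono) auto
      also have "\<dots> \<le> real (card (W l))" using W0(4) lJ W by simp
      finally show ?thesis .
    qed
    have W_k: "c * (\<epsilon> * real (card (V k))) \<le> real (card (W k))"
    proof -
      have "c * (\<epsilon> * real (card (V k))) \<le> c1 / 4 * (\<epsilon> * real (card (V k)))"
        using c_le(3) \<epsilon> by (intro mult_right_mono) auto
      also have "\<dots> = c1 * (\<epsilon> / 4 * real (card (V k)))" by simp
      also have "\<dots> \<le> c1 * (a * real (card (V k)))" using a IH0 by (intro mult_left_mono mult_right_mono) auto
      also have "\<dots> \<le> real (card (W k))" using W0(5) W(2)[of k] by (simp add: I_def)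
      finally show ?thesis .
    qed
    have "\<forall>l\<in>insert i I. W l \<subseteq> V l" using W W0(1) P(1) by auto
    then show "\<exists>W. (\<forall>i\<in>insert i I. W i \<subseteq> V i) \<and>
        real (card {x\<in>PiE (insert i I) W. \<not> f x}) \<le> \<eta> * (\<Prod>i\<in>insert i I. real (card (W i))) \<and>
        c * (\<epsilon> ^ (d * card (insert i J) + 1) * (\<Prod>i\<in>insert i I. real (card (V i)))) \<le> (\<Prod>i\<in>insert i I. real (card (W i))) \<and>
        (\<forall>i\<in>insert i J. c * (part_density d \<epsilon> * real (card (V i))) \<le> real (card (W i))) \<and>
        c * (\<epsilon> * real (card (V k))) \<le> real (card (W k))"
      using W_bad W_prod W_part W_k by blast
  qed (use \<eta>2 c0 c_le in auto)
qed

section \<open>Semi-algebraic hypergraphs\<close>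

text \<open>Degree \<open>d * D\<close>, because membership in \<open>exponents D\<close> limits
  every coordinate separately and not the total degree.\<close>

lemma polyfun_mon:
  assumes "\<alpha> \<in> exponents D"
  shows "polyfun (CARD('d) * D) (mon \<alpha> :: real ^ 'd::finite \<Rightarrow> real)"
proof -
  have pow: "polyfun n (\<lambda>p :: real ^ 'd. (p $ a) ^ n)" for n a
  proof (induction n)
    case (Suc n)
    show ?case using polyfun.mult[OF polyfun.coord[of 0 a] Suc] by simp
  qed (simp add: polyfun.const)
  have "polyfun (card (UNIV :: 'd set) * D) (\<lambda>p :: real ^ 'd. \<Prod>a\<in>UNIV. (p $ a) ^ \<alpha> a)"
    using assms by (intro polyfun_prod polyfun_mono[OF pow]) (auto simp: exponents_def)
  then show ?thesis by (simp add: mon_def[abs_def])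
qed

lemma tensors_mon_polyfun:
  fixes g :: "(nat \<Rightarrow> real ^ 'd::finite) \<Rightarrow> real"
  assumes "g \<in> tensors mon (exponents D) I" "finite I"
  shows "polyfun (CARD('d) * D) (\<lambda>p. g (y(i := p)))"
  using assms(1)
proof induction
  case zero
  show ?case by (rule polyfun.const)
next
  case (add_term g \<alpha> c)
  have "polyfun (CARD('d) * D) (\<lambda>p. \<Prod>l\<in>I. mon (\<alpha> l) ((y(i := p)) l))"
  proof (cases "i \<in> I")
    case True
    have "(\<Prod>l\<in>I. mon (\<alpha> l) ((y(i := p)) l)) = (\<Prod>l\<in>I - {i}. mon (\<alpha> l) (y l)) * mon (\<alpha> i) p" for p
    proof -
      have "(\<Prod>l\<in>I - {i}. mon (\<alpha> l) ((y(i := p)) l)) = (\<Prod>l\<in>I - {i}. mon (\<alpha> l) (y l))"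
        by (intro prod.cong) auto
      then show ?thesis using assms(2) True by (simp add: prod.remove)
    qed
    then show ?thesis using polyfun_scale[OF polyfun_mon[OF add_term.hyps(2)[OF True]]] by simp
  next
    case False
    then have "(\<Prod>l\<in>I. mon (\<alpha> l) ((y(i := p)) l)) = (\<Prod>l\<in>I. mon (\<alpha> l) (y l))" for p
      by (intro prod.cong) auto
    then show ?thesis by (simp add: polyfun.const)
  qed
  then show ?case using add_term.IH by (intro polyfun.add polyfun_scale) auto
qed

lemma holds_cong: "(\<And>a. a \<in> atoms \<Phi> \<Longrightarrow> \<beta> a = \<beta>' a) \<Longrightarrow> holds \<Phi> \<beta> = holds \<Phi> \<beta>'"
  by (induction \<Phi>) auto

text \<open>Each tuple \<open>ys u\<close> turns every \<open>g j\<close> into a polynomial in the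
  free point, so the pattern of a point can be read off, by \<open>h\<close>, from the signs of
  \<open>s * |U|\<close> polynomials in \<open>d\<close> variables. As \<open>U\<close> is nonempty,
  the additive constants may be multiplied by \<open>|U|\<close>, which leaves a pure power.\<close>

lemma pattern_bound_semialgebraic:
  fixes g :: "nat \<Rightarrow> (nat \<Rightarrow> real ^ 'd::finite) \<Rightarrow> real"
  assumes finI: "finite I" and g: "\<And>j. j \<in> {1..s} \<Longrightarrow> g j \<in> tensors mon (exponents D) I"
    and atoms: "atoms \<Phi> \<subseteq> {1..s}"
  shows "pattern_bound ((CARD('d) * (s * (CARD('d) * D) + 2) + 1) ^ CARD('d)) CARD('d)
    (\<lambda>x. holds \<Phi> (\<lambda>j. g j x \<le> 0)) i"
  unfolding pattern_bound_def
proof (intro allI impI)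
  fix U :: "nat set" and X :: "(real ^ 'd) set" and ys :: "nat \<Rightarrow> nat \<Rightarrow> real ^ 'd"
  assume U: "finite U" "U \<noteq> {}" and X: "finite X"
  define J where "J = U \<times> {1..s}"
  define F where "F t p = g (snd t) ((ys (fst t))(i := p))" for t p
  define h where "h \<sigma> = {u\<in>U. holds \<Phi> (\<lambda>j. (u, j) \<in> \<sigma>)}" for \<sigma>
  have "{u\<in>U. holds \<Phi> (\<lambda>j. g j ((ys u)(i := p)) \<le> 0)} = h {t\<in>J. F t p \<le> 0}" for p
  proof -
    have "holds \<Phi> (\<lambda>j. g j ((ys u)(i := p)) \<le> 0) = holds \<Phi> (\<lambda>j. (u, j) \<in> {t\<in>J. F t p \<le> 0})"
      if "u \<in> U" for u
      using atoms that by (intro holds_cong) (auto simp: J_def F_def)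
    then show ?thesis unfolding h_def by blast
  qed
  then have "(\<lambda>p. {u\<in>U. holds \<Phi> (\<lambda>j. g j ((ys u)(i := p)) \<le> 0)}) ` X = h ` (\<lambda>p. {t\<in>J. F t p \<le> 0}) ` X"
    by (simp add: image_image)
  then have "card ((\<lambda>p. {u\<in>U. holds \<Phi> (\<lambda>j. g j ((ys u)(i := p)) \<le> 0)}) ` X) \<le> card ((\<lambda>p. {t\<in>J. F t p \<le> 0}) ` X)"
    using X by (simp add: card_image_le)
  also have "\<dots> \<le> (CARD('d) * (card J * (CARD('d) * D) + 2) + 1) ^ CARD('d)"
  proof (rule card_sign_patterns[OF _ X])
    show "finite J" using U by (simp add: J_def)
    show "polyfun (CARD('d) * D) (F t)" if "t \<in> J" for t
    proof -
      have "g (snd t) \<in> tensors mon (exponents D) I" using that g by (auto simp: J_def)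
      then show ?thesis unfolding F_def[abs_def] by (rule tensors_mon_polyfun[OF _ finI])
    qed
  qed
  also have "\<dots> \<le> ((CARD('d) * (s * (CARD('d) * D) + 2) + 1) * card U) ^ CARD('d)"
  proof (rule power_mono)
    have cJ: "card J = card U * s" by (simp add: J_def card_cartesian_product)
    have "1 \<le> card U" using U by (simp add: Suc_le_eq card_gt_0_iff)
    then have "CARD('d) * 2 + 1 \<le> (CARD('d) * 2 + 1) * card U" using mult_le_mono2[of 1 "card U" "CARD('d) * 2 + 1"] by simp
    then show "CARD('d) * (card J * (CARD('d) * D) + 2) + 1 \<le> (CARD('d) * (s * (CARD('d) * D) + 2) + 1) * card U"
      unfolding cJ by (simp add: algebra_simps)
  qed simp
  finally show "card ((\<lambda>p. {u\<in>U. holds \<Phi> (\<lambda>j. g j ((ys u)(i := p)) \<le> 0)}) ` X)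
      \<le> (CARD('d) * (s * (CARD('d) * D) + 2) + 1) ^ CARD('d) * card U ^ CARD('d)"
    by (simp only: power_mult_distrib)
qed

lemma tensors_sum_terms:
  assumes "finite T" "\<And>t i. t \<in> T \<Longrightarrow> i \<in> I \<Longrightarrow> \<alpha> t i \<in> B"
  shows "(\<lambda>x. \<Sum>t\<in>T. c t * (\<Prod>i\<in>I. \<phi> (\<alpha> t i) (x i))) \<in> tensors \<phi> B I"
  using assms
proof (induction T rule: finite_induct)
  case empty
  then show ?case by (simp add: tensors.zero)
next
  case (insert t T)
  then have "(\<lambda>x. (\<Sum>t\<in>T. c t * (\<Prod>i\<in>I. \<phi> (\<alpha> t i) (x i))) + c t * (\<Prod>i\<in>I. \<phi> (\<alpha> t i) (x i))) \<in> tensors \<phi> B I"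
    by (intro tensors.add_term) auto
  then show ?case using insert.hyps by (simp add: add.commute)
qed

lemma lookup_le_total_degree:
  assumes "m \<in> Poly_Mapping.keys p"
  shows "Poly_Mapping.lookup m v \<le> total_degree p"
proof (cases "v \<in> Poly_Mapping.keys m")
  case True
  then have "Poly_Mapping.lookup m v \<le> monomial_degree m"
    unfolding monomial_degree_def by (intro member_le_sum) auto
  also have "\<dots> \<le> total_degree p"
    unfolding total_degree_def using assms by (intro Max_ge) auto
  finally show ?thesis .
qed (simp add: in_keys_iff)

text \<open>The factors of a monomial are sorted by the part \<open>i\<close> of their variable
  \<open>(a, i)\<close>, which makes it a product of monomials in single points. The total degree
  bounds each exponent.\<close>

lemma mpoly_eval_tuple_vector:
  fixes p :: "('d::finite \<times> nat) real_mpoly"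
  assumes vars: "mpoly_vars p \<subseteq> UNIV \<times> {1..k}" and deg: "total_degree p \<le> D"
  shows "(\<lambda>x. mpoly_eval p (tuple_vector k x)) \<in> tensors mon (exponents D) {1..k}"
proof -
  have "mpoly_eval p (tuple_vector k x) = (\<Sum>m\<in>Poly_Mapping.keys p. Poly_Mapping.lookup p m *
      (\<Prod>i\<in>{1..k}. mon (\<lambda>a. Poly_Mapping.lookup m (a, i)) (x i)))" for x
    unfolding mpoly_eval_def
  proof (intro sum.cong refl arg_cong2[where f = "(*)"])
    fix m assume m: "m \<in> Poly_Mapping.keys p"
    have sub: "Poly_Mapping.keys m \<subseteq> UNIV \<times> {1..k}" using vars m by (auto simp: mpoly_vars_def)
    have "(\<Prod>v\<in>Poly_Mapping.keys m. tuple_vector k x v ^ Poly_Mapping.lookup m v)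
        = (\<Prod>v\<in>UNIV \<times> {1..k}. tuple_vector k x v ^ Poly_Mapping.lookup m v)"
      using sub by (intro prod.mono_neutral_left) (auto simp: in_keys_iff)
    also have "\<dots> = (\<Prod>(a, i)\<in>UNIV \<times> {1..k}. (x i $ a) ^ Poly_Mapping.lookup m (a, i))"
      by (intro prod.cong) (auto simp: tuple_vector_def)
    also have "\<dots> = (\<Prod>a\<in>UNIV. \<Prod>i\<in>{1..k}. (x i $ a) ^ Poly_Mapping.lookup m (a, i))"
      by (rule prod.cartesian_product[symmetric])
    also have "\<dots> = (\<Prod>i\<in>{1..k}. mon (\<lambda>a. Poly_Mapping.lookup m (a, i)) (x i))"
      unfolding mon_def by (rule prod.swap)
    finally show "(\<Prod>v\<in>Poly_Mapping.keys m. tuple_vector k x v ^ Poly_Mapping.lookup m v)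
        = (\<Prod>i\<in>{1..k}. mon (\<lambda>a. Poly_Mapping.lookup m (a, i)) (x i))" .
  qed
  moreover have "(\<lambda>x. \<Sum>m\<in>Poly_Mapping.keys p. Poly_Mapping.lookup p m *
      (\<Prod>i\<in>{1..k}. mon (\<lambda>a. Poly_Mapping.lookup m (a, i)) (x i))) \<in> tensors mon (exponents D) {1..k}"
    using order_trans[OF lookup_le_total_degree deg]
    by (intro tensors_sum_terms) (auto simp: exponents_def)
  ultimately show ?thesis by simp
qed

lemma hypergraph_as_tensors:
  fixes V :: "nat \<Rightarrow> (real ^ 'd::finite) set"
  assumes "hypergraph_complexity_at_most k V E D s"
  obtains g \<Phi> where "\<And>j. g j \<in> tensors mon (exponents D) {1..k}" "atoms \<Phi> \<subseteq> {1..s}"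
    "E = {x \<in> PiE {1..k} V. holds \<Phi> (\<lambda>j. g j x \<le> 0)}"
proof -
  obtain D' s' where le: "D' \<le> D" "s' \<le> s" and "hypergraph_semialgebraic k V E D' s'"
    using assms unfolding hypergraph_complexity_at_most_def by blast
  then obtain Y where Y: "semialgebraic_description (UNIV \<times> {1..k}) D' s' Y"
    "E = {x \<in> PiE {1..k} V. tuple_vector k x \<in> Y}"
    unfolding hypergraph_semialgebraic_def by blast
  then obtain f :: "nat \<Rightarrow> ('d \<times> nat) real_mpoly" and \<Phi> where f:
    "\<And>j. j \<in> {1..s'} \<Longrightarrow> mpoly_vars (f j) \<subseteq> UNIV \<times> {1..k} \<and> total_degree (f j) \<le> D'"
    "atoms \<Phi> \<subseteq> {1..s'}"
    "Y = {y \<in> (UNIV \<times> {1..k}) \<rightarrow>\<^sub>E UNIV. holds \<Phi> (\<lambda>j. mpoly_eval (f j) y \<le> 0)}"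
    unfolding semialgebraic_description_def by blast
  \<comment> \<open>Indices above \<open>s'\<close> get the zero function, so that there are exactly
    \<open>s\<close> functions; the formula does not mention the added ones.\<close>
  define g where "g j = (if j \<in> {1..s'} then (\<lambda>x. mpoly_eval (f j) (tuple_vector k x)) else (\<lambda>x. 0))" for j
  show ?thesis
  proof (rule that[of g \<Phi>])
    show "g j \<in> tensors mon (exponents D) {1..k}" for j
    proof (cases "j \<in> {1..s'}")
      case True
      then have "mpoly_vars (f j) \<subseteq> UNIV \<times> {1..k}" "total_degree (f j) \<le> D" using f(1) le(1) by fastforce+
      then show ?thesis using True mpoly_eval_tuple_vector by (simp add: g_def)
    next
      case False
      then show ?thesis unfolding g_def by (simp only: if_False) (rule tensors.zero)
    qed
    show "atoms \<Phi> \<subseteq> {1..s}" using f(2) le(2) by fastforce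
    have "tuple_vector k x \<in> Y \<longleftrightarrow> holds \<Phi> (\<lambda>j. g j x \<le> 0)" for x
    proof -
      have "tuple_vector k x \<in> (UNIV \<times> {1..k}) \<rightarrow>\<^sub>E UNIV" by (auto simp: tuple_vector_def)
      moreover have "holds \<Phi> (\<lambda>j. mpoly_eval (f j) (tuple_vector k x) \<le> 0) = holds \<Phi> (\<lambda>j. g j x \<le> 0)"
        using f(2) by (intro holds_cong) (auto simp: g_def)
      ultimately show ?thesis unfolding f(3) by blast
    qed
    then show "E = {x \<in> PiE {1..k} V. holds \<Phi> (\<lambda>j. g j x \<le> 0)}" using Y(2) by simp
  qed
qed

theorem theorem1p6:
  fixes k D s :: nat
  assumes "k \<ge> 1"
  shows "\<exists>c>0. \<forall>(\<epsilon>::real) (V :: nat \<Rightarrow> (real ^ 'd::finite) set) E.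
    0 < \<epsilon> \<and> \<epsilon> \<le> 1 \<and>
    kpartite_hypergraph k V E \<and> hypergraph_complexity_at_most k V E D s \<and>
    real (card E) \<ge> \<epsilon> * (\<Prod>i=1..k. real (card (V i))) \<longrightarrow>
    (\<exists>W. (\<forall>i\<in>{1..k}. W i \<subseteq> V i) \<and>
         Pi\<^sub>E {1..k} W \<subseteq> E \<and>
         (\<Prod>i=1..k. real (card (W i)))
           \<ge> c * (\<epsilon> ^ (CARD('d) * (k - 1) + 1) * (\<Prod>i=1..k. real (card (V i)))) \<and>
         (\<forall>i\<in>{1..k-1}. real (card (W i)) \<ge> c * (part_density CARD('d) \<epsilon> * real (card (V i)))) \<and>
         real (card (W k)) \<ge> c * (\<epsilon> * real (card (V k))))"
proof -
  define d where "d = CARD('d)"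
  have d: "0 < d" by (simp add: d_def)
  define I where "I = {1..k}"
  define J where "J = {1..k - 1}"
  have I: "insert k J = I" "finite I" "finite J" "k \<notin> J" "card J = k - 1" "card I = k"
    using assms by (auto simp: I_def J_def)
  define B where "B = (CARD('d) * (s * (CARD('d) * D) + 2) + 1) ^ CARD('d)"
  have B: "0 < B" by (simp add: B_def)
  have fin_exp: "finite (exponents D :: ('d \<Rightarrow> nat) set)" by simp
  obtain cH where cH: "0 < cH" "cH \<le> 1" and hom: "\<And>(V :: nat \<Rightarrow> (real ^ 'd) set) gs.
      (\<forall>i\<in>I. finite (V i)) \<Longrightarrow> length gs = s \<Longrightarrow> set gs \<subseteq> tensors mon (exponents D) I \<Longrightarrow>
      (\<exists>W. shrinks cH I V W \<and> (\<forall>g\<in>set gs. sgn_const I W g))"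
    using tensors_homogeneous_box[OF fin_exp I(2), where \<phi> = mon and r = s] by blast
  have cHk: "0 < cH ^ k" "cH ^ k \<le> 1" "cH ^ k \<le> cH"
  proof -
    show "0 < cH ^ k" using cH by simp
    show "cH ^ k \<le> 1" using cH by (simp add: power_le_one)
    show "cH ^ k \<le> cH" using cH assms power_decreasing[of 1 k cH] by simp
  qed
  \<comment> \<open>A box of constant sign inside \<open>W\<close> keeps at least the fraction
    \<open>cH ^ k\<close> of its tuples; failures amounting to half of that cannot fill it.\<close>
  define \<eta> where "\<eta> = cH ^ k / 2"
  have \<eta>: "0 < \<eta>" "\<eta> \<le> 1" using cHk by (auto simp: \<eta>_def)
  obtain \<gamma> c1 where c1: "0 < \<gamma>" "0 < c1" "c1 \<le> 1" and dense: "\<And>(V :: nat \<Rightarrow> (real ^ 'd) set) e f \<epsilon>.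
      (\<forall>i\<in>I. finite (V i) \<and> V i \<noteq> {}) \<Longrightarrow> (\<forall>i\<in>J. pattern_bound B d e i) \<Longrightarrow> 0 < \<epsilon> \<Longrightarrow> \<epsilon> \<le> 1 \<Longrightarrow>
      \<epsilon> * (\<Prod>i\<in>I. real (card (V i))) \<le> real (card {x\<in>PiE I V. e x}) \<Longrightarrow>
      real (card {x\<in>PiE I V. e x \<and> \<not> f x}) \<le> \<gamma> * real (card {x\<in>PiE I V. e x}) \<Longrightarrow>
      (\<exists>W. (\<forall>i\<in>I. W i \<subseteq> V i) \<and>
        real (card {x\<in>PiE I W. \<not> f x}) \<le> \<eta> * (\<Prod>i\<in>I. real (card (W i))) \<and>
        c1 * (\<epsilon> ^ (d * card J + 1) * (\<Prod>i\<in>I. real (card (V i)))) \<le> (\<Prod>i\<in>I. real (card (W i))) \<and>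
        (\<forall>i\<in>J. c1 * (part_density d \<epsilon> * real (card (V i))) \<le> real (card (W i))) \<and>
        c1 * (\<epsilon> * real (card (V k))) \<le> real (card (W k)))"
    using dense_box[OF d B I(3,4) \<eta>, where 'a = "real ^ 'd"] unfolding I(1) by blast
  \<comment> \<open>The factor \<open>cH ^ k\<close> is lost in the product; for a single part the
    loss is only \<open>cH\<close>, which is no worse because \<open>k \<ge> 1\<close>.\<close>
  define c where "c = cH ^ k * c1"
  have c: "0 < c" "c \<le> 1" using cHk c1 by (auto simp: c_def intro: mult_le_one)
  show ?thesis
    unfolding d_def[symmetric] I_def[symmetric] J_def[symmetric]
  proof (intro exI[of _ c] conjI allI impI c(1); elim conjE)
    fix \<epsilon> :: real and V :: "nat \<Rightarrow> (real ^ 'd) set" and E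
    assume \<epsilon>: "0 < \<epsilon>" "\<epsilon> \<le> 1" and part: "kpartite_hypergraph k V E"
      and compl: "hypergraph_complexity_at_most k V E D s"
      and E: "\<epsilon> * (\<Prod>i\<in>I. real (card (V i))) \<le> real (card E)"
    have finV: "\<forall>i\<in>I. finite (V i)" using part by (simp add: kpartite_hypergraph_def I_def)
    have pd: "0 \<le> part_density d \<epsilon>" "part_density d \<epsilon> \<le> 1" using part_density_bounds[OF \<epsilon>] by auto
    show "\<exists>W. (\<forall>i\<in>I. W i \<subseteq> V i) \<and> PiE I W \<subseteq> E \<and>
         c * (\<epsilon> ^ (d * (k - 1) + 1) * (\<Prod>i\<in>I. real (card (V i)))) \<le> (\<Prod>i\<in>I. real (card (W i))) \<and>
         (\<forall>i\<in>J. c * (part_density d \<epsilon> * real (card (V i))) \<le> real (card (W i))) \<and>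
         c * (\<epsilon> * real (card (V k))) \<le> real (card (W k))"
    proof (cases "\<exists>i\<in>I. V i = {}")
      \<comment> \<open>The search for a dense box assumes nonempty parts. If some part is empty,
        \<open>V\<close> itself is a complete box and the product bound reads
        \<open>0 \<le> 0\<close>.\<close>
      case True
      have small: "c * (t * real n) \<le> real n" if "0 \<le> t" "t \<le> 1" for t and n :: nat
      proof -
        have "(c * t) * real n \<le> 1 * real n"
          using that c by (intro mult_right_mono mult_le_one) auto
        then show ?thesis by (simp add: mult.assoc)
      qed
      have "(\<Prod>i\<in>I. real (card (V i))) = 0"
        using True I(2) by (auto intro!: prod_zero) (metis card.empty)
      moreover have "PiE I V = {}" using True by (auto simp: PiE_eq_empty_iff)
      ultimately show ?thesis using small pd \<epsilon> by (intro exI[of _ V]) auto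
    next
      case False
      then have V: "\<forall>i\<in>I. finite (V i) \<and> V i \<noteq> {}" using finV by blast
      obtain g \<Phi> where g: "\<And>j. g j \<in> tensors mon (exponents D) I" "atoms \<Phi> \<subseteq> {1..s}"
        "E = {x \<in> PiE I V. holds \<Phi> (\<lambda>j. g j x \<le> 0)}"
        using hypergraph_as_tensors[OF compl] unfolding I_def by blast
      define e where "e x = holds \<Phi> (\<lambda>j. g j x \<le> 0)" for x
      have E_e: "E = {x \<in> PiE I V. e x}" by (simp add: g(3) e_def)
      have "\<forall>i\<in>J. pattern_bound B d e i"
        unfolding B_def d_def e_def[abs_def]
        by (intro ballI pattern_bound_semialgebraic[where I = I] I(2) g(1,2))
      \<comment> \<open>Both predicates start as the edge relation, so initially there are no
        failures.\<close>
      from dense[OF V this \<epsilon>, of e] E c1(1) obtain W where W: "\<forall>i\<in>I. W i \<subseteq> V i"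
        "real (card {x\<in>PiE I W. \<not> e x}) \<le> \<eta> * (\<Prod>i\<in>I. real (card (W i)))"
        "c1 * (\<epsilon> ^ (d * (k - 1) + 1) * (\<Prod>i\<in>I. real (card (V i)))) \<le> (\<Prod>i\<in>I. real (card (W i)))"
        "\<forall>i\<in>J. c1 * (part_density d \<epsilon> * real (card (V i))) \<le> real (card (W i))"
        "c1 * (\<epsilon> * real (card (V k))) \<le> real (card (W k))"
        unfolding E_e I(5) by auto
      have finW: "\<forall>i\<in>I. finite (W i)" using W(1) finV finite_subset by blast
      have "0 < (\<Prod>i\<in>I. real (card (V i)))" using V by (intro prod_pos) (auto simp: card_gt_0_iff)
      then have "0 < c1 * (\<epsilon> ^ (d * (k - 1) + 1) * (\<Prod>i\<in>I. real (card (V i))))" using c1 \<epsilon> by simp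
      then have W0: "0 < (\<Prod>i\<in>I. real (card (W i)))" using W(3) by linarith
      define gs where "gs = map g [1..<Suc s]"
      have gs: "length gs = s" "set gs = g ` {1..s}" by (auto simp: gs_def)
      have "set gs \<subseteq> tensors mon (exponents D) I" using g(1) by (auto simp: gs(2))
      then obtain U where U: "shrinks cH I W U" "\<forall>h\<in>g ` {1..s}. sgn_const I U h"
        using hom[OF finW gs(1)] unfolding gs(2) by blast
      have finU: "\<forall>i\<in>I. finite (U i)" by (rule shrinks_finite[OF U(1) finW])
      have UW: "U i \<subseteq> W i" "cH * real (card (W i)) \<le> real (card (U i))" if "i \<in> I" for i
        using U(1) that by (auto simp: shrinks_def)
      have "(\<Prod>i\<in>I. cH * real (card (W i))) \<le> (\<Prod>i\<in>I. real (card (U i)))"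
        using UW(2) cH by (intro prod_mono) auto
      then have U_prod: "cH ^ k * (\<Prod>i\<in>I. real (card (W i))) \<le> (\<Prod>i\<in>I. real (card (U i)))"
        by (simp add: prod.distrib I(6))
      have cardU: "real (card (PiE I U)) = (\<Prod>i\<in>I. real (card (U i)))"
        using finU I(2) by (simp add: card_PiE)
      have all_e: "e x" if x: "x \<in> PiE I U" for x
      proof (rule ccontr)
        assume "\<not> e x"
        have "\<not> e z" if z: "z \<in> PiE I U" for z
        proof -
          have "(g j z \<le> 0) = (g j x \<le> 0)" if "j \<in> {1..s}" for j
          proof -
            have "sgn_const I U (g j)" using U(2) that by blast
            then have "sgn (g j z) = sgn (g j x)" using x z unfolding sgn_const_def by blast
            then show ?thesis by (metis not_le sgn_greater)
          qed
          then have "e z = e x" unfolding e_def using g(2) by (intro holds_cong) auto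
          then show ?thesis using \<open>\<not> e x\<close> by simp
        qed
        moreover have "PiE I U \<subseteq> PiE I W" using UW(1) by (intro PiE_mono) auto
        ultimately have "PiE I U \<subseteq> {x\<in>PiE I W. \<not> e x}" by blast
        moreover have "finite (PiE I W)" using finW I(2) by (intro finite_PiE) auto
        ultimately have "real (card (PiE I U)) \<le> real (card {x\<in>PiE I W. \<not> e x})"
          by (intro of_nat_mono card_mono) auto
        then have "cH ^ k * (\<Prod>i\<in>I. real (card (W i))) \<le> \<eta> * (\<Prod>i\<in>I. real (card (W i)))"
          using U_prod W(2) cardU by linarith
        then show False using W0 cHk(1) by (simp add: \<eta>_def)
      qed
      have c_le: "c * t \<le> real (card (U i))" if "c1 * t \<le> real (card (W i))" "0 \<le> t" "i \<in> I" for t i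
      proof -
        have "c * t = cH ^ k * (c1 * t)" by (simp add: c_def)
        also have "\<dots> \<le> cH ^ k * real (card (W i))" using that cHk by (intro mult_left_mono) auto
        also have "\<dots> \<le> cH * real (card (W i))" using cHk by (intro mult_right_mono) auto
        also have "\<dots> \<le> real (card (U i))" using UW(2) that by blast
        finally show ?thesis .
      qed
      have UV: "\<forall>i\<in>I. U i \<subseteq> V i" using UW(1) W(1) by blast
      have "PiE I U \<subseteq> E"
      proof
        fix x assume x: "x \<in> PiE I U"
        then have "x \<in> PiE I V" using UV PiE_mono[of I U V] by blast
        then show "x \<in> E" using all_e[OF x] by (simp add: E_e)
      qed
      moreover have "c * (\<epsilon> ^ (d * (k - 1) + 1) * (\<Prod>i\<in>I. real (card (V i)))) \<le> (\<Prod>i\<in>I. real (card (U i)))"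
      proof -
        have "c * (\<epsilon> ^ (d * (k - 1) + 1) * (\<Prod>i\<in>I. real (card (V i))))
            = cH ^ k * (c1 * (\<epsilon> ^ (d * (k - 1) + 1) * (\<Prod>i\<in>I. real (card (V i)))))" by (simp add: c_def)
        also have "\<dots> \<le> cH ^ k * (\<Prod>i\<in>I. real (card (W i)))" using W(3) cHk by (intro mult_left_mono) auto
        also note U_prod
        finally show ?thesis .
      qed
      moreover have "\<forall>i\<in>J. c * (part_density d \<epsilon> * real (card (V i))) \<le> real (card (U i))"
        using W(4) pd I(1) by (intro ballI c_le) auto
      moreover have "c * (\<epsilon> * real (card (V k))) \<le> real (card (U k))"
        using W(5) \<epsilon> I(1) by (intro c_le) auto
      ultimately show ?thesis using UV by (intro exI[of _ U]) blast
    qed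
  qed
qed

end
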